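(* Assuming the Exponential Time Hypothesis, for any constant $\delta > 0$ there is no algorithm that solves the (parameterized) minimum fill-in problem in time $2^{O(k^{1/2-\delta})}\cdot n^{O(1)}$, where $n$ is the number of vertices of the input graph and $k$ is the parameter.
   Context: All graphs are finite, undirected and simple. A graph is chordal if it has no induced cycle of length at least four. A fill-in of a graph $G$ is a set $E_+$ of non-edges of $G$ such that $G + E_+$ (the graph with vertex set $V(G)$ and edge set $E(G)\cup E_+$) is chordal. Parameterized minimum fill-in problem: given a graph $G$ and an integer parameter $k$, decide whether $G$ has a fill-in of size at most $k$. Exponential Time Hypothesis: the satisfiability problem for CNF formulas with at most 3 variables per clause (3SAT) cannot be solved in time $2^{o(m+n)}$, where $m$ and $n$ denote the numbers of clauses and of variables of the formula. *)

theory Defs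
  imports Complex_Main "HOL-Library.Landau_Symbols" "HOL-Library.Ramsey"
begin

section \<open>Algorithms and running time\<close>

text \<open>
  Algorithms are random access machine programs: finitely many registers are addressed
  directly by a program, and an unbounded memory is addressed indirectly. All cells hold
  natural numbers, the arithmetic is addition and truncated subtraction, and every
  elementary instruction and every test costs one time unit. As there is no multiplication,
  the bit length of the largest number present grows by at most one per instruction (up to
  the constants of the program), so that this unit-cost model is polynomially equivalent to
  Turing machines. Polynomial overheads do not affect any of the time bounds used below.
\<close>

type_synonym state = "(nat \<Rightarrow> nat) \<times> (nat \<Rightarrow> nat)"  \<comment> \<open>registers, memory\<close>

datatype prog =
    Const nat nat
  | Add nat nat nat
  | Sub nat nat nat
  | Load nat nat
  | Store nat nat
  | Seq prog prog
  | Cond nat prog prog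
  | While nat prog

text \<open>\<open>exec p s t s'\<close>: started in state \<open>s\<close>, the program \<open>p\<close> halts in state \<open>s'\<close> after exactly
  \<open>t\<close> time units.\<close>

inductive exec :: "prog \<Rightarrow> state \<Rightarrow> nat \<Rightarrow> state \<Rightarrow> bool" where
  Const: "exec (Const r c) (R, M) 1 (R(r := c), M)"
| Add: "exec (Add r a b) (R, M) 1 (R(r := R a + R b), M)"
| Sub: "exec (Sub r a b) (R, M) 1 (R(r := R a - R b), M)"
| Load: "exec (Load r a) (R, M) 1 (R(r := M (R a)), M)"
| Store: "exec (Store a b) (R, M) 1 (R, M(R a := R b))"
| Seq: "exec p s t s' \<Longrightarrow> exec q s' u s'' \<Longrightarrow> exec (Seq p q) s (t + u) s''"
| CondTrue: "fst s r \<noteq> 0 \<Longrightarrow> exec p s t s' \<Longrightarrow> exec (Cond r p q) s (Suc t) s'"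
| CondFalse: "fst s r = 0 \<Longrightarrow> exec q s t s' \<Longrightarrow> exec (Cond r p q) s (Suc t) s'"
| WhileFalse: "fst s r = 0 \<Longrightarrow> exec (While r p) s 1 s"
| WhileTrue: "fst s r \<noteq> 0 \<Longrightarrow> exec p s t s' \<Longrightarrow> exec (While r p) s' u s'' \<Longrightarrow>
    exec (While r p) s (Suc (t + u)) s''"

inductive_cases exec_cases:
  "exec (Const r c) s t s'" "exec (Add r a b) s t s'" "exec (Sub r a b) s t s'"
  "exec (Load r a) s t s'" "exec (Store a b) s t s'" "exec (Seq p q) s t s'"
  "exec (Cond r p q) s t s'" "exec (While r p) s t s'"

lemma exec_deterministic:
  "exec p s t s' \<Longrightarrow> exec p s u s'' \<Longrightarrow> u = t \<and> s'' = s'"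
proof (induction arbitrary: u s'' rule: exec.induct)
  case (Seq p s t s1 q v s2)
  from Seq.prems obtain t' s1' v' where
    "exec p s t' s1'" "exec q s1' v' s''" "u = t' + v'"
    by (rule exec_cases)
  with Seq.IH(1)[of t' s1'] Seq.IH(2)[of v' s''] show ?case
    by simp
next
  case (CondTrue s r p t s' q)
  from CondTrue.prems obtain t' where "exec p s t' s''" "u = Suc t'"
    by (rule exec_cases) (use CondTrue.hyps in simp_all)
  with CondTrue.IH[of t' s''] show ?case
    by simp
next
  case (CondFalse s r q t s' p)
  from CondFalse.prems obtain t' where "exec q s t' s''" "u = Suc t'"
    by (rule exec_cases) (use CondFalse.hyps in simp_all)
  with CondFalse.IH[of t' s''] show ?case
    by simp
next
  case (WhileFalse s r p)
  from WhileFalse.prems show ?case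
    by (rule exec_cases) (use WhileFalse.hyps in simp_all)
next
  case (WhileTrue s r p t s1 v s2)
  from WhileTrue.prems obtain t' s1' v' where
    "exec p s t' s1'" "exec (While r p) s1' v' s''" "u = Suc (t' + v')"
    by (rule exec_cases) (use WhileTrue.hyps in simp_all)
  with WhileTrue.IH(1)[of t' s1'] WhileTrue.IH(2)[of v' s''] show ?case
    by simp
qed (erule exec_cases; simp)+

definition init_state :: "nat list \<Rightarrow> state" where
  "init_state ws = ((\<lambda>_. 0), (\<lambda>i. if i < length ws then ws ! i else 0))"

text \<open>The program \<open>p\<close> decides the problem with instance set \<open>I\<close>, input encoding \<open>enc\<close> and
  yes-instances \<open>Q\<close> within time \<open>T\<close>. The answer is yes iff register 0 is nonzero on
  halting.\<close>

definition decides_in_time ::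
  "prog \<Rightarrow> 'i set \<Rightarrow> ('i \<Rightarrow> nat list) \<Rightarrow> ('i \<Rightarrow> bool) \<Rightarrow> ('i \<Rightarrow> real) \<Rightarrow> bool" where
  "decides_in_time p I enc Q T \<longleftrightarrow>
     (\<forall>x\<in>I. \<exists>t s. exec p (init_state (enc x)) t s \<and> real t \<le> T x \<and> (fst s 0 \<noteq> 0 \<longleftrightarrow> Q x))"


section \<open>3SAT and the Exponential Time Hypothesis\<close>

datatype literal = Pos (var: nat) | Neg (var: nat)

text \<open>A CNF formula \<open>(n, cs)\<close> is a list \<open>cs\<close> of clauses over the variables \<open>0, \<dots>, n - 1\<close>.
  A clause is a set of literals, presented as a list without repetitions.\<close>

type_synonym cnf = "nat \<times> literal list list"

definition three_cnf :: "cnf set" where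
  "three_cnf = {(n, cs). \<forall>C\<in>set cs.
     distinct C \<and> var ` set C \<subseteq> {..<n} \<and> card (var ` set C) \<le> 3}"

fun lit_true :: "(nat \<Rightarrow> bool) \<Rightarrow> literal \<Rightarrow> bool" where
  "lit_true \<alpha> (Pos v) \<longleftrightarrow> \<alpha> v"
| "lit_true \<alpha> (Neg v) \<longleftrightarrow> \<not> \<alpha> v"

definition satisfiable :: "cnf \<Rightarrow> bool" where
  "satisfiable = (\<lambda>(n, cs). \<exists>\<alpha>. \<forall>C\<in>set cs. \<exists>l\<in>set C. lit_true \<alpha> l)"

fun lit_code :: "literal \<Rightarrow> nat" where
  "lit_code (Pos v) = 2 * v"
| "lit_code (Neg v) = 2 * v + 1"

definition encode_cnf :: "cnf \<Rightarrow> nat list" where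
  "encode_cnf = (\<lambda>(n, cs). n # length cs # concat (map (\<lambda>C. length C # map lit_code C) cs))"

definition ETH :: bool where
  "ETH \<longleftrightarrow> \<not> (\<exists>p (f :: nat \<Rightarrow> real). f \<in> o(\<lambda>N. real N) \<and>
     decides_in_time p three_cnf encode_cnf satisfiable
       (\<lambda>(n, cs). 2 powr f (length cs + n)))"


section \<open>Minimum fill-in\<close>

text \<open>A graph is given by a finite vertex set \<open>V\<close> and a set \<open>E\<close> of two-element subsets
  of \<open>V\<close>.\<close>

definition simple_graph :: "'a set \<Rightarrow> 'a set set \<Rightarrow> bool" where
  "simple_graph V E \<longleftrightarrow> finite V \<and> E \<subseteq> nsets V 2"

definition induced_cycle :: "'a set \<Rightarrow> 'a set set \<Rightarrow> 'a list \<Rightarrow> bool" where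
  "induced_cycle V E vs \<longleftrightarrow> 3 \<le> length vs \<and> distinct vs \<and> set vs \<subseteq> V \<and>
     (\<forall>i j. i < j \<longrightarrow> j < length vs \<longrightarrow>
        ({vs ! i, vs ! j} \<in> E \<longleftrightarrow> j = i + 1 \<or> (i = 0 \<and> j = length vs - 1)))"

definition chordal :: "'a set \<Rightarrow> 'a set set \<Rightarrow> bool" where
  "chordal V E \<longleftrightarrow> \<not> (\<exists>vs. induced_cycle V E vs \<and> 4 \<le> length vs)"

definition fill_in :: "'a set \<Rightarrow> 'a set set \<Rightarrow> 'a set set \<Rightarrow> bool" where
  "fill_in V E F \<longleftrightarrow> F \<subseteq> nsets V 2 - E \<and> chordal V (E \<union> F)"

text \<open>An instance \<open>(n, E, k)\<close> consists of a graph on the vertices \<open>0, \<dots>, n - 1\<close> and the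
  parameter. It is given to a program as \<open>n\<close>, \<open>k\<close> and the adjacency matrix, row by row.\<close>

type_synonym fill_in_instance = "nat \<times> nat set set \<times> nat"

definition fill_in_instances :: "fill_in_instance set" where
  "fill_in_instances = {(n, E, k). simple_graph {..<n} E}"

definition has_small_fill_in :: "fill_in_instance \<Rightarrow> bool" where
  "has_small_fill_in = (\<lambda>(n, E, k). \<exists>F. fill_in {..<n} E F \<and> card F \<le> k)"

definition encode_fill_in :: "fill_in_instance \<Rightarrow> nat list" where
  "encode_fill_in = (\<lambda>(n, E, k).
     n # k # concat (map (\<lambda>u. map (\<lambda>v. of_bool ({u, v} \<in> E)) [0..<n]) [0..<n]))"

text \<open>Running time \<open>2^O(g(k)) \<cdot> n^O(1)\<close>. The polynomial factor is written with base \<open>n + 2\<close>, so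
  that it absorbs constant factors also for graphs with at most one vertex (there \<open>n\<^sup>c\<close> would
  be 0 or 1, which no algorithm meets); for \<open>n \<ge> 2\<close> it is the same class.\<close>

definition solves_fill_in_subexp :: "prog \<Rightarrow> (nat \<Rightarrow> real) \<Rightarrow> bool" where
  "solves_fill_in_subexp p g \<longleftrightarrow> (\<exists>(f :: nat \<Rightarrow> real) (c :: nat). f \<in> O(g) \<and>
     decides_in_time p fill_in_instances encode_fill_in has_small_fill_in
       (\<lambda>(n, E, k). 2 powr f k * real (n + 2) ^ c))"

end

theory Submission imports Defs begin

text \<open>
  A 3CNF formula with \<open>l\<close> clauses is turned, in polynomial time, into a fill-in instance with
  \<open>k = O(l\<^sup>2)\<close>. Fill-in in time \<open>2^O(k^(1/2 - \<delta>))\<close> would then give satisfiability in time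
  \<open>2^O(l^(1 - 2 \<delta>))\<close>. No gap-creating reduction is needed, because the fill-in number of the
  constructed graph is known exactly.

  First, the literal occurrences, in conflict when they are complementary or belong to the same
  clause, form a graph \<open>G\<close> on \<open>n \<le> 6 l\<close> vertices that has \<open>l\<close> independent vertices iff the formula
  is satisfiable. From \<open>G\<close> we build a graph \<open>H\<close> with two vertices \<open>A\<^sub>u\<close> and \<open>B\<^sub>u\<close> for every vertex
  \<open>u\<close>, a clique \<open>Y\<close> of size \<open>n\<close>, and a clique \<open>K\<close> containing disjoint sets \<open>P\<^sub>u\<close> of size
  \<open>n + deg u + 1\<close>. The \<open>B\<^sub>u\<close> form a clique with \<open>K\<close>; \<open>Y\<close> is complete to \<open>K\<close> and to all \<open>A\<^sub>u\<close>; \<open>A\<^sub>u\<close> is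
  adjacent to \<open>B\<^sub>u\<close>, to \<open>K - P\<^sub>u\<close> and to \<open>A\<^sub>w\<close> for the neighbours \<open>w\<close> of \<open>u\<close> in \<open>G\<close>.
  The 4-cycles \<open>y k B\<^sub>u A\<^sub>u\<close> with \<open>k \<in> P\<^sub>u\<close> force a chordal supergraph to join \<open>B\<^sub>u\<close> to all of \<open>Y\<close> or \<open>A\<^sub>u\<close>
  to all of \<open>P\<^sub>u\<close>. Let \<open>C\<close> consist of the \<open>u\<close> of the second kind. The 4-cycles
  \<open>A\<^sub>u A\<^sub>w k k'\<close> with \<open>k \<in> P\<^sub>u\<close> and \<open>k' \<in> P\<^sub>w\<close> show that \<open>C\<close> is a vertex cover of \<open>G\<close>. The cycles
  through a vertex of \<open>Y\<close>, two \<open>A\<close> and two \<open>B\<close> vertices force \<open>|C| (n - 1)\<close> further edges, except that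
  one is saved for every edge of \<open>G\<close> inside \<open>C\<close>. As \<open>C\<close> is a vertex cover, the summands \<open>deg u\<close> in \<open>|P\<^sub>u|\<close>
  exactly compensate these savings, up to the constant \<open>|E(G)|\<close>. Hence the fill-in number of \<open>H\<close> is
  \<open>n\<^sup>2 + |E(G)| + n \<tau>\<close>, where \<open>\<tau>\<close> is the vertex cover number of \<open>G\<close>.
\<close>

section \<open>Chordal graphs\<close>

lemma induced_cycle_edge_iff:
  assumes "induced_cycle V E vs" "i < length vs" "j < length vs" "i \<noteq> j"
  shows "{vs ! i, vs ! j} \<in> E \<longleftrightarrow> j = Suc i \<or> i = Suc j \<or>
    (i = 0 \<and> j = length vs - 1) \<or> (j = 0 \<and> i = length vs - 1)"
proof (cases "i < j")
  case True
  then show ?thesis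
    using assms unfolding induced_cycle_def by auto
next
  case False
  then have "j < i" using assms by simp
  then show ?thesis
    using assms insert_commute[of "vs ! i" "vs ! j" "{}"] unfolding induced_cycle_def by auto
qed

text \<open>On an induced cycle of length at least four, the two cycle neighbours of a vertex of
  minimal rank are non-adjacent, against the hypothesis. Ranks may tie, so the vertices of a clique
  can share one rank.\<close>

lemma chordal_if_elimination_rank:
  fixes r :: "'a \<Rightarrow> nat"
  assumes "\<And>v a b. v \<in> V \<Longrightarrow> a \<in> V \<Longrightarrow> b \<in> V \<Longrightarrow> a \<noteq> b \<Longrightarrow> a \<noteq> v \<Longrightarrow> b \<noteq> v \<Longrightarrow>
    {v, a} \<in> E \<Longrightarrow> {v, b} \<in> E \<Longrightarrow> r v \<le> r a \<Longrightarrow> r v \<le> r b \<Longrightarrow> {a, b} \<in> E"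
  shows "chordal V E"
  unfolding chordal_def
proof clarify
  fix vs assume c: "induced_cycle V E vs" and len: "4 \<le> length vs"
  let ?L = "length vs"
  obtain i where i: "i < ?L" and min: "\<And>j. j < ?L \<Longrightarrow> r (vs ! i) \<le> r (vs ! j)"
    using ex_has_least_nat[of "\<lambda>i. i < ?L" 0 "\<lambda>i. r (vs ! i)"] len
    by (metis less_le_trans zero_less_numeral)
  have "\<exists>a b. a < ?L \<and> b < ?L \<and> a \<noteq> i \<and> b \<noteq> i \<and> a \<noteq> b \<and> {vs ! i, vs ! a} \<in> E \<and>
    {vs ! i, vs ! b} \<in> E \<and> {vs ! a, vs ! b} \<notin> E"
  proof -
    note iff = induced_cycle_edge_iff[OF c]
    have ne: "vs \<noteq> []" using i by auto
    \<comment> \<open>The cycle closes up at the ends of the list, so the two neighbours of position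
      \<open>i\<close> have a different form at the first and the last position.\<close>
    consider "i = 0" | "i = ?L - 1" "i > 0" | "i > 0" "Suc i < ?L"
      using i by linarith
    then show ?thesis
    proof cases
      case 1
      have "{vs ! i, vs ! 1} \<in> E" "{vs ! i, vs ! (?L - 1)} \<in> E" "{vs ! 1, vs ! (?L - 1)} \<notin> E"
        by (subst iff; use 1 len ne in \<open>simp; arith?\<close>)+
      then show ?thesis
        using 1 len by - (rule exI[of _ 1], rule exI[of _ "?L - 1"], auto)
    next
      case 2
      have "{vs ! i, vs ! (i - 1)} \<in> E" "{vs ! i, vs ! 0} \<in> E" "{vs ! (i - 1), vs ! 0} \<notin> E"
        by (subst iff; use 2 len ne in \<open>simp; arith?\<close>)+
      then show ?thesis
        using 2 len by - (rule exI[of _ "i - 1"], rule exI[of _ 0], auto)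
    next
      case 3
      have "{vs ! i, vs ! (i - 1)} \<in> E" "{vs ! i, vs ! Suc i} \<in> E" "{vs ! (i - 1), vs ! Suc i} \<notin> E"
        by (subst iff; use 3 len ne in \<open>simp; arith?\<close>)+
      then show ?thesis
        using 3 by - (rule exI[of _ "i - 1"], rule exI[of _ "Suc i"], auto)
    qed
  qed
  then obtain a b where ab: "a < ?L" "b < ?L" "a \<noteq> i" "b \<noteq> i" "a \<noteq> b"
    and E: "{vs ! i, vs ! a} \<in> E" "{vs ! i, vs ! b} \<in> E" "{vs ! a, vs ! b} \<notin> E"
    by blast
  have vs: "distinct vs" "set vs \<subseteq> V" using c by (simp_all add: induced_cycle_def)
  then have "vs ! j \<in> V" if "j < ?L" for j using that nth_mem by blast
  moreover have "vs ! a \<noteq> vs ! b" "vs ! a \<noteq> vs ! i" "vs ! b \<noteq> vs ! i"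
    using ab i by (simp_all add: nth_eq_iff_index_eq[OF vs(1)])
  ultimately show False
    using assms[of "vs ! i" "vs ! a" "vs ! b"] E ab(1,2) i min by blast
qed

lemma chordal_cycle4:
  assumes "chordal V E" "distinct [a, b, c, d]" "{a, b, c, d} \<subseteq> V"
    "{a, b} \<in> E" "{b, c} \<in> E" "{c, d} \<in> E" "{d, a} \<in> E"
  shows "{a, c} \<in> E \<or> {b, d} \<in> E"
proof (rule ccontr)
  assume "\<not> ?thesis"
  then have "induced_cycle V E [a, b, c, d]"
    using assms by (auto simp: induced_cycle_def less_Suc_eq numeral_eq_Suc insert_commute)
  then show False
    using assms(1) by (auto simp: chordal_def)
qed

lemma chordal_cycle5:
  assumes "chordal V E" "distinct [a, b, c, d, e]" "{a, b, c, d, e} \<subseteq> V"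
    "{a, b} \<in> E" "{b, c} \<in> E" "{c, d} \<in> E" "{d, e} \<in> E" "{e, a} \<in> E"
  shows "{a, c} \<in> E \<or> {a, d} \<in> E \<or> {b, d} \<in> E \<or> {b, e} \<in> E \<or> {c, e} \<in> E"
proof (rule ccontr)
  assume "\<not> ?thesis"
  then have "induced_cycle V E [a, b, c, d, e]"
    using assms by (auto simp: induced_cycle_def less_Suc_eq numeral_eq_Suc insert_commute)
  then show False
    using assms(1) by (auto simp: chordal_def)
qed

section \<open>From vertex cover to fill-in\<close>

text \<open>
  The vertices of the constructed graph are \<open>0, \<dots>, m - 1\<close>: first \<open>Y\<close>, then the \<open>A\<^sub>u\<close>, the \<open>B\<^sub>u\<close>, and
  finally \<open>K\<close>. For \<open>k\<close> in \<open>K\<close>, \<open>val k = u\<close> means \<open>k \<in> P\<^sub>u\<close>, and values \<open>\<ge> n\<close> mark vertices in no \<open>P\<^sub>u\<close>.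
  As \<open>conf\<close> is reflexive, \<open>card_owned\<close> says that \<open>P\<^sub>u\<close> has \<open>n + deg u + 1\<close> elements.
\<close>

locale gadget =
  fixes n m :: nat and conf :: "nat \<Rightarrow> nat \<Rightarrow> bool" and val :: "nat \<Rightarrow> nat"
  assumes conf_sym: "conf u w \<longleftrightarrow> conf w u"
    and conf_refl: "u < n \<Longrightarrow> conf u u"
    and m: "3 * n \<le> m"
    and val_A: "u < n \<Longrightarrow> val (n + u) = u"
    and val_B: "u < n \<Longrightarrow> val (2 * n + u) = u"
    and card_owned: "u < n \<Longrightarrow> card {k \<in> {3 * n..<m}. val k = u} = n + card {w. w < n \<and> conf u w}"
begin

text \<open>The codes of the four classes are chosen such that the sums 2, 3, 4, 10 of two codes, at which
  adjacency is not automatic, each come from only one pair of classes.\<close>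

definition cls :: "nat \<Rightarrow> nat" where
  "cls a = (if a < n then 0 else if a < 2 * n then 1 else if a < 3 * n then 3 else 9)"

text \<open>The sums mean: 3 for \<open>Y\<close> and \<open>B\<close>, 2 for two \<open>A\<close>
  vertices, 4 for \<open>A\<close> and \<open>B\<close>, 10 for \<open>A\<close> and
  \<open>K\<close>. All other pairs of classes are completely joined.\<close>

definition adj :: "nat \<Rightarrow> nat \<Rightarrow> bool" where
  "adj a b \<longleftrightarrow> a \<noteq> b \<and> (let s = cls a + cls b in
     if s = 3 then False else if s = 2 then conf (val a) (val b)
     else if s = 4 then val a = val b else if s = 10 then val a \<noteq> val b else True)"

definition edges :: "nat set set" where
  "edges = {{a, b} | a b. a < m \<and> b < m \<and> adj a b}"

definition edge_count :: nat where
  "edge_count = card {(u, w). u < w \<and> w < n \<and> conf u w}"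

definition independent :: "nat set \<Rightarrow> bool" where
  "independent I \<longleftrightarrow> I \<subseteq> {..<n} \<and> (\<forall>u\<in>I. \<forall>w\<in>I. u \<noteq> w \<longrightarrow> \<not> conf u w)"

abbreviation A :: "nat \<Rightarrow> nat" where "A u \<equiv> n + u"
abbreviation B :: "nat \<Rightarrow> nat" where "B u \<equiv> 2 * n + u"
abbreviation owned :: "nat \<Rightarrow> nat set" where "owned u \<equiv> {k \<in> {3 * n..<m}. val k = u}"

lemma adj_sym: "adj a b \<longleftrightarrow> adj b a"
  unfolding adj_def Let_def using conf_sym by (auto simp: add.commute)

lemma edges_iff: "a < m \<Longrightarrow> b < m \<Longrightarrow> {a, b} \<in> edges \<longleftrightarrow> adj a b"
  unfolding edges_def using adj_sym by (auto simp: doubleton_eq_iff)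

lemma simple_graph_edges: "simple_graph {..<m} edges"
  unfolding simple_graph_def edges_def nsets_def by (auto simp: adj_def)

lemma adj_simps:
  "y < n \<Longrightarrow> y' < n \<Longrightarrow> adj y y' \<longleftrightarrow> y \<noteq> y'"
  "y < n \<Longrightarrow> u < n \<Longrightarrow> adj y (A u)"
  "y < n \<Longrightarrow> u < n \<Longrightarrow> adj (A u) y"
  "y < n \<Longrightarrow> u < n \<Longrightarrow> \<not> adj y (B u)"
  "y < n \<Longrightarrow> u < n \<Longrightarrow> \<not> adj (B u) y"
  "y < n \<Longrightarrow> 3 * n \<le> k \<Longrightarrow> adj y k"
  "y < n \<Longrightarrow> 3 * n \<le> k \<Longrightarrow> adj k y"
  "u < n \<Longrightarrow> w < n \<Longrightarrow> adj (A u) (A w) \<longleftrightarrow> u \<noteq> w \<and> conf u w"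
  "u < n \<Longrightarrow> w < n \<Longrightarrow> adj (A u) (B w) \<longleftrightarrow> u = w"
  "u < n \<Longrightarrow> w < n \<Longrightarrow> adj (B w) (A u) \<longleftrightarrow> u = w"
  "u < n \<Longrightarrow> w < n \<Longrightarrow> adj (B u) (B w) \<longleftrightarrow> u \<noteq> w"
  "u < n \<Longrightarrow> 3 * n \<le> k \<Longrightarrow> adj (A u) k \<longleftrightarrow> val k \<noteq> u"
  "u < n \<Longrightarrow> 3 * n \<le> k \<Longrightarrow> adj k (A u) \<longleftrightarrow> val k \<noteq> u"
  "u < n \<Longrightarrow> 3 * n \<le> k \<Longrightarrow> adj (B u) k"
  "u < n \<Longrightarrow> 3 * n \<le> k \<Longrightarrow> adj k (B u)"
  "3 * n \<le> k \<Longrightarrow> 3 * n \<le> k' \<Longrightarrow> adj k k' \<longleftrightarrow> k \<noteq> k'"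
  using val_A val_B by (auto simp: adj_def cls_def Let_def)

lemma vertex_cases:
  assumes "a < m"
  obtains "a < n" | u where "u < n" "a = A u" | u where "u < n" "a = B u" | "3 * n \<le> a"
proof -
  consider "a < n" | "n \<le> a" "a < 2 * n" | "2 * n \<le> a" "a < 3 * n" | "3 * n \<le> a" by linarith
  then show thesis
  proof cases
    case 2 then show ?thesis using that(2)[of "a - n"] by auto
  next
    case 3 then show ?thesis using that(3)[of "a - 2 * n"] by auto
  qed (use that in auto)
qed

section \<open>Counting edges around a vertex cover\<close>

text \<open>The left side counts pairs \<open>(c, w)\<close> with \<open>c\<close> in
  \<open>C\<close>. The diagonal gives \<open>card C\<close>, as \<open>conf\<close> is reflexive.
  An edge with one end in \<open>C\<close> occurs once and an edge inside \<open>C\<close> twice;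
  splitting off the second copies leaves every edge exactly once, because \<open>C\<close> is a
  cover.\<close>

lemma sum_degrees_cover:
  assumes C: "C \<subseteq> {..<n}" and cover: "\<And>u w. u < n \<Longrightarrow> w < n \<Longrightarrow> u \<noteq> w \<Longrightarrow> conf u w \<Longrightarrow> u \<in> C \<or> w \<in> C"
  shows "(\<Sum>c\<in>C. card {w. w < n \<and> conf c w}) =
    card C + edge_count + card {(c, d). c \<in> C \<and> d \<in> C \<and> d < c \<and> conf c d}"
proof -
  have fin: "finite C" using C finite_subset by blast
  let ?S = "SIGMA c:C. {w. w < n \<and> conf c w}"
  let ?D = "(\<lambda>c. (c, c)) ` C"
  let ?E1 = "{(c, d). c \<in> C \<and> d \<in> C \<and> d < c \<and> conf c d}"
  let ?E2 = "{(c, w). c \<in> C \<and> w < n \<and> w \<noteq> c \<and> conf c w \<and> \<not> (w \<in> C \<and> w < c)}"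
  have S: "?S = ?D \<union> (?E1 \<union> ?E2)"
    using C conf_refl by auto
  have "finite ?S" using fin by auto
  then have "finite ?E1" "finite ?E2" "finite ?D" using fin unfolding S by auto
  then have "card ?S = card ?D + (card ?E1 + card ?E2)"
    unfolding S by (subst card_Un_disjoint; (subst card_Un_disjoint)?) auto
  moreover have "card ?D = card C" by (intro card_image inj_onI) auto
  moreover have "card ?E2 = edge_count"
    unfolding edge_count_def
  \<comment> \<open>A pair is sent to its edge with sorted ends. An edge inside \<open>C\<close>
    survives in \<open>?E2\<close> only with its smaller end first, which makes the map
    injective.\<close>
  proof (rule bij_betw_same_card[of "\<lambda>(c, w). (min c w, max c w)"], rule bij_betw_imageI)
    show "inj_on (\<lambda>(c, w). (min c w, max c w)) ?E2"
      using conf_sym by (auto simp: inj_on_def min_def max_def split: if_splits)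
    show "(\<lambda>(c, w). (min c w, max c w)) ` ?E2 = {(u, w). u < w \<and> w < n \<and> conf u w}"
    proof (intro set_eqI iffI)
      fix p assume "p \<in> (\<lambda>(c, w). (min c w, max c w)) ` ?E2"
      then show "p \<in> {(u, w). u < w \<and> w < n \<and> conf u w}"
        using C conf_sym by (auto simp: min_def max_def)
    next
      fix p assume "p \<in> {(u, w). u < w \<and> w < n \<and> conf u w}"
      then obtain u w where p: "p = (u, w)" "u < w" "w < n" "conf u w" by auto
      show "p \<in> (\<lambda>(c, w). (min c w, max c w)) ` ?E2"
      proof (cases "u \<in> C")
        case True
        then have "(u, w) \<in> ?E2" using p by auto
        then show ?thesis by (rule rev_image_eqI) (use p in simp)
      next
        case False
        then have "(w, u) \<in> ?E2" using p cover[of u w] conf_sym[of u w] by auto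
        then show ?thesis by (rule rev_image_eqI) (use p in simp)
      qed
    qed
  qed
  moreover have "card ?S = (\<Sum>c\<in>C. card {w. w < n \<and> conf c w})"
    using fin by (intro card_SigmaI) auto
  ultimately show ?thesis by simp
qed

text \<open>The pairs \<open>(c, d)\<close> index the edges between \<open>A\<close> and \<open>B\<close> vertices forced by \<open>X\<close>:
  if only \<open>c\<close> is in \<open>X\<close>, then \<open>A\<^sub>c\<close> and \<open>B\<^sub>d\<close> become adjacent; if both are, then \<open>A\<^sub>c\<close> and \<open>A\<^sub>d\<close>
  become adjacent (charged to \<open>c > d\<close> unless they already are) and so does one of the pairs
  \<open>A\<^sub>c, B\<^sub>d\<close> and \<open>A\<^sub>d, B\<^sub>c\<close> (charged to \<open>c < d\<close>).\<close>

definition pairs :: "nat set \<Rightarrow> (nat \<times> nat) set" where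
  "pairs X = {(c, d). c \<in> X \<and> d < n \<and> d \<noteq> c \<and> \<not> (d \<in> X \<and> d < c \<and> conf c d)}"

lemma card_pairs:
  assumes "X \<subseteq> {..<n}"
  shows "card (pairs X) + card {(c, d). c \<in> X \<and> d \<in> X \<and> d < c \<and> conf c d} = card X * (n - 1)"
    and "finite (pairs X)"
proof -
  let ?E = "{(c, d). c \<in> X \<and> d \<in> X \<and> d < c \<and> conf c d}"
  have fin: "finite X" using assms finite_subset by blast
  have eq: "pairs X \<union> ?E = (SIGMA c:X. {..<n} - {c})"
    using assms by (auto simp: pairs_def)
  have "finite (pairs X \<union> ?E)" unfolding eq using fin by auto
  then show "finite (pairs X)" by simp
  have "card (pairs X) + card ?E = card (pairs X \<union> ?E)"
    using \<open>finite (pairs X \<union> ?E)\<close> by (subst card_Un_disjoint) (auto simp: pairs_def)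
  also have "\<dots> = (\<Sum>c\<in>X. card ({..<n} - {c}))"
    unfolding eq using fin by (intro card_SigmaI) auto
  also have "\<dots> = card X * (n - 1)"
    using assms by (subst sum.cong[where h = "\<lambda>_. n - 1"]) auto
  finally show "card (pairs X) + card ?E = card X * (n - 1)" .
qed


section \<open>Upper bound: a fill-in from a vertex cover\<close>

text \<open>For \<open>c < d\<close> in \<open>C\<close> only \<open>A c\<close> and
  \<open>B d\<close> are joined, not \<open>A d\<close> and \<open>B c\<close>. This staircase lets
  the \<open>B\<close> vertices of \<open>C\<close> be eliminated in increasing order.\<close>

definition fill :: "nat set \<Rightarrow> nat set set" where
  "fill C = {{A c, k} | c k. c \<in> C \<and> k \<in> owned c} \<union>
     {{B i, y} | i y. i < n \<and> i \<notin> C \<and> y < n} \<union>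
     {{A c, A d} | c d. c \<in> C \<and> d \<in> C \<and> d < c \<and> \<not> conf c d} \<union>
     {{A c, B d} | c d. c \<in> C \<and> d < n \<and> d \<noteq> c \<and> (d \<in> C \<longrightarrow> c < d)}"

text \<open>The last two families of \<open>fill\<close> share the index set \<open>pairs C\<close>:
  a pair with both entries in \<open>C\<close> and \<open>d < c\<close> stands for an edge between
  \<open>A\<close> vertices, any other for an edge between \<open>A\<close> and \<open>B\<close>.
  For the upper bound an inclusion in images is enough.\<close>

lemma fill_subset:
  assumes "C \<subseteq> {..<n}"
  shows "fill C \<subseteq> (\<lambda>(c, k). {A c, k}) ` (SIGMA c:C. owned c) \<union>
     (\<lambda>(i, y). {B i, y}) ` (({..<n} - C) \<times> {..<n}) \<union>
     (\<lambda>(c, d). if d \<in> C \<and> d < c then {A c, A d} else {A c, B d}) ` pairs C"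
proof -
  define F1 where "F1 = (\<lambda>(c, k). {A c, k}) ` (SIGMA c:C. owned c)"
  define F2 where "F2 = (\<lambda>(i, y). {B i, y}) ` (({..<n} - C) \<times> {..<n})"
  define F3 where "F3 = (\<lambda>(c, d). if d \<in> C \<and> d < c then {A c, A d} else {A c, B d}) ` pairs C"
  have "{A c, k} \<in> F1" if "c \<in> C" "k \<in> owned c" for c k
    unfolding F1_def by (rule image_eqI[where x = "(c, k)"]) (use that in auto)
  moreover have "{B i, y} \<in> F2" if "i < n" "i \<notin> C" "y < n" for i y
    unfolding F2_def by (rule image_eqI[where x = "(i, y)"]) (use that in auto)
  moreover have "{A c, A d} \<in> F3" if "c \<in> C" "d \<in> C" "d < c" "\<not> conf c d" for c d
    unfolding F3_def by (rule image_eqI[where x = "(c, d)"]) (use that assms in \<open>auto simp: pairs_def\<close>)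
  moreover have "{A c, B d} \<in> F3" if "c \<in> C" "d < n" "d \<noteq> c" "d \<in> C \<longrightarrow> c < d" for c d
    unfolding F3_def by (rule image_eqI[where x = "(c, d)"]) (use that assms in \<open>auto simp: pairs_def\<close>)
  ultimately have "fill C \<subseteq> F1 \<union> F2 \<union> F3"
    unfolding fill_def by (auto simp del: insert_iff)
  then show ?thesis
    by (simp only: F1_def F2_def F3_def)
qed

text \<open>The edges inside \<open>C\<close> that \<open>sum_degrees_cover\<close> counts on top
  are exactly those that \<open>card_pairs\<close> saves. What remains is
  \<open>card C * n + (n - card C) * n = n * n\<close> together with \<open>edge_count\<close> and
  \<open>card C + card C * (n - 1) = card C * n\<close>.\<close>

lemma card_fill_le:
  assumes "C \<subseteq> {..<n}" and cover: "\<And>u w. u < n \<Longrightarrow> w < n \<Longrightarrow> u \<noteq> w \<Longrightarrow> conf u w \<Longrightarrow> u \<in> C \<or> w \<in> C"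
  shows "card (fill C) \<le> n * n + edge_count + card C * n"
proof -
  let ?F1 = "(\<lambda>(c, k). {A c, k}) ` (SIGMA c:C. owned c)"
  let ?F2 = "(\<lambda>(i, y). {B i, y}) ` (({..<n} - C) \<times> {..<n})"
  let ?F3 = "(\<lambda>(c, d). if d \<in> C \<and> d < c then {A c, A d} else {A c, B d}) ` pairs C"
  have fin: "finite C" using assms finite_subset by blast
  have C: "card C \<le> n" using assms card_mono[of "{..<n}" C] by simp
  have "card (fill C) \<le> card (SIGMA c:C. owned c) + card (({..<n} - C) \<times> {..<n}) + card (pairs C)"
  proof -
    have fins: "finite (SIGMA c:C. owned c)" "finite (({..<n} - C) \<times> {..<n})" "finite (pairs C)"
      using fin card_pairs(2)[OF assms(1)] by auto
    have "card (fill C) \<le> card (?F1 \<union> ?F2 \<union> ?F3)"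
      using fins by (intro card_mono fill_subset assms) auto
    also have "\<dots> \<le> card ?F1 + card ?F2 + card ?F3"
      by (intro order.trans[OF card_Un_le] add_mono card_Un_le order.refl)
    also have "\<dots> \<le> card (SIGMA c:C. owned c) + card (({..<n} - C) \<times> {..<n}) + card (pairs C)"
      using fins by (intro add_mono card_image_le)
    finally show ?thesis .
  qed
  moreover have "card (SIGMA c:C. owned c) = (\<Sum>c\<in>C. n + card {w. w < n \<and> conf c w})"
    using fin assms by (subst card_SigmaI) (auto intro!: sum.cong simp: card_owned[simplified])
  moreover have "\<dots> = card C * n + (\<Sum>c\<in>C. card {w. w < n \<and> conf c w})"
    by (simp add: sum.distrib)
  moreover have "card (({..<n} - C) \<times> {..<n}) = n * n - card C * n"
    using assms fin by (simp add: card_cartesian_product card_Diff_subset diff_mult_distrib)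
  moreover have "card C * n \<le> n * n" using C by simp
  moreover have "card C * n = card C * (n - 1) + card C"
    using C by (cases n) auto
  ultimately show ?thesis
    using sum_degrees_cover[OF assms] card_pairs(1)[OF assms(1)] by linarith
qed

lemma fill_iff:
  assumes "C \<subseteq> {..<n}"
  shows "y < n \<Longrightarrow> y' < n \<Longrightarrow> {y, y'} \<notin> fill C"
    "y < n \<Longrightarrow> u < n \<Longrightarrow> {y, A u} \<notin> fill C"
    "y < n \<Longrightarrow> u < n \<Longrightarrow> {y, B u} \<in> fill C \<longleftrightarrow> u \<notin> C"
    "y < n \<Longrightarrow> 3 * n \<le> k \<Longrightarrow> {y, k} \<notin> fill C"
    "u < n \<Longrightarrow> w < n \<Longrightarrow> {A u, A w} \<in> fill C \<longleftrightarrow> u \<noteq> w \<and> u \<in> C \<and> w \<in> C \<and> \<not> conf u w"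
    "u < n \<Longrightarrow> w < n \<Longrightarrow> {A u, B w} \<in> fill C \<longleftrightarrow> u \<noteq> w \<and> u \<in> C \<and> (w \<in> C \<longrightarrow> u < w)"
    "u < n \<Longrightarrow> w < n \<Longrightarrow> {B u, B w} \<notin> fill C"
    "u < n \<Longrightarrow> 3 * n \<le> k \<Longrightarrow> k < m \<Longrightarrow> {A u, k} \<in> fill C \<longleftrightarrow> u \<in> C \<and> val k = u"
    "u < n \<Longrightarrow> 3 * n \<le> k \<Longrightarrow> {B u, k} \<notin> fill C"
    "3 * n \<le> k \<Longrightarrow> 3 * n \<le> k' \<Longrightarrow> {k, k'} \<notin> fill C"
proof -
  show "{A u, A w} \<in> fill C \<longleftrightarrow> u \<noteq> w \<and> u \<in> C \<and> w \<in> C \<and> \<not> conf u w"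
    if "u < n" "w < n" for u w
  proof
    assume "{A u, A w} \<in> fill C"
    then show "u \<noteq> w \<and> u \<in> C \<and> w \<in> C \<and> \<not> conf u w"
      using that conf_sym by (auto simp: fill_def doubleton_eq_iff dest: subsetD[OF assms])
  next
    assume r: "u \<noteq> w \<and> u \<in> C \<and> w \<in> C \<and> \<not> conf u w"
    have "{A c, A d} \<in> fill C" if "c \<in> C" "d \<in> C" "d < c" "c < n" "\<not> conf c d" for c d
      using that unfolding fill_def by blast
    from this[of u w] this[of w u] show "{A u, A w} \<in> fill C"
      using r that conf_sym[of u w] by (cases "u < w") (auto simp: insert_commute)
  qed
qed (auto simp: fill_def doubleton_eq_iff dest: subsetD[OF assms])

lemma fill_disjoint:
  assumes "C \<subseteq> {..<n}"
  shows "fill C \<subseteq> nsets {..<m} 2 - edges"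
proof -
  have m': "u < n \<Longrightarrow> u < m" "u < n \<Longrightarrow> A u < m" "u < n \<Longrightarrow> B u < m" for u using m by auto
  define S where "S = nsets {..<m} 2 - edges"
  have pair: "{a, b} \<in> S" if "a < m" "b < m" "a \<noteq> b" "\<not> adj a b" for a b
    using that by (simp add: S_def nsets_def edges_iff)
  have C: "c < n" if "c \<in> C" for c using assms that by blast
  have "{A c, k} \<in> S" if "c \<in> C" "k \<in> owned c" for c k
    using that C[of c] m'(2)[of c] adj_simps(12)[of c k] by (intro pair) auto
  moreover have "{B i, y} \<in> S" if "i < n" "y < n" for i y
    using that m'(1)[of y] m'(3)[of i] adj_simps(5)[of y i] by (intro pair) auto
  moreover have "{A c, A d} \<in> S" if "c \<in> C" "d \<in> C" "d < c" "\<not> conf c d" for c d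
    using that C[of c] C[of d] m'(2)[of c] m'(2)[of d] adj_simps(8)[of c d] by (intro pair) auto
  moreover have "{A c, B d} \<in> S" if "c \<in> C" "d < n" "d \<noteq> c" for c d
    using that C[of c] m'(2)[of c] m'(3)[of d] adj_simps(9)[of c d] by (intro pair) auto
  ultimately have "fill C \<subseteq> S"
    unfolding fill_def by blast
  then show ?thesis
    by (simp only: S_def)
qed

lemma chordal_fill:
  assumes C: "C \<subseteq> {..<n}" and cover: "\<And>u w. u < n \<Longrightarrow> w < n \<Longrightarrow> u \<noteq> w \<Longrightarrow> conf u w \<Longrightarrow> u \<in> C \<or> w \<in> C"
  shows "chordal {..<m} (edges \<union> fill C)"
proof -
  \<comment> \<open>Elimination order: \<open>A\<^sub>i\<close> for \<open>i \<notin> C\<close>, then \<open>Y\<close>, then \<open>B\<^sub>c\<close> for \<open>c \<in> C\<close> by increasing \<open>c\<close>; the rest is a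
    clique.\<close>
  define r where "r a = (if a < n then 1 else if a < 2 * n then if a - n \<in> C then n + 2 else 0
    else if a < 3 * n then if a - 2 * n \<in> C then 2 + (a - 2 * n) else n + 2 else n + 2)" for a
  have r: "y < n \<Longrightarrow> r y = 1" "u < n \<Longrightarrow> r (A u) = (if u \<in> C then n + 2 else 0)"
    "u < n \<Longrightarrow> r (B u) = (if u \<in> C then 2 + u else n + 2)" "3 * n \<le> k \<Longrightarrow> r k = n + 2" for y u k
    by (auto simp: r_def)
  have m': "u < n \<Longrightarrow> u < m" "u < n \<Longrightarrow> A u < m" "u < n \<Longrightarrow> B u < m" for u using m by auto
  define h where "h a b \<longleftrightarrow> {a, b} \<in> edges \<union> fill C" for a b
  have h_sym: "h a b \<longleftrightarrow> h b a" for a b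
    by (simp add: h_def insert_commute)
  note e = edges_iff adj_simps m' h_def fill_iff[OF C]
  have h1: "y < n \<Longrightarrow> y' < n \<Longrightarrow> h y y' \<longleftrightarrow> y \<noteq> y'"
    "y < n \<Longrightarrow> u < n \<Longrightarrow> h y (A u)"
    "y < n \<Longrightarrow> u < n \<Longrightarrow> h y (B u) \<longleftrightarrow> u \<notin> C"
    "y < n \<Longrightarrow> 3 * n \<le> k \<Longrightarrow> k < m \<Longrightarrow> h y k"
    "u < n \<Longrightarrow> w < n \<Longrightarrow> h (A u) (A w) \<longleftrightarrow> u \<noteq> w \<and> (conf u w \<or> u \<in> C \<and> w \<in> C)"
    "u < n \<Longrightarrow> w < n \<Longrightarrow> h (A u) (B w) \<longleftrightarrow> u = w \<or> u \<in> C \<and> (w \<in> C \<longrightarrow> u < w)"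
    "u < n \<Longrightarrow> w < n \<Longrightarrow> h (B u) (B w) \<longleftrightarrow> u \<noteq> w"
    "u < n \<Longrightarrow> 3 * n \<le> k \<Longrightarrow> k < m \<Longrightarrow> h (A u) k \<longleftrightarrow> val k \<noteq> u \<or> u \<in> C"
    "u < n \<Longrightarrow> 3 * n \<le> k \<Longrightarrow> k < m \<Longrightarrow> h (B u) k"
    "3 * n \<le> k \<Longrightarrow> 3 * n \<le> k' \<Longrightarrow> k < m \<Longrightarrow> k' < m \<Longrightarrow> h k k' \<longleftrightarrow> k \<noteq> k'" for y y' u w k k'
    by (auto simp: e)
  have h2: "y < n \<Longrightarrow> u < n \<Longrightarrow> h (A u) y"
    "y < n \<Longrightarrow> u < n \<Longrightarrow> h (B u) y \<longleftrightarrow> u \<notin> C"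
    "y < n \<Longrightarrow> 3 * n \<le> k \<Longrightarrow> k < m \<Longrightarrow> h k y"
    "u < n \<Longrightarrow> w < n \<Longrightarrow> h (B w) (A u) \<longleftrightarrow> u = w \<or> u \<in> C \<and> (w \<in> C \<longrightarrow> u < w)"
    "u < n \<Longrightarrow> 3 * n \<le> k \<Longrightarrow> k < m \<Longrightarrow> h k (A u) \<longleftrightarrow> val k \<noteq> u \<or> u \<in> C"
    "u < n \<Longrightarrow> 3 * n \<le> k \<Longrightarrow> k < m \<Longrightarrow> h k (B u)" for y u w k
    unfolding h_sym[of "A u" y] h_sym[of "B u" y] h_sym[of k y] h_sym[of "B w" "A u"]
      h_sym[of k "A u"] h_sym[of k "B u"]
    by (rule h1; assumption)+
  note h = h1 h2
  \<comment> \<open>By the cover property, an \<open>A\<close> vertex outside \<open>C\<close> has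
    all its \<open>A\<close> neighbours in \<open>C\<close>.\<close>
  have hc: "u < n \<Longrightarrow> w < n \<Longrightarrow> h (A u) (A w) \<Longrightarrow> u \<in> C \<or> w \<in> C" for u w
    using cover[of u w] by (auto simp: h)
  show ?thesis
  proof (rule chordal_if_elimination_rank[where r = r], fold h_def, unfold lessThan_iff)
    fix v a b
    assume lt: "v < m" "a < m" "b < m" and ne: "a \<noteq> b" "a \<noteq> v" "b \<noteq> v"
      and va: "h v a" and vb: "h v b" and ra: "r v \<le> r a" and rb: "r v \<le> r b"
    define later where "later x \<longleftrightarrow> x < m \<and> x \<noteq> v \<and> h v x \<and> r v \<le> r x" for x
    have later: "later a" "later b" using lt ne va vb ra rb by (simp_all add: later_def)
    let ?K = "{3 * n..<m}"
    \<comment> \<open>All sets of later neighbours fit into this shape. It is a clique if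
      \<open>I\<close> lies in \<open>C\<close>, if \<open>Y\<close> does not occur together with a
      \<open>B\<close> vertex of \<open>C\<close>, and if \<open>I\<close> and \<open>J\<close>
      respect the staircase.\<close>
    let ?Q = "\<lambda>Y I J. Y \<union> A ` I \<union> B ` J \<union> ?K"
    have clique: "h a b" if "a \<in> ?Q Y I J" "b \<in> ?Q Y I J"
      "Y \<subseteq> {..<n}" "I \<subseteq> C" "J \<subseteq> {..<n}" "Y = {} \<or> J \<inter> C = {}" "\<And>u w. u \<in> I \<Longrightarrow> w \<in> J \<inter> C \<Longrightarrow> u \<le> w"
    for Y I J
    proof -
      have I: "I \<subseteq> {..<n}" using that(4) C by blast
      have "h x y" if "x \<in> Y" "y \<in> Y" "x \<noteq> y" for x y
        using h1(1)[of x y] that \<open>Y \<subseteq> {..<n}\<close> by blast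
      moreover have "h x y" if "x \<in> Y" "y \<in> A ` I" for x y
        using h1(2)[of x] that \<open>Y \<subseteq> {..<n}\<close> I by blast
      moreover have "h x y" if "x \<in> Y" "y \<in> B ` J" for x y
        using h1(3)[of x] that \<open>Y \<subseteq> {..<n}\<close> \<open>J \<subseteq> {..<n}\<close> \<open>Y = {} \<or> J \<inter> C = {}\<close> by blast
      moreover have "h x y" if "x \<in> Y" "y \<in> ?K" for x y
        using h1(4)[of x y] that \<open>Y \<subseteq> {..<n}\<close> by auto
      moreover have "h x y" if "x \<in> A ` I" "y \<in> A ` I" "x \<noteq> y" for x y
        using h1(5) that I \<open>I \<subseteq> C\<close> by blast
      moreover have "h x y" if xy: "x \<in> A ` I" "y \<in> B ` J" for x y
      proof -
        obtain u w where uw: "x = A u" "y = B w" "u \<in> I" "w \<in> J" using xy by blast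
        have "u = w \<or> u \<in> C \<and> (w \<in> C \<longrightarrow> u < w)"
          using \<open>I \<subseteq> C\<close> uw(3,4) \<open>\<And>u w. u \<in> I \<Longrightarrow> w \<in> J \<inter> C \<Longrightarrow> u \<le> w\<close>[of u w] by auto
        then show ?thesis
          using h1(6)[of u w] uw I \<open>J \<subseteq> {..<n}\<close> by blast
      qed
      moreover have "h x y" if "x \<in> A ` I" "y \<in> ?K" for x y
        using h1(8)[of _ y] that I \<open>I \<subseteq> C\<close> by auto
      moreover have "h x y" if "x \<in> B ` J" "y \<in> B ` J" "x \<noteq> y" for x y
        using h1(7) that \<open>J \<subseteq> {..<n}\<close> by blast
      moreover have "h x y" if "x \<in> B ` J" "y \<in> ?K" for x y
        using h1(9)[of _ y] that \<open>J \<subseteq> {..<n}\<close> by auto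
      moreover have "h x y" if "x \<in> ?K" "y \<in> ?K" "x \<noteq> y" for x y
        using h1(10)[of x y] that by simp
      moreover have "h b a \<Longrightarrow> h a b" using h_sym by blast
      ultimately show ?thesis
        using that(1,2) ne by (elim UnE) metis+
    qed
    have A_C: "w \<in> C" if "w < n" "1 \<le> r (A w)" for w
      using that by (cases "w \<in> C") (simp_all add: r)
    have B_C: "w \<notin> C" if "w < n" "n + 2 \<le> r (B w)" for w
      using that by (cases "w \<in> C") (simp_all add: r)
    show "h a b"
    \<comment> \<open>Only the vertices \<open>B u\<close> with \<open>u\<close> in \<open>C\<close>
      use the staircase: their later neighbours are \<open>A w\<close> with
      \<open>w \<le> u\<close>, \<open>B w\<close> with \<open>w\<close> outside \<open>C\<close> or
      beyond \<open>u\<close>, and \<open>K\<close>.\<close>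
    proof (cases "\<exists>u. v = B u \<and> u \<in> C")
      case True
      then obtain u where u: "v = B u" "u \<in> C" "u < n" using C by blast
      have rv: "r v = 2 + u" using u r(3)[of u] by simp
      have Q: "x \<in> ?Q {} {w \<in> C. w \<le> u} {w. w < n \<and> (w \<in> C \<longrightarrow> u < w)}" if "later x" for x
      proof -
        from that have x: "x < m" "x \<noteq> v" "h v x" "r v \<le> r x" by (simp_all add: later_def)
        show ?thesis
        proof (cases rule: vertex_cases[OF x(1)])
          case 1
          then show ?thesis using x(4) rv r(1) by simp
        next
          case (2 w)
          then have "w \<in> C" "w \<le> u"
            using A_C[of w] x(3,4) rv h2(4)[OF 2(1) u(3)] u by auto
          then show ?thesis using 2 by simp
        next
          case (3 w)
          then have "w \<in> C \<longrightarrow> u < w"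
            using x(2,4) rv r(3)[of w] u by auto
          then show ?thesis using 3 by simp
        qed (use x(1) in simp)
      qed
      show ?thesis
        by (rule clique[OF Q[OF later(1)] Q[OF later(2)]]) auto
    next
      case False
      have v: "v < n \<or> (\<exists>u<n. u \<notin> C \<and> v = A u) \<or> n + 2 \<le> r v"
      proof (cases rule: vertex_cases[OF lt(1)])
        case (2 u) then show ?thesis using r(2)[of u] by (cases "u \<in> C") simp_all
      next
        case (3 u) then show ?thesis using False r(3)[of u] by auto
      qed (simp_all add: r(4))
      have v_A: "w \<in> C" if "w < n" "h v (A w)" "r v \<le> r (A w)" for w
        using v by (elim disjE exE conjE) (use A_C[of w] that r(1)[of v] hc[of _ w] in auto)
      have v_B: "w \<notin> C" if "w < n" "h v (B w)" "r v \<le> r (B w)" for w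
        using v by (elim disjE exE conjE) (use B_C[of w] that h1(3)[of v w] h1(6)[of _ w] in auto)
      \<comment> \<open>In all other cases one clique, made of \<open>Y\<close>, the
        \<open>A\<close> vertices of \<open>C\<close>, the \<open>B\<close> vertices outside
        \<open>C\<close>, and \<open>K\<close>, contains all later neighbours.\<close>
      have Q: "x \<in> ?Q {..<n} C ({..<n} - C)" if "later x" for x
      proof -
        from that have x: "x < m" "x \<noteq> v" "h v x" "r v \<le> r x" by (simp_all add: later_def)
        show ?thesis
        proof (cases rule: vertex_cases[OF x(1)])
          case (2 w) then show ?thesis using v_A[of w] x by blast
        next
          case (3 w) then show ?thesis using v_B[of w] x by blast
        qed (use x(1) in simp_all)
      qed
      show ?thesis
        by (rule clique[OF Q[OF later(1)] Q[OF later(2)]]) (use C in auto)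
    qed
  qed
qed

section \<open>Lower bound: a vertex cover from a fill-in\<close>

text \<open>For a fixed \<open>y\<close> in \<open>Y\<close>, the forced edges among the \<open>A\<close> and \<open>B\<close> vertices are only those of the set
  \<open>D y \<subseteq> C\<close> of all \<open>u\<close> with \<open>B\<^sub>u\<close> not joined to \<open>y\<close>. Every \<open>u\<close> missing from \<open>D y\<close> pays with the edge from \<open>y\<close>
  to \<open>B\<^sub>u\<close>, and averaging over the \<open>n\<close> choices of \<open>y\<close> this makes up for the at most \<open>n - 1\<close> edges lost.\<close>

lemma fill_in_lower_bound:
  assumes F: "fill_in {..<m} edges F"
  obtains I where "independent I" "n * n + edge_count + (n - card I) * n \<le> card F"
proof -
  have chord: "chordal {..<m} (edges \<union> F)" and Fsub: "F \<subseteq> nsets {..<m} 2 - edges"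
    using F by (auto simp: fill_in_def)
  have finF: "finite F"
    using finite_imp_finite_nsets[of "{..<m}" 2] Fsub by (meson finite_Diff finite_lessThan finite_subset)
  have m': "u < n \<Longrightarrow> u < m" "u < n \<Longrightarrow> A u < m" "u < n \<Longrightarrow> B u < m" for u using m by auto
  define g where "g a b \<longleftrightarrow> {a, b} \<in> edges \<union> F" for a b
  have g_sym: "g a b \<Longrightarrow> g b a" for a b
    by (simp add: g_def insert_commute)
  have g_adj: "a < m \<Longrightarrow> b < m \<Longrightarrow> adj a b \<Longrightarrow> g a b" for a b
    by (simp add: g_def edges_iff)
  have g_F: "a < m \<Longrightarrow> b < m \<Longrightarrow> \<not> adj a b \<Longrightarrow> g a b \<longleftrightarrow> {a, b} \<in> F" for a b
    by (simp add: g_def edges_iff)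
  have g4: "g a c \<or> g b d" if "distinct [a, b, c, d]" "a < m" "b < m" "c < m" "d < m"
    "g a b" "g b c" "g c d" "g d a" for a b c d
    using chordal_cycle4[OF chord that(1)] that(2-) by (simp add: g_def)
  have g5: "g a c \<or> g a d \<or> g b d \<or> g b e \<or> g c e" if "distinct [a, b, c, d, e]"
    "a < m" "b < m" "c < m" "d < m" "e < m" "g a b" "g b c" "g c d" "g d e" "g e a" for a b c d e
    using chordal_cycle5[OF chord that(1)] that(2-) by (simp add: g_def)
  have gYA: "g y (A u)" and gAB: "g (A u) (B u)" if "y < n" "u < n" for y u
    using that m' adj_simps(2)[of y u] adj_simps(9)[of u u] by (auto intro: g_adj)
  have gBB: "g (B u) (B w)" if "u < n" "w < n" "u \<noteq> w" for u w
    using that m' adj_simps(11)[of u w] by (auto intro: g_adj)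
  have gYB: "g y (B u) \<longleftrightarrow> {y, B u} \<in> F" if "y < n" "u < n" for y u
    using that m' adj_simps(4)[of y u] by (intro g_F) auto
  have gABF: "g (A u) (B w) \<longleftrightarrow> {A u, B w} \<in> F" if "u < n" "w < n" "u \<noteq> w" for u w
    using that m' adj_simps(9)[of u w] by (intro g_F) auto
  have gAK: "g (A u) k \<longleftrightarrow> {A u, k} \<in> F" if "u < n" "k \<in> owned u" for u k
    using that m' adj_simps(12)[of u k] by (intro g_F) auto
  have gAK': "g (A u) k" if "u < n" "k \<in> owned w" "u \<noteq> w" for u k w
    using that m' adj_simps(12)[of u k] by (intro g_adj) auto
  define C where "C = {u. u < n \<and> (\<forall>k\<in>owned u. {A u, k} \<in> F)}"
  define D where "D y = {u. u < n \<and> {y, B u} \<notin> F}" for y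
  define Y where "Y u = {y. y < n \<and> {y, B u} \<in> F}" for u
  have Cn: "C \<subseteq> {..<n}" and Dn: "D y \<subseteq> {..<n}" for y by (auto simp: C_def D_def)
  have finC: "finite C" using Cn finite_subset by blast
  have yB_or_Ak: "{y, B u} \<in> F \<or> {A u, k} \<in> F" if "u < n" "y < n" "k \<in> owned u" for u y k
  proof -
    have k: "3 * n \<le> k" "k < m" using that by auto
    have "g y (B u) \<or> g k (A u)"
    proof (rule g4[OF _ m'(1)[OF that(2)] k(2) m'(3,2)[OF that(1)]])
      show "g y k" "g k (B u)"
        using adj_simps(6)[of y k] adj_simps(15)[of u k] m' that k by (simp_all add: g_adj)
    qed (use that k g_sym[OF gAB] g_sym[OF gYA] in auto)
    then show ?thesis
      using gYB[of y u] gAK[of u k] g_sym[of k "A u"] that by blast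
  qed
  have cover: "u \<in> C \<or> w \<in> C" if "u < n" "w < n" "u \<noteq> w" "conf u w" for u w
  proof -
    \<comment> \<open>One of the two chords of the cycle \<open>A u\<close>, \<open>A w\<close>,
      \<open>k\<close>, \<open>k'\<close> is present for every choice of \<open>k\<close> and
      \<open>k'\<close>. Hence either all edges at \<open>A u\<close> or all edges at
      \<open>A w\<close> are present.\<close>
    have "{A u, k} \<in> F \<or> {A w, k'} \<in> F" if k: "k \<in> owned u" "k' \<in> owned w" for k k'
    proof -
      have k': "3 * n \<le> k" "k < m" "3 * n \<le> k'" "k' < m" "k \<noteq> k'" using k \<open>u \<noteq> w\<close> by auto
      have "g (A u) k \<or> g (A w) k'"
      proof (rule g4[OF _ m'(2)[OF \<open>u < n\<close>] m'(2)[OF \<open>w < n\<close>] k'(2,4)])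
        show "distinct [A u, A w, k, k']"
          using k' \<open>u < n\<close> \<open>w < n\<close> \<open>u \<noteq> w\<close> by simp
        show "g (A u) (A w)"
          using adj_simps(8)[of u w] m'(2) \<open>u < n\<close> \<open>w < n\<close> \<open>u \<noteq> w\<close> \<open>conf u w\<close> by (intro g_adj) auto
        show "g k k'"
          using adj_simps(16)[of k k'] k' by (intro g_adj) auto
      qed (use gAK'[of w k u] g_sym[OF gAK'[of u k' w]] k \<open>u < n\<close> \<open>w < n\<close> \<open>u \<noteq> w\<close> in simp_all)
      then show ?thesis
        using gAK[of u k] gAK[of w k'] k \<open>u < n\<close> \<open>w < n\<close> by blast
    qed
    then show ?thesis using that by (auto simp: C_def)
  qed
  have DC: "D y \<subseteq> C" if "y < n" for y
    using yB_or_Ak that by (auto simp: C_def D_def)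
  have D: "u < n" "\<not> g y (B u)" if "y < n" "u \<in> D y" for y u
    using that gYB[of y u] by (auto simp: D_def)
  \<comment> \<open>The cycle \<open>y\<close>, \<open>A u\<close>, \<open>B u\<close>,
    \<open>B w\<close> lacks the chord from \<open>y\<close> to \<open>B u\<close>, so it has the
    other one.\<close>
  have D_in_out: "{A u, B w} \<in> F" if "y < n" "u \<in> D y" "w < n" "w \<notin> D y" for y u w
  proof -
    have "g (B w) y" using that gYB[of y w] by (auto simp: D_def intro: g_sym)
    then have "g y (B u) \<or> g (A u) (B w)"
      using that D[OF that(1,2)] m'(1)[of y] m'(2)[of u] m'(3)[of u] m'(3)[of w]
      by (intro g4 gYA gAB gBB) auto
    then show ?thesis
      using D[OF that(1,2)] that gABF[of u w] by blast
  qed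
  \<comment> \<open>First the 5-cycle \<open>y\<close>, \<open>A u\<close>, \<open>B u\<close>,
    \<open>B w\<close>, \<open>A w\<close> forces the edge between \<open>A u\<close> and
    \<open>A w\<close>; then the 4-cycle left after dropping \<open>y\<close> forces one of the
    mixed chords.\<close>
  have D_in_in: "{A u, A w} \<in> edges \<union> F \<and> ({A u, B w} \<in> F \<or> {A w, B u} \<in> F)"
    if "y < n" "u \<in> D y" "w \<in> D y" "u \<noteq> w" for y u w
  proof -
    note u = D[OF that(1,2)] and w = D[OF that(1,3)]
    note ms = m'(1)[OF that(1)] m'(2,3)[OF u(1)] m'(2,3)[OF w(1)]
    have "g (A u) (A w)"
    proof (rule ccontr)
      assume no: "\<not> g (A u) (A w)"
      \<comment> \<open>Without the edge between the \<open>A\<close> vertices, a mixed chord would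
        close the chordless 4-cycle \<open>y\<close>, \<open>A a\<close>, \<open>B b\<close>,
        \<open>A b\<close>.\<close>
      have *: "\<not> g (A a) (B b)" if "a < n" "b < n" "a \<noteq> b" "\<not> g (A a) (A b)" "\<not> g y (B b)" for a b
        using g4[of y "A a" "B b" "A b"] that \<open>y < n\<close> m'(1)[of y] m'(2)[of a] m'(2,3)[of b]
          gYA[of y a] g_sym[OF gAB[of y b]] g_sym[OF gYA[of y b]] by auto
      have "g y (B u) \<or> g y (B w) \<or> g (A u) (B w) \<or> g (A u) (A w) \<or> g (B u) (A w)"
        by (rule g5[OF _ ms(1,2,3,5,4) gYA[OF that(1) u(1)] gAB[OF that(1) u(1)]
              gBB[OF u(1) w(1) that(4)] g_sym[OF gAB[OF that(1) w(1)]] g_sym[OF gYA[OF that(1) w(1)]]])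
          (use that u(1) w(1) in simp)
      then show False
        using no u w *[OF u(1) w(1) that(4) no w(2)]
          *[OF w(1) u(1) that(4)[symmetric] _ u(2)] g_sym by blast
    qed
    moreover from this have "g (A u) (B w) \<or> g (B u) (A w)"
      using g4[OF _ ms(2,3,5,4) gAB[OF that(1) u(1)] gBB[OF u(1) w(1) that(4)]
          g_sym[OF gAB[OF that(1) w(1)]] g_sym] that u(1) w(1) by simp
    ultimately show ?thesis
      using gABF[OF u(1) w(1) that(4)] gABF[OF w(1) u(1) that(4)[symmetric]] g_sym
      unfolding g_def[of "A u" "A w"] by blast
  qed
  let ?eC = "card {(c, d). c \<in> C \<and> d \<in> C \<and> d < c \<and> conf c d}"
  define T where "T = F \<inter> ({{A u, A w} | u w. u < n \<and> w < n} \<union> {{A u, B w} | u w. u < n \<and> w < n})"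
  have card_D: "card (D y) * (n - 1) \<le> card T + ?eC" if y: "y < n" for y
  proof -
    \<comment> \<open>Each pair is charged to a forced edge of \<open>F\<close>. The charge is
      injective: for two indices in \<open>D y\<close>, a mixed edge can only come from the pair in
      increasing order, an edge between \<open>A\<close> vertices only from the decreasing
      one.\<close>
    let ?\<phi> = "\<lambda>(c, d). if d \<in> D y \<and> d < c then {A c, A d}
      else if d \<notin> D y \<or> {A c, B d} \<in> F then {A c, B d} else {A d, B c}"
    have "?\<phi> ` pairs (D y) \<subseteq> T"
    proof clarify
      fix c d assume p: "(c, d) \<in> pairs (D y)"
      then have cd: "c \<in> D y" "c < n" "d < n" "d \<noteq> c" "d \<in> D y \<Longrightarrow> d < c \<Longrightarrow> \<not> conf c d"
        using Dn[of y] by (auto simp: pairs_def)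
      have "d \<in> D y \<Longrightarrow> d < c \<Longrightarrow> {A c, A d} \<in> F"
        using D_in_in[OF y cd(1), of d] cd adj_simps(8)[of c d] m'(2)[of c] m'(2)[of d]
        by (auto simp: edges_iff)
      moreover have "d \<notin> D y \<Longrightarrow> {A c, B d} \<in> F"
        using D_in_out[OF y cd(1) cd(3)] .
      moreover have "d \<in> D y \<Longrightarrow> {A c, B d} \<notin> F \<Longrightarrow> {A d, B c} \<in> F"
        using D_in_in[OF y cd(1), of d] cd by auto
      ultimately show "(if d \<in> D y \<and> d < c then {A c, A d}
        else if d \<notin> D y \<or> {A c, B d} \<in> F then {A c, B d} else {A d, B c}) \<in> T"
        unfolding T_def using cd(2,3) by auto
    qed
    moreover have "inj_on ?\<phi> (pairs (D y))"
    proof (rule inj_onI, clarify)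
      fix c d c' d'
      assume p: "(c, d) \<in> pairs (D y)" "(c', d') \<in> pairs (D y)"
        and eq: "(if d \<in> D y \<and> d < c then {A c, A d}
          else if d \<notin> D y \<or> {A c, B d} \<in> F then {A c, B d} else {A d, B c}) =
          (if d' \<in> D y \<and> d' < c' then {A c', A d'}
          else if d' \<notin> D y \<or> {A c', B d'} \<in> F then {A c', B d'} else {A d', B c'})"
      have cd: "c \<in> D y" "c < n" "d < n" "d \<noteq> c" "c' \<in> D y" "c' < n" "d' < n" "d' \<noteq> c'"
        using p Dn[of y] by (auto simp: pairs_def)
      show "c = c' \<and> d = d'"
        using eq cd by (auto simp: doubleton_eq_iff split: if_splits)
    qed
    ultimately have "card (pairs (D y)) \<le> card T"
      using card_inj_on_le[of ?\<phi> "pairs (D y)" T] finF by (simp add: T_def)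
    \<comment> \<open>As \<open>D y\<close> lies in \<open>C\<close>, it saves at most as many edges
      as \<open>C\<close>.\<close>
    moreover have "card {(c, d). c \<in> D y \<and> d \<in> D y \<and> d < c \<and> conf c d} \<le> ?eC"
      using DC[OF y] finC
      by (intro card_mono finite_subset[of "{(c, d). c \<in> C \<and> d \<in> C \<and> d < c \<and> conf c d}" "C \<times> C"]) auto
    ultimately show ?thesis
      using card_pairs(1)[OF Dn[of y]] by linarith
  qed
  define X where "X = (\<Sum>u\<in>C. card (Y u))"
  \<comment> \<open>Double counting: for \<open>u\<close> in \<open>C\<close> and
    \<open>y < n\<close>, exactly one of \<open>u \<in> D y\<close> and \<open>y \<in> Y u\<close>
    holds.\<close>
  have sum_D: "(\<Sum>y<n. card (D y)) + X = n * card C"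
  proof -
    have "(\<Sum>y<n. card (D y)) = (\<Sum>y<n. \<Sum>u\<in>C. of_bool (u \<in> D y))"
      using DC finC by (intro sum.cong refl) (simp add: Int_absorb1)
    also have "\<dots> = (\<Sum>u\<in>C. \<Sum>y<n. of_bool (u \<in> D y))"
      by (rule sum.swap)
    also have "\<dots> + X = (\<Sum>u\<in>C. (\<Sum>y<n. of_bool (u \<in> D y)) + card (Y u))"
      by (simp add: X_def sum.distrib)
    also have "\<dots> = (\<Sum>u\<in>C. n)"
    proof (rule sum.cong[OF refl])
      fix u assume "u \<in> C"
      then have *: "{..<n} = ({..<n} \<inter> {y. u \<in> D y}) \<union> Y u" "({..<n} \<inter> {y. u \<in> D y}) \<inter> Y u = {}"
        by (auto simp: D_def Y_def C_def)
      have "n = card (({..<n} \<inter> {y. u \<in> D y}) \<union> Y u)" using * by simp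
      also have "\<dots> = card ({..<n} \<inter> {y. u \<in> D y}) + card (Y u)"
        using *(2) by (intro card_Un_disjoint) (auto simp: Y_def)
      finally show "(\<Sum>y<n. of_bool (u \<in> D y)) + card (Y u) = n" by simp
    qed
    finally show ?thesis by simp
  qed
  define G1 where "G1 = (\<lambda>(c, k). {A c, k}) ` (SIGMA c:C. owned c)"
  define G2 where "G2 = (\<lambda>(u, y). {y, B u}) ` (SIGMA u:{..<n}. Y u)"
  have sub: "G1 \<subseteq> F" "G2 \<subseteq> F" "T \<subseteq> F"
    by (auto simp: G1_def G2_def T_def C_def Y_def)
  have disj: "G1 \<inter> G2 = {}" "(G1 \<union> G2) \<inter> T = {}"
    using Cn by (auto simp: G1_def G2_def T_def Y_def doubleton_eq_iff)
  have "card G1 + card G2 + card T = card (G1 \<union> G2 \<union> T)"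
    using finite_subset[OF _ finF] sub disj by (simp add: card_Un_disjoint)
  also have "\<dots> \<le> card F"
    using sub by (intro card_mono finF) auto
  finally have card_F: "card G1 + card G2 + card T \<le> card F" .
  have "card G1 = card (SIGMA c:C. owned c)"
    unfolding G1_def using Cn by (intro card_image) (auto simp: inj_on_def doubleton_eq_iff)
  also have "\<dots> = (\<Sum>c\<in>C. card (owned c))"
    using finC by (intro card_SigmaI) auto
  also have "\<dots> = (\<Sum>c\<in>C. n + card {w. w < n \<and> conf c w})"
    by (intro sum.cong refl card_owned) (use Cn in auto)
  finally have G1: "card G1 = card C * n + (\<Sum>c\<in>C. card {w. w < n \<and> conf c w})"
    by (simp add: sum.distrib)
  have "card G2 = card (SIGMA u:{..<n}. Y u)"
    unfolding G2_def by (intro card_image) (auto simp: inj_on_def doubleton_eq_iff Y_def)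
  also have "\<dots> = (\<Sum>u<n. card (Y u))"
    by (intro card_SigmaI) (auto simp: Y_def)
  also have "\<dots> = (\<Sum>u\<in>{..<n} - C. card (Y u)) + X"
    unfolding X_def using Cn by (intro sum.subset_diff) auto
  also have "(\<Sum>u\<in>{..<n} - C. card (Y u)) = (\<Sum>u\<in>{..<n} - C. n)"
  proof (rule sum.cong[OF refl])
    \<comment> \<open>Some member of \<open>owned u\<close> is not joined to \<open>A u\<close>, so
      \<open>yB_or_Ak\<close> joins \<open>B u\<close> to every \<open>y\<close>.\<close>
    fix u assume "u \<in> {..<n} - C"
    then have "Y u = {..<n}"
      using yB_or_Ak by (auto simp: C_def Y_def)
    then show "card (Y u) = n" by simp
  qed
  finally have G2: "card G2 = (n - card C) * n + X"
    using finC Cn by (simp add: card_Diff_subset)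
  have "(\<Sum>y<n. card (D y) * (n - 1)) \<le> (\<Sum>y<n. card T + ?eC)"
    by (intro sum_mono card_D) auto
  then have "(\<Sum>y<n. card (D y)) * (n - 1) \<le> n * (card T + ?eC)"
    by (simp add: sum_distrib_right)
  then have "n * card C * (n - 1) \<le> n * (card T + ?eC) + X * (n - 1)"
    unfolding sum_D[symmetric] by (simp add: add_mult_distrib)
  \<comment> \<open>After weakening \<open>n - 1\<close> to \<open>n\<close> at this place, the
    factor \<open>n\<close> from summing over all \<open>y\<close> cancels.\<close>
  also have "X * (n - 1) \<le> n * X" by simp
  finally have "n * (card C * (n - 1)) \<le> n * (card T + ?eC + X)"
    by (simp add: algebra_simps)
  then have main: "n > 0 \<Longrightarrow> card C * (n - 1) \<le> card T + ?eC + X"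
    by (simp only: mult_le_cancel1)
  have Cle: "card C \<le> n" using card_mono[OF _ Cn] by simp
  have "independent ({..<n} - C)"
    unfolding independent_def using cover by auto
  moreover have "n - card ({..<n} - C) = card C"
    using Cle finC Cn by (simp add: card_Diff_subset)
  moreover have "n * n + edge_count + card C * n \<le> card F"
  \<comment> \<open>Cancelling the factor \<open>n\<close> requires \<open>n > 0\<close>.\<close>
  proof (cases "n = 0")
    case True
    then have "edge_count = 0" "C = {}"
      using Cn unfolding edge_count_def by simp_all
    then show ?thesis using True by (metis add_0 card.empty le0 mult_0)
  next
    case False
    have "card C * n = card C * (n - 1) + card C" using False by (cases n) auto
    moreover have "card C * n + (n - card C) * n = n * n"
      using Cle by (simp add: add_mult_distrib[symmetric])
    ultimately show ?thesis
      using main False card_F G1 G2 sum_degrees_cover[OF Cn cover] by linarith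
  qed
  ultimately show thesis using that by metis
qed

text \<open>Both bounds are combined, with independent sets as complements of covers. The assumption
  \<open>r \<le> n\<close> makes the truncated difference \<open>n - r\<close> exact, so that it can
  be compared with \<open>n - card I\<close>.\<close>

lemma small_fill_in_iff:
  assumes "r \<le> n"
  shows "(\<exists>F. fill_in {..<m} edges F \<and> card F \<le> n * n + edge_count + (n - r) * n) \<longleftrightarrow>
    (\<exists>I. independent I \<and> r \<le> card I)"
proof
  assume "\<exists>F. fill_in {..<m} edges F \<and> card F \<le> n * n + edge_count + (n - r) * n"
  then obtain I where I: "independent I" and "(n - card I) * n \<le> (n - r) * n"
    by (meson add_le_cancel_left fill_in_lower_bound le_trans)
  then have "n = 0 \<or> n - card I \<le> n - r" by auto
  then show "\<exists>I. independent I \<and> r \<le> card I"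
    using I assms by (intro exI[of _ I]) auto
next
  assume "\<exists>I. independent I \<and> r \<le> card I"
  then obtain I where I: "independent I" "r \<le> card I" by blast
  define C where "C = {..<n} - I"
  have C: "C \<subseteq> {..<n}" by (auto simp: C_def)
  have cover: "u \<in> C \<or> w \<in> C" if "u < n" "w < n" "u \<noteq> w" "conf u w" for u w
    using that I by (auto simp: C_def independent_def)
  have "card C = n - card I"
    using I unfolding C_def independent_def by (simp add: card_Diff_subset finite_subset[of I "{..<n}"])
  then have "card (fill C) \<le> n * n + edge_count + (n - card I) * n"
    using card_fill_le[OF C cover] by simp
  also have "\<dots> \<le> n * n + edge_count + (n - r) * n"
    using I(2) by (intro add_left_mono mult_right_mono) auto
  finally show "\<exists>F. fill_in {..<m} edges F \<and> card F \<le> n * n + edge_count + (n - r) * n"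
    using fill_disjoint[OF C] chordal_fill[OF C cover] unfolding fill_in_def by blast
qed

end

section \<open>From 3SAT to independent sets\<close>

fun negate :: "literal \<Rightarrow> literal" where
  "negate (Pos v) = Neg v"
| "negate (Neg v) = Pos v"

definition occs :: "literal list list \<Rightarrow> (nat \<times> literal) list" where
  "occs cs = concat (map (\<lambda>j. map (Pair j) (cs ! j)) [0..<length cs])"

text \<open>An occurrence shares its clause with itself, so the relation is reflexive, as
  \<open>gadget\<close> assumes.\<close>

definition conflict :: "literal list list \<Rightarrow> nat \<Rightarrow> nat \<Rightarrow> bool" where
  "conflict cs u w \<longleftrightarrow> fst (occs cs ! u) = fst (occs cs ! w) \<or>
     snd (occs cs ! u) = negate (snd (occs cs ! w))"

lemma negate_eq_iff: "negate l = l' \<longleftrightarrow> l = negate l'"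
  by (cases l; cases l') auto

lemma conflict_sym: "conflict cs u w \<longleftrightarrow> conflict cs w u"
  unfolding conflict_def using negate_eq_iff by metis

lemma set_occs: "(j, l) \<in> set (occs cs) \<longleftrightarrow> j < length cs \<and> l \<in> set (cs ! j)"
  by (auto simp: occs_def)

text \<open>One true occurrence per clause gives a conflict-free set. Conversely, a conflict-free
  set has at most one occurrence per clause, so its size forces one in every clause, and the absence
  of complementary literals makes all of them true together.\<close>

lemma satisfiable_iff_independent:
  "satisfiable (nv, cs) \<longleftrightarrow> (\<exists>I \<subseteq> {..<length (occs cs)}.
     (\<forall>u\<in>I. \<forall>w\<in>I. u \<noteq> w \<longrightarrow> \<not> conflict cs u w) \<and> length cs \<le> card I)"
proof
  assume "satisfiable (nv, cs)"
  then obtain \<alpha> where \<alpha>: "\<And>C. C \<in> set cs \<Longrightarrow> \<exists>l\<in>set C. lit_true \<alpha> l"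
    by (auto simp: satisfiable_def)
  have "\<exists>u < length (occs cs). fst (occs cs ! u) = j \<and> lit_true \<alpha> (snd (occs cs ! u))"
    if j: "j < length cs" for j
  proof -
    obtain l where "l \<in> set (cs ! j)" "lit_true \<alpha> l"
      using \<alpha>[OF nth_mem[OF j]] by blast
    then show ?thesis
      using j set_occs[of j l cs] by (auto simp: in_set_conv_nth[of _ "occs cs"])
  qed
  then obtain f where f: "\<And>j. j < length cs \<Longrightarrow>
      f j < length (occs cs) \<and> fst (occs cs ! f j) = j \<and> lit_true \<alpha> (snd (occs cs ! f j))"
    by metis
  have "inj_on f {..<length cs}"
    using f by (intro inj_onI) (metis lessThan_iff)
  then have "card (f ` {..<length cs}) = length cs"
    by (simp add: card_image)
  moreover have neg: "\<not> lit_true \<alpha> l" if "lit_true \<alpha> (negate l)" for l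
    using that by (cases l) auto
  have "\<not> conflict cs (f i) (f j)" if "i < length cs" "j < length cs" "i \<noteq> j" for i j
    using f[OF that(1)] f[OF that(2)] neg[of "snd (occs cs ! f j)"] that(3) unfolding conflict_def by metis
  then have "\<forall>u\<in>f ` {..<length cs}. \<forall>w\<in>f ` {..<length cs}. u \<noteq> w \<longrightarrow> \<not> conflict cs u w"
    by auto
  moreover have "f ` {..<length cs} \<subseteq> {..<length (occs cs)}"
    using f by blast
  ultimately show "\<exists>I \<subseteq> {..<length (occs cs)}.
     (\<forall>u\<in>I. \<forall>w\<in>I. u \<noteq> w \<longrightarrow> \<not> conflict cs u w) \<and> length cs \<le> card I"
    by (intro exI[of _ "f ` {..<length cs}"]) simp
next
  assume "\<exists>I \<subseteq> {..<length (occs cs)}.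
     (\<forall>u\<in>I. \<forall>w\<in>I. u \<noteq> w \<longrightarrow> \<not> conflict cs u w) \<and> length cs \<le> card I"
  then obtain I where I: "I \<subseteq> {..<length (occs cs)}" "length cs \<le> card I"
    and indep: "\<And>u w. u \<in> I \<Longrightarrow> w \<in> I \<Longrightarrow> u \<noteq> w \<Longrightarrow> \<not> conflict cs u w" by blast
  have occ: "fst (occs cs ! u) < length cs \<and> snd (occs cs ! u) \<in> set (cs ! fst (occs cs ! u))"
    if "u \<in> I" for u
    using set_occs[of "fst (occs cs ! u)" "snd (occs cs ! u)" cs] that I(1) by auto
  let ?f = "\<lambda>u. fst (occs cs ! u)"
  have "inj_on ?f I"
    using indep unfolding conflict_def by (meson inj_onI)
  then have "length cs \<le> card (?f ` I)"
    using I by (simp add: card_image)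
  moreover have "?f ` I \<subseteq> {..<length cs}"
    using occ by auto
  ultimately have onto: "?f ` I = {..<length cs}"
    by (intro card_seteq) auto
  \<comment> \<open>Variables without a positive occurrence in \<open>I\<close> become false, which
    also satisfies the negative literals in \<open>I\<close>.\<close>
  define \<alpha> where "\<alpha> v \<longleftrightarrow> (\<exists>u\<in>I. snd (occs cs ! u) = Pos v)" for v
  have true: "lit_true \<alpha> (snd (occs cs ! u))" if "u \<in> I" for u
  proof (cases "snd (occs cs ! u)")
    case (Pos v)
    then show ?thesis using that by (auto simp: \<alpha>_def)
  next
    case (Neg v)
    have "snd (occs cs ! w) \<noteq> Pos v" if "w \<in> I" for w
      using indep[OF that \<open>u \<in> I\<close>] Neg unfolding conflict_def by force
    then show ?thesis using Neg by (auto simp: \<alpha>_def)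
  qed
  show "satisfiable (nv, cs)"
    unfolding satisfiable_def case_prod_conv
  proof (intro exI[of _ \<alpha>] ballI)
    fix C assume "C \<in> set cs"
    then obtain j where j: "j < length cs" "C = cs ! j" by (auto simp: in_set_conv_nth)
    then have "j \<in> ?f ` I" unfolding onto by simp
    then obtain u where "u \<in> I" "j = ?f u" by (rule imageE)
    then show "\<exists>l\<in>set C. lit_true \<alpha> l"
      using occ[of u] true[of u] j(2) by auto
  qed
qed

section \<open>The gadget as explicit lists\<close>

text \<open>In the second half of \<open>K\<close>, the vertex number \<open>u * n + t\<close> belongs to \<open>P\<^sub>u\<close> iff \<open>u\<close> and \<open>t\<close> are in
  conflict, so that a program computes \<open>val\<close> without knowing degrees.\<close>

definition cls_list :: "nat \<Rightarrow> nat list" where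
  "cls_list n = replicate n 0 @ replicate n 1 @ replicate n 3 @ replicate (n * n + n * n) 9"

text \<open>The first half of \<open>K\<close> gives every \<open>u\<close> exactly \<open>n\<close>
  vertices of its own; the second half adds one for each conflict partner, \<open>u\<close> itself
  included. The value \<open>n\<close> stands for no owner.\<close>

definition val_list :: "nat \<Rightarrow> (nat \<Rightarrow> nat \<Rightarrow> bool) \<Rightarrow> nat list" where
  "val_list n conf = [0..<n] @ [0..<n] @ [0..<n] @ concat (map (\<lambda>u. replicate n u) [0..<n]) @
     concat (map (\<lambda>u. map (\<lambda>t. if conf u t then u else n) [0..<n]) [0..<n])"

lemma length_concat_map_const:
  "(\<And>x. x \<in> set xs \<Longrightarrow> length (f x) = k) \<Longrightarrow> length (concat (map f xs)) = length xs * k"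
  by (induction xs) auto

lemma length_val_list: "length (val_list n conf) = 3 * n + (n * n + n * n)"
  by (simp add: val_list_def length_concat_map_const[where k = n])

lemma length_cls_list: "length (cls_list n) = 3 * n + (n * n + n * n)"
  by (simp add: cls_list_def)

lemma card_shifted_indices:
  assumes "length ys = l"
  shows "card {k \<in> {length xs..<length xs + l}. (xs @ ys) ! k = u} = length (filter (\<lambda>x. x = u) ys)"
proof -
  have "{k \<in> {length xs..<length xs + l}. (xs @ ys) ! k = u} = (+) (length xs) ` {i. i < length ys \<and> ys ! i = u}"
  proof (intro set_eqI iffI)
    fix k assume "k \<in> {k \<in> {length xs..<length xs + l}. (xs @ ys) ! k = u}"
    then show "k \<in> (+) (length xs) ` {i. i < length ys \<and> ys ! i = u}"
      using assms by (intro image_eqI[where x = "k - length xs"]) (auto simp: nth_append)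
  qed (use assms in \<open>auto simp: nth_append\<close>)
  then show ?thesis
    by (simp add: card_image length_filter_conv_card)
qed

lemma length_filter_concat_upt:
  "length (filter P (concat (map f [0..<n]))) = (\<Sum>v<n. length (filter P (f v)))"
  by (induction n) auto

lemma gadget_val_list:
  assumes sym: "\<And>u w. conf u w \<longleftrightarrow> conf w u" and refl: "\<And>u. u < n \<Longrightarrow> conf u u"
  shows "gadget n (3 * n + (n * n + n * n)) conf ((!) (val_list n conf))"
proof
  fix u assume u: "u < n"
  let ?ps = "concat (map (\<lambda>u. replicate n u) [0..<n])"
  let ?qs = "concat (map (\<lambda>u. map (\<lambda>t. if conf u t then u else n) [0..<n]) [0..<n])"
  let ?xs = "[0..<n] @ [0..<n] @ [0..<n]"
  have ps: "length (filter (\<lambda>x. x = u) ?ps) = n"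
  proof -
    have "length (filter (\<lambda>x. x = u) ?ps) = (\<Sum>v<n. if v = u then n else 0)"
      unfolding length_filter_concat_upt by (rule sum.cong) auto
    also have "\<dots> = n" using u by simp
    finally show ?thesis .
  qed
  have "length (filter (\<lambda>x. x = u) ?qs) = (\<Sum>v<n. if v = u then card {w. w < n \<and> conf u w} else 0)"
    unfolding length_filter_concat_upt
  proof (rule sum.cong[OF HOL.refl])
    fix v assume "v \<in> {..<n}"
    \<comment> \<open>Block \<open>v\<close> holds only the values \<open>v\<close> and
      \<open>n\<close>, and \<open>u < n\<close>; so \<open>u\<close> can occur only in its own
      block.\<close>
    have "(\<lambda>t. (if conf v t then v else n) = u) = (\<lambda>t. v = u \<and> conf u t)"
      using u by auto
    then show "length (filter (\<lambda>x. x = u) (map (\<lambda>t. if conf v t then v else n) [0..<n])) =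
        (if v = u then card {w. w < n \<and> conf u w} else 0)"
      by (simp add: filter_map comp_def length_filter_conv_card conj_commute cong: conj_cong)
  qed
  also have "\<dots> = card {w. w < n \<and> conf u w}" using u by simp
  finally have count: "length (filter (\<lambda>x. x = u) (?ps @ ?qs)) = n + card {w. w < n \<and> conf u w}"
    unfolding filter_append length_append ps by simp
  have len: "length (?ps @ ?qs) = n * n + n * n"
    by (simp add: length_concat_map_const[where k = n])
  have xs: "length ?xs = 3 * n" by simp
  have "val_list n conf = ?xs @ (?ps @ ?qs)"
    by (simp add: val_list_def)
  then show "card {k \<in> {3 * n..<3 * n + (n * n + n * n)}. val_list n conf ! k = u} =
      n + card {w. w < n \<and> conf u w}"
    using card_shifted_indices[OF len, of ?xs u] by (simp only: count xs)
next
  fix u assume "u < n"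
  then show "val_list n conf ! (n + u) = u" "val_list n conf ! (2 * n + u) = u"
    unfolding val_list_def by (simp_all only: nth_append) auto
qed (use sym refl in auto)

section \<open>Growth of running times\<close>

text \<open>Makes the asymptotic bound valid for every \<open>k\<close>, as a time bound for all
  instances must be. \<open>B\<close> sums the finitely many values up to the threshold; beyond it
  \<open>k \<ge> 1\<close>, so the exponent may be raised.\<close>

lemma bigo_powr_bound:
  fixes f :: "nat \<Rightarrow> real"
  assumes "f \<in> O(\<lambda>k. real k powr a)" "a \<le> b" "0 \<le> b"
  obtains B C where "B \<ge> 0" "C \<ge> 0" "\<And>k. f k \<le> B + C * real k powr b"
proof -
  obtain C where C: "C > 0" "eventually (\<lambda>k. norm (f k) \<le> C * norm (real k powr a)) at_top"
    using assms(1) by (elim landau_o.bigE)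
  then obtain k0 where k0: "\<And>k. k \<ge> k0 \<Longrightarrow> \<bar>f k\<bar> \<le> C * real k powr a"
    unfolding eventually_at_top_linorder by auto
  define B where "B = (\<Sum>k<Suc k0. \<bar>f k\<bar>)"
  have "f k \<le> B + C * real k powr b" for k
  proof (cases "k \<le> k0")
    case True
    then have "\<bar>f k\<bar> \<le> B"
      unfolding B_def by (intro member_le_sum) auto
    moreover have "0 \<le> C * real k powr b"
      using C by simp
    ultimately show ?thesis by linarith
  next
    case False
    then have "1 \<le> real k" by simp
    have "f k \<le> C * real k powr a"
      using k0[of k] False by linarith
    also have "\<dots> \<le> C * real k powr b"
      using C powr_mono[OF assms(2) \<open>1 \<le> real k\<close>] by (intro mult_left_mono) auto
    also have "\<dots> \<le> B + \<dots>"
      unfolding B_def by (simp add: sum_nonneg)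
    finally show ?thesis .
  qed
  then show thesis
    using that[of B C] C by (simp add: B_def sum_nonneg)
qed

text \<open>Every term is compared with a power of \<open>N + 1\<close> of exponent below 1, the
  logarithm through \<open>ln x \<le> 2 * x powr (1 / 2)\<close>.\<close>

lemma smallo_log_powr:
  fixes D E G q :: real
  assumes "q < 1"
  shows "(\<lambda>N. D + E * ln (real N + 1) + G * (real N + 1) powr q) \<in> o(\<lambda>N. real N)"
proof -
  have top: "filterlim (\<lambda>N. real N + 1) at_top sequentially"
    by (rule filterlim_at_top_mono[OF filterlim_real_sequentially]) auto
  have lin: "(\<lambda>N. (real N + 1) powr 1) \<in> O(\<lambda>N. real N)"
    by (rule bigoI[where c = 2], rule eventually_sequentiallyI[of 1]) auto
  have powr: "(\<lambda>N. (real N + 1) powr r) \<in> o(\<lambda>N. real N)" if "r < 1" for r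
    by (rule landau_o.small_big_trans[OF _ lin], subst powr_smallo_iff[OF top]) (use that in simp_all)
  have "(\<lambda>N. ln (real N + 1)) \<in> O(\<lambda>N. (real N + 1) powr (1 / 2))"
  proof (rule bigoI[where c = 2], rule always_eventually, rule allI)
    fix N
    show "norm (ln (real N + 1)) \<le> 2 * norm ((real N + 1) powr (1 / 2))"
      using ln_powr_bound[of "real N + 1" "1 / 2"] by simp
  qed
  then have "(\<lambda>N. ln (real N + 1)) \<in> o(\<lambda>N. real N)"
    by (rule landau_o.big_small_trans) (simp add: powr)
  moreover have "(\<lambda>N. D) \<in> o(\<lambda>N. real N)"
    using powr[of 0] landau_o.small.cmult_in_iff[of D "\<lambda>_. 1"] by (cases "D = 0") simp_all
  ultimately show ?thesis
    using powr[OF assms] by (intro sum_in_smallo(1)) auto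
qed

section \<open>Reasoning about programs\<close>

fun writes :: "prog \<Rightarrow> nat set" where
  "writes (Const r c) = {r}"
| "writes (Add r a b) = {r}"
| "writes (Sub r a b) = {r}"
| "writes (Load r a) = {r}"
| "writes (Store a b) = {}"
| "writes (Seq p q) = writes p \<union> writes q"
| "writes (Cond r p q) = writes p \<union> writes q"
| "writes (While r p) = writes p"

lemma exec_unwritten: "exec p s t s' \<Longrightarrow> r \<notin> writes p \<Longrightarrow> fst s' r = fst s r"
  by (induction rule: exec.induct) auto

text \<open>A total correctness triple with a time bound. The frame condition is built in, so that
  postconditions need to mention only what changes.\<close>

definition run :: "prog \<Rightarrow> (nat \<Rightarrow> nat) \<Rightarrow> (nat \<Rightarrow> nat) \<Rightarrow> nat \<Rightarrow>
    ((nat \<Rightarrow> nat) \<Rightarrow> (nat \<Rightarrow> nat) \<Rightarrow> bool) \<Rightarrow> bool" where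
  "run p R M b Q \<longleftrightarrow> (\<exists>t R' M'. exec p (R, M) t (R', M') \<and> t \<le> b \<and> Q R' M' \<and>
     (\<forall>r. r \<notin> writes p \<longrightarrow> R' r = R r))"

lemma runI: "exec p (R, M) t (R', M') \<Longrightarrow> t \<le> b \<Longrightarrow> Q R' M' \<Longrightarrow> run p R M b Q"
  unfolding run_def using exec_unwritten[of p "(R, M)" t "(R', M')"] by auto

lemma run_mono:
  assumes "run p R M b P" "b \<le> c"
    "\<And>R' M'. P R' M' \<Longrightarrow> (\<And>r. r \<notin> writes p \<Longrightarrow> R' r = R r) \<Longrightarrow> Q R' M'"
  shows "run p R M c Q"
  using assms unfolding run_def by (meson le_trans)

lemma run_Seq:
  assumes "run p R M b P"
    "\<And>R' M'. P R' M' \<Longrightarrow> (\<And>r. r \<notin> writes p \<Longrightarrow> R' r = R r) \<Longrightarrow> run q R' M' c Q"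
    "b + c \<le> d"
  shows "run (Seq p q) R M d Q"
proof -
  from assms(1) obtain t R' M' where p: "exec p (R, M) t (R', M')" "t \<le> b" "P R' M'"
    "\<And>r. r \<notin> writes p \<Longrightarrow> R' r = R r" unfolding run_def by blast
  from assms(2)[OF p(3,4)] obtain u R'' M'' where q: "exec q (R', M') u (R'', M'')" "u \<le> c" "Q R'' M''"
    unfolding run_def by blast
  show ?thesis
    using runI[OF exec.Seq[OF p(1) q(1)]] p(2) q(2,3) assms(3) by simp
qed

text \<open>The variant \<open>\<mu>\<close> bounds the number of iterations. Each costs one test
  and at most \<open>b\<close> steps, and the last, failing test costs one more.\<close>

lemma run_While:
  assumes "I R M"
    and "\<And>R' M'. I R' M' \<Longrightarrow> R' r \<noteq> 0 \<Longrightarrow> run p R' M' b (\<lambda>R'' M''. I R'' M'' \<and> (\<mu> R'' M'' :: nat) < \<mu> R' M')"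
  shows "run (While r p) R M (\<mu> R M * (b + 1) + 1) (\<lambda>R' M'. I R' M' \<and> R' r = 0)"
  using assms(1)
proof (induction "\<mu> R M" arbitrary: R M rule: less_induct)
  case less
  show ?case
  proof (cases "R r = 0")
    case True
    then have "exec (While r p) (R, M) 1 (R, M)" by (intro exec.WhileFalse) simp
    then show ?thesis using less.prems True by (elim runI) auto
  next
    case False
    then obtain t R' M' where p: "exec p (R, M) t (R', M')" "t \<le> b" "I R' M'" "\<mu> R' M' < \<mu> R M"
      using assms(2)[OF less.prems] unfolding run_def by blast
    from less.hyps[OF p(4,3)] obtain u R'' M'' where
      q: "exec (While r p) (R', M') u (R'', M'')" "u \<le> \<mu> R' M' * (b + 1) + 1" "I R'' M''" "R'' r = 0"
      unfolding run_def by blast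
    have "Suc (\<mu> R' M') * (b + 1) \<le> \<mu> R M * (b + 1)"
      using p(4) by (intro mult_right_mono) auto
    then have "Suc (t + u) \<le> \<mu> R M * (b + 1) + 1"
      using p(2) q(2) by simp
    then show ?thesis
      using runI[OF exec.WhileTrue[OF _ p(1) q(1)]] False q by simp
  qed
qed

fun straight :: "prog \<Rightarrow> bool" where
  "straight (Seq p q) \<longleftrightarrow> straight p \<and> straight q"
| "straight (Cond r p q) \<longleftrightarrow> straight p \<and> straight q"
| "straight (While r p) \<longleftrightarrow> False"
| "straight _ \<longleftrightarrow> True"

fun steps :: "prog \<Rightarrow> nat" where
  "steps (Seq p q) = steps p + steps q"
| "steps (Cond r p q) = Suc (max (steps p) (steps q))"
| "steps _ = 1"

fun effect :: "prog \<Rightarrow> (nat \<Rightarrow> nat) \<Rightarrow> (nat \<Rightarrow> nat) \<Rightarrow> state" where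
  "effect (Const r c) R M = (R(r := c), M)"
| "effect (Add r a b) R M = (R(r := R a + R b), M)"
| "effect (Sub r a b) R M = (R(r := R a - R b), M)"
| "effect (Load r a) R M = (R(r := M (R a)), M)"
| "effect (Store a b) R M = (R, M(R a := R b))"
| "effect (Seq p q) R M = (case effect p R M of (R', M') \<Rightarrow> effect q R' M')"
| "effect (Cond r p q) R M = (if R r \<noteq> 0 then effect p R M else effect q R M)"
| "effect (While r p) R M = (R, M)"

lemma exec_straight: "straight p \<Longrightarrow> \<exists>t\<le>steps p. exec p (R, M) t (effect p R M)"
proof (induction p arbitrary: R M)
  case (Seq p q)
  obtain R' M' where e: "effect p R M = (R', M')" by fastforce
  from Seq obtain t u where "t \<le> steps p" "exec p (R, M) t (R', M')" "u \<le> steps q"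
    "exec q (R', M') u (effect q R' M')" using e by (metis straight.simps(1))
  then show ?case
    using e by (intro exI[of _ "t + u"]) (auto intro: exec.Seq)
next
  case (Cond r p q)
  then obtain t u where "t \<le> steps p" "exec p (R, M) t (effect p R M)" "u \<le> steps q"
    "exec q (R, M) u (effect q R M)" by (metis straight.simps(2))
  then show ?case
    by (intro exI[of _ "Suc (if R r \<noteq> 0 then t else u)"]) (auto intro: exec.CondTrue exec.CondFalse)
qed (auto intro: exec.intros(1-5)[unfolded One_nat_def])

text \<open>Turns a triple for a loop-free program into symbolic evaluation by the
  simplifier.\<close>

lemma run_straight:
  assumes "straight p" "case effect p R M of (R', M') \<Rightarrow> Q R' M'" "steps p \<le> b"
  shows "run p R M b Q"
proof -
  obtain R' M' where e: "effect p R M = (R', M')" by fastforce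
  obtain t where t: "t \<le> steps p" "exec p (R, M) t (R', M')"
    using exec_straight[OF assms(1), of R M] e by auto
  show ?thesis
    using assms e t(1) by (intro runI[OF t(2)]) auto
qed

text \<open>Counts register \<open>i\<close> from 0 up to the value of register \<open>l\<close>, with \<open>d\<close> as scratch register. Register 2 must
  hold the constant 1. A time bound \<open>?t\<close> in a goal, here and below, is supplied by the last step of the proof.\<close>

definition For :: "nat \<Rightarrow> nat \<Rightarrow> nat \<Rightarrow> prog \<Rightarrow> prog" where
  "For i l d p = Seq (Const i 0) (Seq (Sub d l i)
     (While d (Seq p (Seq (Add i i 2) (Sub d l i)))))"

lemma writes_For [simp]: "writes (For i l d p) = insert i (insert d (writes p))"
  by (auto simp: For_def)

lemma straight_For [simp]: "\<not> straight (For i l d p)"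
  by (simp add: For_def)

\<comment> \<open>The loop itself changes \<open>i\<close> and \<open>d\<close>, so
  \<open>Inv\<close> must be insensitive to both. Register \<open>d\<close> holds the number of
  iterations left and is the variant; an iteration costs the test, the body and two updates.\<close>
schematic_goal run_For:
  assumes one: "R 2 = 1" and lim: "R l = n"
    and reg: "{i, l, 2} \<inter> writes p = {}" "distinct [i, l, d, 2]"
    and init: "Inv 0 R M"
    and indep: "\<And>j R' M' x y. Inv j (R'(i := x, d := y)) M' \<longleftrightarrow> Inv j R' M'"
    and step: "\<And>j R' M'. j < n \<Longrightarrow> Inv j R' M' \<Longrightarrow> R' i = j \<Longrightarrow>
      (\<And>r. r \<notin> insert i (insert d (writes p)) \<Longrightarrow> R' r = R r) \<Longrightarrow> run p R' M' b (Inv (Suc j))"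
  shows "run (For i l d p) R M ?t (Inv n)" (is "run ?prog _ _ _ ?post")
proof -
  let ?same = "\<lambda>R'. \<forall>r. r \<notin> insert i (insert d (writes p)) \<longrightarrow> R' r = R r"
  let ?I = "\<lambda>R' M'. R' i \<le> n \<and> R' d = n - R' i \<and> Inv (R' i) R' M' \<and> ?same R'"
  have indep_i: "Inv j (R'(i := x)) M' \<longleftrightarrow> Inv j R' M'" for j R' M' x
    using indep[of j R' x "R' d" M'] by (metis fun_upd_triv fun_upd_twist reg(2) distinct_length_2_or_more)
  have "run (While d (Seq p (Seq (Add i i 2) (Sub d l i)))) (R(i := 0, d := n)) M
    ((R(i := 0, d := n)) d * ((b + 2) + 1) + 1) (\<lambda>R' M'. ?I R' M' \<and> R' d = 0)"
  proof (rule run_While)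
    show "?I (R(i := 0, d := n)) M"
      using init indep reg(2) by simp
  next
    fix R' M' assume I: "?I R' M'" and d: "R' d \<noteq> 0"
    then have lt: "R' i < n" by simp
    have "run p R' M' b (Inv (Suc (R' i)))"
      using step[OF lt] I by blast
    then show "run (Seq p (Seq (Add i i 2) (Sub d l i))) R' M' (b + 2)
      (\<lambda>R'' M''. ?I R'' M'' \<and> R'' d < R' d)"
    proof (rule run_Seq)
      fix R'' M'' assume J: "Inv (Suc (R' i)) R'' M''" and same: "\<And>r. r \<notin> writes p \<Longrightarrow> R'' r = R' r"
      let ?R = "R''(i := Suc (R' i), d := n - Suc (R' i))"
      have "R'' i = R' i" "R'' l = n" "R'' 2 = 1"
        using same[of i] same[of l] same[of 2] I reg one lim by auto
      then have step: "run (Seq (Add i i 2) (Sub d l i)) R'' M'' 2 (\<lambda>R\<^sub>3 M\<^sub>3. R\<^sub>3 = ?R \<and> M\<^sub>3 = M'')"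
        using reg(2) by (intro run_straight) auto
      have "Inv (Suc (R' i)) ?R M''" using J by (simp only: indep)
      then have good: "?I ?R M'' \<and> ?R d < R' d"
        using I same reg(2) lt by simp
      show "run (Seq (Add i i 2) (Sub d l i)) R'' M'' 2 (\<lambda>R'' M''. ?I R'' M'' \<and> R'' d < R' d)"
        by (rule run_mono[OF step order.refl]) (elim conjE, hypsubst, rule good)
    qed simp
  qed
  note loop = this
  have init_d: "run (Sub d l i) (R(i := 0)) M 1 (\<lambda>R' M'. R' = R(i := 0, d := n) \<and> M' = M)"
    using lim reg(2) by (intro run_straight) auto
  have init_i: "run (Const i 0) R M 1 (\<lambda>R' M'. R' = R(i := 0) \<and> M' = M)"
    by (intro run_straight) auto
  have "run (For i l d p) R M (1 + (1 + (n * (b + 3) + 1))) (\<lambda>R' M'. ?I R' M' \<and> R' d = 0)"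
    unfolding For_def
    by (rule run_Seq[OF init_i], elim conjE, simp only:, rule run_Seq[OF init_d], elim conjE, simp only:,
        rule run_mono[OF loop]) (auto simp: algebra_simps)
  then show "run ?prog R M (n * (b + 3) + 3) ?post"
    by (rule run_mono) (auto simp: le_antisym)
qed

section \<open>The reduction as a program\<close>

notation Seq (infixr ";;" 55)

text \<open>The part of \<open>encode_cnf\<close> behind its two header entries; it starts at
  address 2.\<close>

definition code :: "literal list list \<Rightarrow> nat list" where
  "code cs = concat (map (\<lambda>C. length C # map lit_code C) cs)"

lemma nth_concat_take:
  assumes "j < length xss" "i < length (xss ! j)"
  shows "concat xss ! (length (concat (take j xss)) + i) = xss ! j ! i"
    and "length (concat (take j xss)) + i < length (concat xss)"
proof -
  have "concat xss = concat (take j xss) @ xss ! j @ concat (drop (Suc j) xss)"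
    using assms(1) by (metis concat.simps(2) concat_append id_take_nth_drop)
  then show "concat xss ! (length (concat (take j xss)) + i) = xss ! j ! i"
    and "length (concat (take j xss)) + i < length (concat xss)"
    using assms(2) by (simp_all add: nth_append)
qed

lemma length_code: "length (code cs) = length cs + length (concat cs)"
  by (induction cs) (simp_all add: code_def)

lemma code_nth:
  assumes "j < length cs"
  shows "code cs ! length (code (take j cs)) = length (cs ! j)"
    and "i < length (cs ! j) \<Longrightarrow> code cs ! (length (code (take j cs)) + Suc i) = lit_code (cs ! j ! i)"
    and "i \<le> length (cs ! j) \<Longrightarrow> length (code (take j cs)) + i < length (code cs)"
  using nth_concat_take[of j "map (\<lambda>C. length C # map lit_code C) cs" 0]
    nth_concat_take[of j "map (\<lambda>C. length C # map lit_code C) cs" "Suc i"]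
    nth_concat_take(2)[of j "map (\<lambda>C. length C # map lit_code C) cs" i] assms
  by (simp_all add: code_def take_map)

lemma length_occs: "length (occs cs) = length (concat cs)"
proof -
  have "map length cs = map (\<lambda>j. length (cs ! j)) [0..<length cs]"
    by (rule nth_equalityI) auto
  then show ?thesis
    by (simp add: occs_def length_concat comp_def)
qed

lemma occs_nth:
  assumes "j < length cs" "i < length (cs ! j)"
  shows "occs cs ! (length (concat (take j cs)) + i) = (j, cs ! j ! i)"
    and "length (concat (take j cs)) + i < length (concat cs)"
proof -
  let ?xss = "map (\<lambda>j. map (Pair j) (cs ! j)) [0..<length cs]"
  have e: "map length ?xss = map length cs"
    by (rule nth_equalityI) auto
  have "length (concat (take j cs)) = length (concat (take j ?xss))"
    unfolding length_concat take_map[symmetric] e ..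
  then show "occs cs ! (length (concat (take j cs)) + i) = (j, cs ! j ! i)"
    using nth_concat_take(1)[of j ?xss i] assms by (simp add: occs_def)
  show "length (concat (take j cs)) + i < length (concat cs)"
    using nth_concat_take(2)[of j cs i] assms by simp
qed

definition seg :: "(nat \<Rightarrow> nat) \<Rightarrow> nat \<Rightarrow> nat list \<Rightarrow> bool" where
  "seg M a xs \<longleftrightarrow> (\<forall>i<length xs. M (a + i) = xs ! i)"

lemma seg_nth: "seg M a xs \<Longrightarrow> i < length xs \<Longrightarrow> M (a + i) = xs ! i"
  by (simp add: seg_def)

lemma seg_Nil [simp]: "seg M a []"
  by (simp add: seg_def)

lemma seg_snoc: "seg M a xs \<Longrightarrow> c = a + length xs \<Longrightarrow> seg (M(c := v)) a (xs @ [v])"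
  by (auto simp: seg_def nth_append less_Suc_eq)

lemma seg_cong: "seg M a xs \<Longrightarrow> (\<And>i. a \<le> i \<Longrightarrow> i < a + length xs \<Longrightarrow> M' i = M i) \<Longrightarrow> seg M' a xs"
  by (auto simp: seg_def)

section \<open>Counting literal occurrences and laying out the memory\<close>

text \<open>
  Use of the registers: 0 constant 0; 2 constant 1; 3 \<open>n\<close>; 4 input pointer; 5 whether there is an
  empty clause; 6, 7 and 18, 19 outer and inner loops; 8 clause length; 9 \<open>n\<^sup>2\<close>; 10 \<open>m\<close>; 11 \<open>m\<^sup>2\<close>;
  12, 13, 14 base addresses of three tables with an entry for every literal occurrence (clause number,
  literal, negated literal); 15, 16 base addresses of two tables with an entry for every vertex of the
  constructed graph (class, \<open>val\<close>); 17 end of the tables; 24 number of edges of the conflict graph;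
  25, 26, 27 output pointers; 29 number of clauses; all others are scratch. The tables lie above both
  the input and the output.
\<close>

definition count_prog :: prog where
  "count_prog = For 6 29 7 (Load 8 4 ;; Cond 8 (Const 20 0) (Const 5 1) ;;
     Add 3 3 8 ;; Add 4 4 8 ;; Add 4 4 2)"

schematic_goal run_count_prog:
  assumes "R 2 = 1" "R 3 = 0" "R 4 = 2" "R 5 = 0" "R 29 = length cs" "seg M 2 (code cs)"
  shows "run count_prog R M ?t (\<lambda>R' M'. M' = M \<and> R' 3 = length (concat cs) \<and>
     R' 4 = 2 + length (code cs) \<and> (R' 5 \<noteq> 0 \<longleftrightarrow> [] \<in> set cs))" (is "run ?prog _ _ _ ?post")
proof -
  let ?Inv = "\<lambda>j R' M'. M' = M \<and> R' 3 = length (concat (take j cs)) \<and>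
     R' 4 = 2 + length (code (take j cs)) \<and> (R' 5 \<noteq> 0 \<longleftrightarrow> [] \<in> set (take j cs))"
  have "run count_prog R M (length cs * (6 + 3) + 3) (?Inv (length cs))"
    unfolding count_prog_def
  proof (rule run_For)
    fix j R' M'
    assume j: "j < length cs" and I: "?Inv j R' M'"
      and same: "\<And>r. r \<notin> insert 6 (insert 7 (writes (Load 8 4 ;; Cond 8 (Const 20 0) (Const 5 1) ;;
     Add 3 3 8 ;; Add 4 4 8 ;; Add 4 4 2))) \<Longrightarrow> R' r = R r"
    have "M (R' 4) = length (cs ! j)"
      using seg_nth[OF assms(6), of "length (code (take j cs))"] code_nth(1)[OF j] code_nth(3)[OF j, of 0] I by simp
    moreover have "R' 2 = 1" using same[of 2] assms by simp
    ultimately show "run (Load 8 4 ;; Cond 8 (Const 20 0) (Const 5 1) ;;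
     Add 3 3 8 ;; Add 4 4 8 ;; Add 4 4 2) R' M' 6 (?Inv (Suc j))"
      using I j by (intro run_straight) (auto simp: take_Suc_conv_app_nth[OF j] length_code)
  qed (use assms in \<open>auto simp: code_def\<close>)
  then show "run ?prog R M (length cs * 9 + 3) ?post" by simp
qed

text \<open>Products are computed by repeated addition. The first table address is a sum of
  \<open>m * m\<close>, the end of the input and 2, hence beyond both the input and the
  output.\<close>

definition sizes_prog :: prog where
  "sizes_prog = For 6 3 7 (Add 9 9 3) ;;
     (Add 10 3 3 ;; Add 10 10 3 ;; Add 10 10 9 ;; Add 10 10 9) ;;
     For 6 10 7 (Add 11 11 10) ;;
     (Add 12 11 4 ;; Add 12 12 2 ;; Add 12 12 2 ;; Add 13 12 3 ;; Add 14 13 3 ;; Add 15 14 3 ;;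
      Add 16 15 10 ;; Add 17 16 10)"

lemma run_multiply:
  assumes "R 2 = 1" "R a = 0" "distinct [6, 7, 2, a, b]"
  shows "run (For 6 b 7 (Add a a b)) R M (R b * 4 + 3) (\<lambda>R' M'. M' = M \<and> R' a = R b * R b)"
proof -
  have "run (For 6 b 7 (Add a a b)) R M (R b * (1 + 3) + 3) (\<lambda>R' M'. M' = M \<and> R' a = R b * R b)"
  proof (rule run_For[where Inv = "\<lambda>j R' M'. M' = M \<and> R' a = j * R b"])
    fix j R' M' assume "M' = M \<and> R' a = j * R b"
      and same: "\<And>r. r \<notin> insert 6 (insert 7 (writes (Add a a b))) \<Longrightarrow> R' r = R r"
    then show "run (Add a a b) R' M' 1 (\<lambda>R' M'. M' = M \<and> R' a = Suc j * R b)"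
      using same[of b] assms by (intro run_straight) auto
  qed (use assms in auto)
  then show ?thesis by simp
qed

schematic_goal run_sizes_prog:
  fixes R :: "nat \<Rightarrow> nat"
  defines "n \<equiv> R 3"
  defines "m \<equiv> 3 * n + (n * n + n * n)"
  defines "z \<equiv> m * m + R 4 + 2"
  assumes "R 2 = 1" "R 9 = 0" "R 11 = 0"
  shows "run sizes_prog R M ?t (\<lambda>R' M'. M' = M \<and> R' 9 = n * n \<and> R' 10 = m \<and>
    R' 11 = m * m \<and> R' 12 = z \<and> R' 13 = z + n \<and> R' 14 = z + 2 * n \<and> R' 15 = z + 3 * n \<and>
    R' 16 = z + 3 * n + m \<and> R' 17 = z + 3 * n + 2 * m)" (is "run _ _ _ _ ?Q")
proof -
  let ?p1 = "For 6 3 7 (Add 9 9 3)" and ?p3 = "For 6 10 7 (Add 11 11 10)"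
  let ?p2 = "Add 10 3 3 ;; Add 10 10 3 ;; Add 10 10 9 ;; Add 10 10 9"
  let ?p4 = "Add 12 11 4 ;; Add 12 12 2 ;; Add 12 12 2 ;; Add 13 12 3 ;; Add 14 13 3 ;; Add 15 14 3 ;;
      Add 16 15 10 ;; Add 17 16 10"
  have 1: "run ?p1 R M (n * 4 + 3) (\<lambda>R' M'. M' = M \<and> R' 9 = n * n)"
    unfolding n_def using assms by (intro run_multiply) auto
  show "run sizes_prog R M (n * 4 + m * 4 + 18) ?Q"
    unfolding sizes_prog_def
  proof (rule run_Seq[OF 1], elim conjE)
    fix R1 M1 assume s1: "M1 = M" "R1 9 = n * n" "\<And>r. r \<notin> writes ?p1 \<Longrightarrow> R1 r = R r"
    have r1: "R1 3 = n" "R1 4 = R 4" "R1 2 = 1" "R1 11 = 0"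
      using s1(3)[of 3] s1(3)[of 4] s1(3)[of 2] s1(3)[of 11] assms by simp_all
    have 2: "run ?p2 R1 M1 4 (\<lambda>R' M'. M' = M \<and> R' = R1(10 := m))"
      using s1 r1 by (intro run_straight) (auto simp: m_def)
    show "run (?p2 ;; ?p3 ;; ?p4) R1 M1 (4 + (m * 4 + 3 + 8)) ?Q"
    proof (rule run_Seq[OF 2], elim conjE)
      fix R2 M2 assume s2: "M2 = M" "R2 = R1(10 := m)"
      have 3: "run ?p3 R2 M2 (m * 4 + 3) (\<lambda>R' M'. M' = M2 \<and> R' 11 = m * m)"
        using run_multiply[of R2 11 10 M2] s2 r1 by simp
      show "run (?p3 ;; ?p4) R2 M2 (m * 4 + 3 + 8) ?Q"
      proof (rule run_Seq[OF 3], elim conjE)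
        fix R3 M3 assume s3: "M3 = M2" "R3 11 = m * m" "\<And>r. r \<notin> writes ?p3 \<Longrightarrow> R3 r = R2 r"
        have "R3 9 = n * n" "R3 10 = m" "R3 3 = n" "R3 4 = R 4" "R3 2 = 1"
          using s3(3)[of 9] s3(3)[of 10] s3(3)[of 3] s3(3)[of 4] s3(3)[of 2] s2 s1 r1 by simp_all
        then show "run ?p4 R3 M3 8 ?Q"
          using s3(1,2) s2 by (intro run_straight) (auto simp: z_def)
      qed simp
    qed simp
  qed simp
qed

section \<open>Tables of literal occurrences\<close>

text \<open>Negation flips the last bit of a literal code. The parity is found by subtracting 2 from
  a copy until at most 1 is left.\<close>

definition negate_prog :: prog where
  "negate_prog = (Add 21 20 0 ;; Sub 22 21 2) ;;
     While 22 (Sub 21 21 2 ;; Sub 21 21 2 ;; Sub 22 21 2) ;; Cond 21 (Sub 23 20 2) (Add 23 20 2)"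

lemma lit_code_negate:
  "lit_code (negate l) = (if even (lit_code l) then lit_code l + 1 else lit_code l - 1)"
  by (cases l) auto

lemma lit_code_less: "var l < v \<Longrightarrow> lit_code l < 2 * v"
  by (cases l) auto

lemma run_negate_prog:
  assumes "R 0 = 0" "R 2 = 1"
  shows "run negate_prog R M (4 * R 20 + 5)
    (\<lambda>R' M'. M' = M \<and> R' 20 = R 20 \<and> R' 23 = (if even (R 20) then R 20 + 1 else R 20 - 1))"
    (is "run _ _ _ _ ?Q")
proof -
  let ?p1 = "Add 21 20 0 ;; Sub 22 21 2"
  let ?p2 = "While 22 (Sub 21 21 2 ;; Sub 21 21 2 ;; Sub 22 21 2)"
  let ?p3 = "Cond 21 (Sub 23 20 2) (Add 23 20 2)"
  let ?I = "\<lambda>(R' :: nat \<Rightarrow> nat) M'. M' = M \<and> R' 22 = R' 21 - 1 \<and> even (R' 21) = even (R 20) \<and> R' 2 = 1 \<and> R' 20 = R 20"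
  have 1: "run ?p1 R M 2 (\<lambda>R' M'. ?I R' M' \<and> R' 21 = R 20)"
    using assms by (intro run_straight) auto
  show ?thesis
    unfolding negate_prog_def
  proof (rule run_Seq[OF 1])
    fix R1 M1 assume I: "?I R1 M1 \<and> R1 21 = R 20"
    have 2: "run ?p2 R1 M1 (R1 22 * (3 + 1) + 1) (\<lambda>R' M'. ?I R' M' \<and> R' 22 = 0)"
    proof (rule run_While)
      fix R' M' assume J: "?I R' M'" and "R' 22 \<noteq> 0"
      then obtain k where "R' 21 = Suc (Suc k)"
        by (metis diff_0_eq_0 diff_Suc_1 not0_implies_Suc)
      then show "run (Sub 21 21 2 ;; Sub 21 21 2 ;; Sub 22 21 2) R' M' 3
        (\<lambda>R'' M''. ?I R'' M'' \<and> R'' 22 < R' 22)"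
        using J by (intro run_straight) auto
    qed (use I in simp)
    show "run (?p2 ;; ?p3) R1 M1 (4 * R 20 + 3) ?Q"
    proof (rule run_Seq[OF 2])
      fix R2 M2 assume J: "?I R2 M2 \<and> R2 22 = 0"
      then have "R2 21 = 0 \<or> R2 21 = 1" by auto
      then show "run ?p3 R2 M2 2 ?Q"
        using J by (intro run_straight) auto
    qed (use I in simp)
  qed simp
qed

text \<open>\<open>u\<close> is the number of occurrences entered so far, so one predicate serves
  both as loop invariant and as final result.\<close>

definition tables :: "literal list list \<Rightarrow> nat \<Rightarrow> nat \<Rightarrow> (nat \<Rightarrow> nat) \<Rightarrow> bool" where
  "tables cs z u M \<longleftrightarrow> seg M z (take u (map fst (occs cs))) \<and>
     seg M (z + length (concat cs)) (take u (map (\<lambda>x. lit_code (snd x)) (occs cs))) \<and>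
     seg M (z + 2 * length (concat cs)) (take u (map (\<lambda>x. lit_code (negate (snd x))) (occs cs)))"

lemma seg_extend:
  "seg M a xs \<Longrightarrow> M' (a + length xs) = v \<Longrightarrow>
    (\<And>i. a \<le> i \<Longrightarrow> i < a + length xs \<Longrightarrow> M' i = M i) \<Longrightarrow> seg M' a (xs @ [v])"
  by (auto simp: seg_def nth_append less_Suc_eq)

lemma tables_Suc:
  assumes "tables cs z u M" "u < length (concat cs)" "occs cs ! u = (j, l)"
  shows "tables cs z (Suc u) (M(z + u := j, z + length (concat cs) + u := lit_code l,
    z + 2 * length (concat cs) + u := lit_code (negate l)))"
proof -
  define n where "n = length (concat cs)"
  have n: "length (occs cs) = n" by (simp add: n_def length_occs)
  have t: "take (Suc u) (map f (occs cs)) = take u (map f (occs cs)) @ [f (j, l)]" for f :: "_ \<Rightarrow> nat"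
    using assms(2,3) by (simp add: take_Suc_conv_app_nth length_occs)
  show ?thesis
    using assms(1,2) unfolding tables_def t n_def[symmetric]
    by (intro conjI seg_extend[of M]) (auto simp: n)
qed

lemma tables_cong: "tables cs z u M \<Longrightarrow>
    (\<And>a. z \<le> a \<Longrightarrow> a < z + 3 * length (concat cs) \<Longrightarrow> M' a = M a) \<Longrightarrow> tables cs z u M'"
  unfolding tables_def by (auto elim!: seg_cong simp: length_occs)

definition literal_prog :: prog where
  "literal_prog = Load 20 4 ;; negate_prog ;;
     (Store 25 6 ;; Store 26 20 ;; Store 27 23 ;; Add 25 25 2 ;; Add 26 26 2 ;; Add 27 27 2 ;; Add 4 4 2)"

lemma writes_literal_prog [simp]: "writes literal_prog = {4, 20, 21, 22, 23, 25, 26, 27}"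
  by (auto simp: literal_prog_def negate_prog_def)

lemma run_literal_prog:
  assumes "R 0 = 0" "R 2 = 1" "M (R 4) = lit_code l"
  shows "run literal_prog R M (4 * lit_code l + 13) (\<lambda>R' M'. R' 4 = R 4 + 1 \<and>
    R' 25 = R 25 + 1 \<and> R' 26 = R 26 + 1 \<and> R' 27 = R 27 + 1 \<and>
    M' = M(R 25 := R 6, R 26 := lit_code l, R 27 := lit_code (negate l)))"
    (is "run _ _ _ _ ?Q")
proof -
  have 1: "run (Load 20 4) R M 1 (\<lambda>R' M'. R' 20 = lit_code l \<and> M' = M)"
    using assms by (intro run_straight) auto
  let ?p = "Store 25 6 ;; Store 26 20 ;; Store 27 23 ;; Add 25 25 2 ;; Add 26 26 2 ;; Add 27 27 2 ;; Add 4 4 2"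
  show ?thesis
    unfolding literal_prog_def
  proof (rule run_Seq[OF 1], elim conjE)
    fix R1 M1 assume s1: "R1 20 = lit_code l" "M1 = M" "\<And>r. r \<notin> writes (Load 20 4) \<Longrightarrow> R1 r = R r"
    have r1: "R1 0 = 0" "R1 2 = 1" using s1(3)[of 0] s1(3)[of 2] assms by auto
    show "run (negate_prog ;; ?p) R1 M1 (4 * lit_code l + 12) ?Q"
    proof (rule run_Seq[OF run_negate_prog[OF r1]], elim conjE)
      fix R2 M2 assume s2: "M2 = M1" "R2 20 = R1 20" "R2 23 = (if even (R1 20) then R1 20 + 1 else R1 20 - 1)"
        "\<And>r. r \<notin> writes negate_prog \<Longrightarrow> R2 r = R1 r"
      have "R2 r = R r" if "r \<in> {2, 4, 6, 25, 26, 27}" for r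
        using s2(4)[of r] s1(3)[of r] that by (auto simp: negate_prog_def)
      then have "R2 2 = 1" "R2 4 = R 4" "R2 6 = R 6" "R2 25 = R 25" "R2 26 = R 26" "R2 27 = R 27"
        using assms by auto
      moreover have "R2 23 = lit_code (negate l)" "R2 20 = lit_code l" "M2 = M"
        using s2 s1 by (simp_all add: lit_code_negate)
      ultimately show "run ?p R2 M2 7 ?Q"
        by (intro run_straight) auto
    qed (use s1 in simp)
  qed simp
qed

definition table_prog :: prog where
  "table_prog = (Const 4 2 ;; Add 25 12 0 ;; Add 26 13 0 ;; Add 27 14 0) ;;
     For 6 29 7 ((Load 8 4 ;; Add 4 4 2) ;; For 18 8 19 literal_prog)"

schematic_goal run_table_prog:
  fixes cs :: "literal list list" and M0 :: "nat \<Rightarrow> nat" and z v :: nat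
  defines "n \<equiv> length (concat cs)"
  assumes R: "R 0 = 0" "R 2 = 1" "R 29 = length cs" "R 12 = z" "R 13 = z + n" "R 14 = z + 2 * n"
    and code: "seg M0 2 (code cs)" and z: "z \<ge> 2 + length (code cs)"
    and zero: "\<And>a. a \<ge> z \<Longrightarrow> M0 a = 0"
    and vars: "\<And>C l. C \<in> set cs \<Longrightarrow> l \<in> set C \<Longrightarrow> var l < v"
  shows "run table_prog R M0 ?t
    (\<lambda>R' M'. tables cs z n M' \<and> (\<forall>a. a \<ge> z + 3 * n \<longrightarrow> M' a = 0))" (is "run ?prog _ _ _ ?post")
proof -
  \<comment> \<open>Clause \<open>j\<close> starts at index \<open>len j\<close> in the tables and
    at address \<open>pos j\<close> in the input.\<close>
  define len where "len j = length (concat (take j cs))" for j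
  define pos where "pos j = 2 + length (code (take j cs))" for j
  define st where "st u R' M' \<longleftrightarrow> tables cs z u M' \<and> R' (25 :: nat) = z + u \<and> R' 26 = z + n + u \<and>
    R' 27 = z + 2 * n + u \<and> (\<forall>a<z. M' a = M0 a) \<and> (\<forall>a\<ge>z + 3 * n. M' a = 0)" for u and R' M' :: "nat \<Rightarrow> nat"
  let ?body = "(Load 8 4 ;; Add 4 4 2) ;; For 18 8 19 literal_prog"
  have 1: "run (Const 4 2 ;; Add 25 12 0 ;; Add 26 13 0 ;; Add 27 14 0) R M0 4
      (\<lambda>R' M'. R' 4 = pos 0 \<and> st 0 R' M')"
    using R zero by (intro run_straight) (auto simp: st_def tables_def pos_def code_def)
  have "run table_prog R M0 (4 + (length cs * ((n * (8 * v + 13 + 3) + 5) + 3) + 3))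
      (\<lambda>R' M'. R' 4 = pos (length cs) \<and> st (len (length cs)) R' M')"
    unfolding table_prog_def
  proof (rule run_Seq[OF 1])
    fix R1 M1 assume s1: "R1 4 = pos 0 \<and> st 0 R1 M1"
      and same1: "\<And>r. r \<notin> writes (Const 4 2 ;; Add 25 12 0 ;; Add 26 13 0 ;; Add 27 14 0) \<Longrightarrow> R1 r = R r"
    have r1: "R1 0 = 0" "R1 2 = 1" "R1 29 = length cs"
      using same1[of 0] same1[of 2] same1[of 29] R by auto
    show "run (For 6 29 7 ?body) R1 M1 (length cs * ((n * (8 * v + 13 + 3) + 5) + 3) + 3)
      (\<lambda>R' M'. R' 4 = pos (length cs) \<and> st (len (length cs)) R' M')"
    proof (rule run_For[where Inv = "\<lambda>j R' M'. R' 4 = pos j \<and> st (len j) R' M'"])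
      fix j R' M' assume j: "j < length cs" and I: "R' 4 = pos j \<and> st (len j) R' M'" and "R' 6 = j"
        and same: "\<And>r. r \<notin> insert 6 (insert 7 (writes ?body)) \<Longrightarrow> R' r = R1 r"
      let ?k = "length (cs ! j)"
      have r': "R' 0 = 0" "R' 2 = 1" using same[of 0] same[of 2] r1 by auto
      have "pos j < z" "i < ?k \<Longrightarrow> pos j + Suc i < z" for i
        using code_nth(3)[OF j, of 0] code_nth(3)[OF j, of "Suc i"] z by (simp_all add: pos_def)
      moreover have "M0 (pos j) = ?k" "i < ?k \<Longrightarrow> M0 (pos j + Suc i) = lit_code (cs ! j ! i)" for i
        using seg_nth[OF code, of "length (code (take j cs))"] code_nth(1)[OF j] code_nth(3)[OF j, of 0]
          seg_nth[OF code, of "length (code (take j cs)) + Suc i"] code_nth(2)[OF j, of i] code_nth(3)[OF j, of "Suc i"]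
        by (simp_all add: pos_def)
      ultimately have low: "M'' (pos j) = ?k" "i < ?k \<Longrightarrow> M'' (pos j + Suc i) = lit_code (cs ! j ! i)"
        if "\<forall>a<z. M'' a = M0 a" for M'' i
        using that by simp_all
      have head: "run (Load 8 4 ;; Add 4 4 2) R' M' 2
          (\<lambda>R'' M''. R'' 8 = ?k \<and> R'' 4 = pos j + 1 \<and> st (len j) R'' M'')"
        using I r' low(1)[of M'] by (intro run_straight) (auto simp: st_def)
      have "run ?body R' M' (n * (8 * v + 13 + 3) + 5) (\<lambda>R'' M''. R'' 4 = pos j + 1 + ?k \<and> st (len j + ?k) R'' M'')"
      proof (rule run_Seq[OF head], elim conjE)
        fix R2 M2 assume s2: "R2 8 = ?k" "R2 4 = pos j + 1" "st (len j) R2 M2"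
          and same2: "\<And>r. r \<notin> writes (Load 8 4 ;; Add 4 4 2) \<Longrightarrow> R2 r = R' r"
        have r2: "R2 0 = 0" "R2 2 = 1" "R2 6 = j"
          using same2[of 0] same2[of 2] same2[of 6] r' \<open>R' 6 = j\<close> by auto
        have "run (For 18 8 19 literal_prog) R2 M2 (?k * (8 * v + 13 + 3) + 3)
          ((\<lambda>i R'' M''. R'' 4 = pos j + 1 + i \<and> st (len j + i) R'' M'') ?k)"
        proof (rule run_For)
          fix i R3 M3 assume i: "i < ?k" and I3: "R3 4 = pos j + 1 + i \<and> st (len j + i) R3 M3"
            and same3: "\<And>r. r \<notin> insert 18 (insert 19 (writes literal_prog)) \<Longrightarrow> R3 r = R2 r"
          have r3: "R3 0 = 0" "R3 2 = 1" "R3 6 = j"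
            using same3[of 0] same3[of 2] same3[of 6] r2 by auto
          let ?l = "cs ! j ! i"
          have l: "M3 (R3 4) = lit_code ?l"
            using low(2)[of M3 i] i I3 by (auto simp: st_def)
          \<comment> \<open>Negating takes time linear in the code, so the number of variables
            enters the running time.\<close>
          have "lit_code ?l < 2 * v"
            by (intro lit_code_less vars[of "cs ! j"] nth_mem i j)
          then have time: "4 * lit_code ?l + 13 \<le> 8 * v + 13" by simp
          note o = occs_nth[OF j i, folded len_def n_def]
          have st3: "R3 25 = z + (len j + i)" "R3 26 = z + n + (len j + i)" "R3 27 = z + 2 * n + (len j + i)"
            "\<forall>a<z. M3 a = M0 a" "\<forall>a\<ge>z + 3 * n. M3 a = 0" and "tables cs z (len j + i) M3"
            using I3 by (simp_all add: st_def)
          then have "tables cs z (Suc (len j + i)) (M3(R3 25 := R3 6, R3 26 := lit_code ?l, R3 27 := lit_code (negate ?l)))"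
            using tables_Suc[of cs z "len j + i" M3 j ?l, folded n_def] o r3(3) by simp
          then have "st (len j + Suc i) R'' M''" if "R'' 25 = R3 25 + 1" "R'' 26 = R3 26 + 1" "R'' 27 = R3 27 + 1"
            "M'' = M3(R3 25 := R3 6, R3 26 := lit_code ?l, R3 27 := lit_code (negate ?l))" for R'' M''
            using o(2) by (simp add: st_def that st3)
          then show "run literal_prog R3 M3 (8 * v + 13)
            (\<lambda>R'' M''. R'' 4 = pos j + 1 + Suc i \<and> st (len j + Suc i) R'' M'')"
            using I3 by (intro run_mono[OF run_literal_prog[where R = R3 and M = M3, OF r3(1,2) l] time]) simp
        qed (use s2 r2 in \<open>auto simp: st_def\<close>)
        \<comment> \<open>The outer loop rule wants one time bound for all clauses, so the clause
          length is replaced by \<open>n\<close>.\<close>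
        moreover have "?k \<le> n"
          using member_le_sum_list[of ?k "map length cs"] j by (simp add: n_def length_concat)
        ultimately show "run (For 18 8 19 literal_prog) R2 M2 (n * (8 * v + 13 + 3) + 3)
          (\<lambda>R'' M''. R'' 4 = pos j + 1 + ?k \<and> st (len j + ?k) R'' M'')"
          by (elim run_mono) (auto intro: mult_right_mono)
      qed simp
      then show "run ?body R' M' (n * (8 * v + 13 + 3) + 5) (\<lambda>R'' M''. R'' 4 = pos (Suc j) \<and> st (len (Suc j)) R'' M'')"
        by (rule run_mono) (auto simp: pos_def len_def length_code take_Suc_conv_app_nth[OF j])
    qed (use r1 s1 in \<open>auto simp: st_def len_def\<close>)
  qed simp
  then show "run ?prog R M0 (length cs * (n * (8 * v + 16) + 8) + 7) ?post"
    by (rule run_mono) (auto simp: st_def len_def n_def algebra_simps)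
qed

section \<open>Conflict tests and the tables of vertices\<close>

lemma lit_code_eq_iff: "lit_code l = lit_code l' \<longleftrightarrow> l = l'"
  by (cases l; cases l') (auto, presburger+)

text \<open>The two truncated differences add up to 0 exactly for equal values, hence the exchanged
  branches of the conditional.\<close>

definition compare_prog :: "nat \<Rightarrow> nat \<Rightarrow> prog \<Rightarrow> prog \<Rightarrow> prog" where
  "compare_prog a b p q = Sub 32 a b ;; Sub 33 b a ;; Add 32 32 33 ;; Cond 32 q p"

definition conflict_prog :: "nat \<Rightarrow> nat \<Rightarrow> prog" where
  "conflict_prog a b = Add 30 12 a ;; Load 30 30 ;; Add 31 12 b ;; Load 31 31 ;;
     compare_prog 30 31 (Const 21 1)
       (Add 30 13 a ;; Load 30 30 ;; Add 31 14 b ;; Load 31 31 ;;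
        compare_prog 30 31 (Const 21 1) (Const 21 0))"

lemma tables_nth:
  assumes "tables cs z (length (concat cs)) M" "u < length (concat cs)"
  shows "M (z + u) = fst (occs cs ! u)"
    and "M (z + length (concat cs) + u) = lit_code (snd (occs cs ! u))"
    and "M (z + 2 * length (concat cs) + u) = lit_code (negate (snd (occs cs ! u)))"
  using assms by (simp_all add: tables_def seg_def length_occs)

lemma run_conflict_prog:
  assumes "tables cs z n M" "n = length (concat cs)" "R 12 = z" "R 13 = z + n" "R 14 = z + 2 * n"
    "R a = u" "R b = w" "u < n" "w < n" "{a, b} \<inter> {30, 31, 32, 33} = {}"
  shows "run (conflict_prog a b) R M 17 (\<lambda>R' M'. M' = M \<and> R' 21 = of_bool (conflict cs u w))"
proof -
  note t = tables_nth[OF assms(1)[unfolded assms(2)], folded assms(2)]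
  obtain cu cw lu lw where v: "cu = fst (occs cs ! u)" "cw = fst (occs cs ! w)"
    "lu = lit_code (snd (occs cs ! u))" "lw = lit_code (negate (snd (occs cs ! w)))" by blast
  have c: "conflict cs u w \<longleftrightarrow> cu = cw \<or> lu = lw"
    unfolding conflict_def v lit_code_eq_iff by simp
  have M: "M (z + u) = cu" "M (z + w) = cw" "M (z + n + u) = lu" "M (z + 2 * n + w) = lw"
    using t assms(8,9) v by simp_all
  have ab: "a \<noteq> 30" "a \<noteq> 31" "a \<noteq> 32" "a \<noteq> 33" "b \<noteq> 30" "b \<noteq> 31" "b \<noteq> 32" "b \<noteq> 33"
    using assms(10) by auto
  have neq: "x - y + (y - x) = (0 :: nat) \<longleftrightarrow> x = y" for x y by auto
  show ?thesis
    unfolding c conflict_prog_def compare_prog_def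
    by (rule run_straight; cases "cu = cw"; cases "lu = lw")
      (simp_all add: assms(3-7) M ab neq del: add_is_0 add_eq_0_iff_both_eq_0)
qed

definition emit_prog :: prog where
  "emit_prog = Store 25 20 ;; Store 26 22 ;; Add 25 25 2 ;; Add 26 26 2"

text \<open>Describes the state while the class table at \<open>x\<close> and the value table at
  \<open>x + m\<close> grow in parallel. Below \<open>x\<close> lie the input and the literal
  tables; the zeros above are kept because the final memory must be an initial one.\<close>

definition emitted :: "nat \<Rightarrow> nat \<Rightarrow> (nat \<Rightarrow> nat) \<Rightarrow> nat list \<Rightarrow> nat list \<Rightarrow>
    (nat \<Rightarrow> nat) \<Rightarrow> (nat \<Rightarrow> nat) \<Rightarrow> bool" where
  "emitted x m M0 cl vl R M \<longleftrightarrow> length cl = length vl \<and> R 25 = x + length cl \<and>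
     R 26 = x + m + length vl \<and> seg M x cl \<and> seg M (x + m) vl \<and>
     (\<forall>a<x. M a = M0 a) \<and> (\<forall>a\<ge>x + 2 * m. M a = 0)"

lemma run_emit_prog:
  assumes "emitted x m M0 cl vl R M" "length cl < m" "R 2 = 1" "R 20 = c" "R 22 = v"
  shows "run emit_prog R M 4 (emitted x m M0 (cl @ [c]) (vl @ [v]))"
  using assms
  by (intro run_straight) (auto simp: emit_prog_def emitted_def intro!: seg_extend[of M])

lemma writes_emit_prog [simp]: "writes emit_prog = {25, 26}"
  by (auto simp: emit_prog_def)

lemma run_row:
  assumes R: "R 0 = 0" "R 2 = 1" "R 3 = n" and e: "emitted x m M0 cl vl R M"
    and len: "length cl + n \<le> m"
  shows "run (Const 20 c ;; For 6 3 7 (Add 22 6 0 ;; emit_prog)) R M (n * 8 + 4)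
    (emitted x m M0 (cl @ replicate n c) (vl @ [0..<n]))"
proof -
  have 1: "run (Const 20 c) R M 1 (\<lambda>R' M'. R' 20 = c \<and> emitted x m M0 cl vl R' M')"
    using e by (intro run_straight) (auto simp: emitted_def)
  show ?thesis
  proof (rule run_Seq[OF 1], elim conjE)
    fix R1 M1 assume s1: "R1 20 = c" "emitted x m M0 cl vl R1 M1"
      "\<And>r. r \<notin> writes (Const 20 c) \<Longrightarrow> R1 r = R r"
    have r1: "R1 0 = 0" "R1 2 = 1" "R1 3 = n"
      using s1(3)[of 0] s1(3)[of 2] s1(3)[of 3] R by auto
    have "run (For 6 3 7 (Add 22 6 0 ;; emit_prog)) R1 M1 (n * (5 + 3) + 3)
      (emitted x m M0 (cl @ replicate n c) (vl @ [0..<n]))"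
    proof (rule run_For[where Inv = "\<lambda>j. emitted x m M0 (cl @ replicate j c) (vl @ [0..<j])"])
      fix j R' M' assume j: "j < n" and I: "emitted x m M0 (cl @ replicate j c) (vl @ [0..<j]) R' M'"
        and r6: "R' 6 = j"
        and same: "\<And>r. r \<notin> insert 6 (insert 7 (writes (Add 22 6 0 ;; emit_prog))) \<Longrightarrow> R' r = R1 r"
      have r': "R' 0 = 0" "R' 2 = 1" "R' 20 = c"
        using same[of 0] same[of 2] same[of 20] r1 s1 by auto
      have 2: "run (Add 22 6 0) R' M' 1 (\<lambda>R'' M''. R'' = R'(22 := j) \<and> M'' = M')"
        using r' r6 by (intro run_straight) auto
      show "run (Add 22 6 0 ;; emit_prog) R' M' 5
        (emitted x m M0 (cl @ replicate (Suc j) c) (vl @ [0..<Suc j]))"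
      proof (rule run_Seq[OF 2], elim conjE)
        fix R2 M2 assume "R2 = R'(22 := j)" "M2 = M'"
        then show "run emit_prog R2 M2 4 (emitted x m M0 (cl @ replicate (Suc j) c) (vl @ [0..<Suc j]))"
          using run_emit_prog[of x m M0 "cl @ replicate j c" "vl @ [0..<j]" R2 M2 c j] I r' j len
          by (simp add: emitted_def replicate_append_same)
      qed simp
    qed (use s1 r1 in \<open>auto simp: emitted_def\<close>)
    then show "run (For 6 3 7 (Add 22 6 0 ;; emit_prog)) R1 M1 (n * 8 + 3)
      (emitted x m M0 (cl @ replicate n c) (vl @ [0..<n]))" by simp
  qed simp
qed

\<comment> \<open>Serves both halves of \<open>K\<close>, whose vertices are indexed by pairs. The
  body leaves the value in register 22 and may add to the counter in register 24.\<close>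
schematic_goal run_grid:
  fixes g h :: "nat \<Rightarrow> nat \<Rightarrow> nat"
  assumes wr: "writes p \<subseteq> {21, 22, 23, 24, 30, 31, 32, 33}"
    and body: "\<And>j i R' M'. j < n \<Longrightarrow> i < n \<Longrightarrow> R' 6 = j \<Longrightarrow> R' 18 = i \<Longrightarrow>
      (\<And>r. r \<in> {0, 2, 3, 12, 13, 14} \<Longrightarrow> R' r = R r) \<Longrightarrow> (\<forall>a<x. M' a = M0 a) \<Longrightarrow>
      run p R' M' b (\<lambda>R'' M''. M'' = M' \<and> R'' 22 = g j i \<and> R'' 24 = R' 24 + h j i)"
    and R: "R 2 = 1" "R 3 = n" "R 20 = c" "R 24 = 0" and e: "emitted x m M0 cl vl R M"
    and len: "length cl + n * n \<le> m"
  shows "run (For 6 3 7 (For 18 3 19 (p ;; emit_prog))) R M ?t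
    (\<lambda>R' M'. emitted x m M0 (cl @ replicate (n * n) c)
       (vl @ concat (map (\<lambda>j. map (g j) [0..<n]) [0..<n])) R' M' \<and> R' 24 = (\<Sum>j<n. \<Sum>i<n. h j i))" (is "run ?prog _ _ _ ?post")
proof -
  have nw: "0 \<notin> writes p" "2 \<notin> writes p" "3 \<notin> writes p" "6 \<notin> writes p" "12 \<notin> writes p" "13 \<notin> writes p"
    "14 \<notin> writes p" "18 \<notin> writes p" "20 \<notin> writes p" "25 \<notin> writes p" "26 \<notin> writes p"
    using wr by auto
  let ?row = "\<lambda>j. map (g j) [0..<n]"
  let ?I = "\<lambda>j i R' M'. emitted x m M0 (cl @ replicate (j * n + i) c)
       (vl @ concat (map ?row [0..<j]) @ map (g j) [0..<i]) R' M' \<and>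
     R' 24 = (\<Sum>j'<j. \<Sum>i'<n. h j' i') + (\<Sum>i'<i. h j i')"
  have lenc: "length (concat (map ?row [0..<j])) = j * n" for j
    by (induction j) auto
  have "run (For 6 3 7 (For 18 3 19 (p ;; emit_prog))) R M (n * ((n * (b + 4 + 3) + 3) + 3) + 3)
    (?I n 0)"
  proof (rule run_For[where Inv = "\<lambda>j. ?I j 0"])
    fix j R' M' assume j: "j < n" and I: "?I j 0 R' M'" and r6: "R' 6 = j"
      and same: "\<And>r. r \<notin> insert 6 (insert 7 (writes (For 18 3 19 (p ;; emit_prog)))) \<Longrightarrow> R' r = R r"
    have r': "R' r = R r" if "r \<in> {0, 2, 3, 12, 13, 14, 20}" for r
      using that same[of r] nw by auto
    have "run (For 18 3 19 (p ;; emit_prog)) R' M' (n * (b + 4 + 3) + 3) (?I j n)"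
    proof (rule run_For[where Inv = "?I j"])
      fix i R1 M1 assume i: "i < n" and I1: "?I j i R1 M1" and r18: "R1 18 = i"
        and same1: "\<And>r. r \<notin> insert 18 (insert 19 (writes (p ;; emit_prog))) \<Longrightarrow> R1 r = R' r"
      have r1: "R1 r = R r" if "r \<in> {0, 2, 3, 12, 13, 14, 20}" for r
        using that same1[of r] r'[of r] nw by auto
      have "R1 6 = j" using same1[of 6] nw r6 by auto
      then have b: "run p R1 M1 b (\<lambda>R'' M''. M'' = M1 \<and> R'' 22 = g j i \<and> R'' 24 = R1 24 + h j i)"
        using I1 by (intro body[where R' = R1 and j = j and i = i] j i r18 r1) (auto simp: emitted_def)
      show "run (p ;; emit_prog) R1 M1 (b + 4) (?I j (Suc i))"
      proof (rule run_Seq[OF b], elim conjE)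
        fix R2 M2 assume s2: "M2 = M1" "R2 22 = g j i" "R2 24 = R1 24 + h j i"
          "\<And>r. r \<notin> writes p \<Longrightarrow> R2 r = R1 r"
        have r2: "R2 2 = 1" "R2 20 = c" "R2 25 = R1 25" "R2 26 = R1 26"
          using s2(4) nw r1[of 2] r1[of 20] R by auto
        have "j * n + i < n * n"
        proof -
          have "j * n + i < Suc j * n" using i by simp
          also have "\<dots> \<le> n * n" using j by (intro mult_right_mono) auto
          finally show ?thesis .
        qed
        then have "length (cl @ replicate (j * n + i) c) < m" using len by simp
        moreover have "emitted x m M0 (cl @ replicate (j * n + i) c)
           (vl @ concat (map ?row [0..<j]) @ map (g j) [0..<i]) R2 M2"
          using I1 s2(1) r2(3,4) by (simp add: emitted_def)
        ultimately have "run emit_prog R2 M2 4 (emitted x m M0 ((cl @ replicate (j * n + i) c) @ [c])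
           ((vl @ concat (map ?row [0..<j]) @ map (g j) [0..<i]) @ [g j i]))"
          using r2(1,2) s2(2) by (intro run_emit_prog)
        then show "run emit_prog R2 M2 4 (?I j (Suc i))"
          by (rule run_mono) (use I1 s2(3) nw in \<open>simp_all add: replicate_append_same\<close>)
      qed simp
    next
      show "?I j 0 R' M'" by (rule I)
    qed (use r'[of 2] r'[of 3] R nw in \<open>simp_all add: emitted_def\<close>)
    then show "run (For 18 3 19 (p ;; emit_prog)) R' M' (n * (b + 4 + 3) + 3) (?I (Suc j) 0)"
      by (rule run_mono) (auto simp: add.commute)
  next
    show "?I 0 0 R M" using e R by simp
  qed (use R nw in \<open>simp_all add: emitted_def\<close>)
  then show "run ?prog R M (n * (n * (b + 7) + 6) + 3) ?post"
    by (rule run_mono) (simp_all add: algebra_simps)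
qed

text \<open>Follows the blocks of \<open>cls_list\<close> and \<open>val_list\<close>. The last
  block visits every pair of occurrences and at the same time counts the conflicts with
  \<open>j < i\<close>, which yields \<open>edge_count\<close>.\<close>

definition vertex_prog :: prog where
  "vertex_prog = (Add 25 15 0 ;; Add 26 16 0) ;;
     (Const 20 0 ;; For 6 3 7 (Add 22 6 0 ;; emit_prog)) ;;
     (Const 20 1 ;; For 6 3 7 (Add 22 6 0 ;; emit_prog)) ;;
     (Const 20 3 ;; For 6 3 7 (Add 22 6 0 ;; emit_prog)) ;;
     (Const 20 9 ;; For 6 3 7 (For 18 3 19 (Add 22 6 0 ;; emit_prog))) ;;
     For 6 3 7 (For 18 3 19 ((conflict_prog 6 18 ;;
       Cond 21 (Add 22 6 0 ;; Sub 23 18 6 ;; Cond 23 (Add 24 24 2) (Const 23 0)) (Add 22 3 0)) ;; emit_prog))"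

schematic_goal run_vertex_prog:
  fixes cs :: "literal list list" and x z :: nat
  defines "n \<equiv> length (concat cs)"
  defines "m \<equiv> 3 * n + (n * n + n * n)"
  assumes R: "R 0 = 0" "R 2 = 1" "R 3 = n" "R 12 = z" "R 13 = z + n" "R 14 = z + 2 * n" "R 15 = x"
      "R 16 = x + m" "R 24 = 0"
    and x: "x = z + 3 * n"
    and t: "tables cs z n M" and zero: "\<forall>a\<ge>x. M a = 0"
  shows "run vertex_prog R M ?t (\<lambda>R' M'.
    emitted x m M (cls_list n) (val_list n (conflict cs)) R' M' \<and>
    R' 24 = (\<Sum>j<n. \<Sum>i<n. of_bool (j < i \<and> conflict cs j i)))" (is "run _ _ _ _ ?Q")
proof -
  let ?c = "conflict cs"
  define P where "P cl vl R' M' \<longleftrightarrow> emitted x m M cl vl R' M' \<and>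
    (\<forall>r\<in>{0, 2, 3, 12, 13, 14, 24}. R' r = R r)" for cl vl R' M'
  let ?p0 = "Add 25 15 0 ;; Add 26 16 0"
  let ?row = "\<lambda>c. Const 20 c ;; For 6 3 7 (Add 22 6 0 ;; emit_prog)"
  let ?val = "conflict_prog 6 18 ;; Cond 21 (Add 22 6 0 ;; Sub 23 18 6 ;; Cond 23 (Add 24 24 2) (Const 23 0)) (Add 22 3 0)"
  let ?p4 = "Const 20 9 ;; For 6 3 7 (For 18 3 19 (Add 22 6 0 ;; emit_prog))"
  let ?p5 = "For 6 3 7 (For 18 3 19 (?val ;; emit_prog))"
  let ?u = "[0..<n]"
  have 0: "run ?p0 R M 2 (P [] [])"
    using R zero by (intro run_straight) (auto simp: P_def emitted_def)
  have row: "run (?row c) R' M' (n * 8 + 4) (P (cl @ replicate n c) (vl @ ?u))"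
    if "P cl vl R' M'" "length cl + n \<le> m" for c cl vl R' M'
  proof -
    have "R' 0 = 0" "R' 2 = 1" "R' 3 = n" "emitted x m M cl vl R' M'"
      using that R by (simp_all add: P_def)
    then have "run (?row c) R' M' (n * 8 + 4) (emitted x m M (cl @ replicate n c) (vl @ ?u))"
      using that(2) by (intro run_row)
    then show ?thesis
      by (rule run_mono) (use that in \<open>auto simp: P_def\<close>)
  qed
  have 4: "run ?p4 R' M' (n * (n * 8 + 6) + 4) (\<lambda>R' M'.
      P (cl @ replicate (n * n) 9) (vl @ concat (map (\<lambda>u. replicate n u) ?u)) R' M' \<and> R' 20 = 9)"
    if p: "P cl vl R' M'" and len: "length cl + n * n \<le> m" for cl vl R' M'
  proof -
    have 41: "run (Const 20 9) R' M' 1 (\<lambda>R' M'. P cl vl R' M' \<and> R' 20 = 9)"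
      using p by (intro run_straight) (auto simp: P_def emitted_def)
    show ?thesis
    proof (rule run_Seq[OF 41], elim conjE)
      fix R1 M1 assume p1: "P cl vl R1 M1" "R1 20 = 9"
      have "run (For 6 3 7 (For 18 3 19 (Add 22 6 0 ;; emit_prog))) R1 M1 (n * (n * (1 + 7) + 6) + 3)
         (\<lambda>R' M'. emitted x m M (cl @ replicate (n * n) 9) (vl @ concat (map (\<lambda>j. map (\<lambda>i. j) ?u) ?u)) R' M' \<and>
           R' 24 = (\<Sum>j<n. \<Sum>i<n. 0))"
      proof (rule run_grid)
        fix j i R2 M2 assume "R2 6 = j" and same: "\<And>r. r \<in> {0, 2, 3, 12, 13, 14} \<Longrightarrow> R2 r = R1 r"
        moreover have "R1 0 = 0" using p1 R by (simp add: P_def)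
        ultimately show "run (Add 22 6 0) R2 M2 1 (\<lambda>R'' M''. M'' = M2 \<and> R'' 22 = j \<and> R'' 24 = R2 24 + 0)"
          using same[of 0] by (intro run_straight) auto
      qed (use p1 R len in \<open>simp_all add: P_def\<close>)
      then show "run (For 6 3 7 (For 18 3 19 (Add 22 6 0 ;; emit_prog))) R1 M1 (n * (n * 8 + 6) + 3)
         (\<lambda>R' M'. P (cl @ replicate (n * n) 9) (vl @ concat (map (\<lambda>u. replicate n u) ?u)) R' M' \<and> R' 20 = 9)"
        by (rule run_mono) (use p1 R in \<open>auto simp: P_def map_replicate_const\<close>)
    qed simp
  qed
  have 5: "run ?p5 R' M' (n * (n * 29 + 6) + 3) (\<lambda>R' M'.
      emitted x m M (cl @ replicate (n * n) 9) (vl @ concat (map (\<lambda>u. map (\<lambda>t. if ?c u t then u else n) ?u) ?u)) R' M' \<and>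
      R' 24 = (\<Sum>j<n. \<Sum>i<n. of_bool (j < i \<and> ?c j i)))"
    if p: "P cl vl R' M'" "R' 20 = 9" and len: "length cl + n * n \<le> m" for cl vl R' M'
  proof -
    have "run ?p5 R' M' (n * (n * (22 + 7) + 6) + 3) (\<lambda>R' M'.
      emitted x m M (cl @ replicate (n * n) 9) (vl @ concat (map (\<lambda>u. map (\<lambda>t. if ?c u t then u else n) ?u) ?u)) R' M' \<and>
      R' 24 = (\<Sum>j<n. \<Sum>i<n. of_bool (j < i \<and> ?c j i)))"
    proof (rule run_grid)
      show "writes ?val \<subseteq> {21, 22, 23, 24, 30, 31, 32, 33}"
        by (auto simp: conflict_prog_def compare_prog_def)
    next
      fix j i R2 M2 assume ji: "j < n" "i < n" "R2 6 = j" "R2 18 = i"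
        and same: "\<And>r. r \<in> {0, 2, 3, 12, 13, 14} \<Longrightarrow> R2 r = R' r" and low: "\<forall>a<x. M2 a = M a"
      have r2: "R2 r = R r" if "r \<in> {0, 2, 3, 12, 13, 14}" for r
        using same[OF that] p(1) that by (auto simp: P_def)
      have t2: "tables cs z n M2"
        using t by (rule tables_cong) (use low x in \<open>auto simp: n_def\<close>)
      have b: "run (conflict_prog 6 18) R2 M2 17 (\<lambda>R' M'. M' = M2 \<and> R' 21 = of_bool (?c j i))"
        using ji r2[of 12] r2[of 13] r2[of 14] R by (intro run_conflict_prog[OF t2]) (simp_all add: n_def)
      show "run ?val R2 M2 22 (\<lambda>R'' M''. M'' = M2 \<and> R'' 22 = (if ?c j i then j else n) \<and>
          R'' 24 = R2 24 + of_bool (j < i \<and> ?c j i))"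
      proof (rule run_Seq[OF b], elim conjE)
        fix R3 M3 assume s3: "M3 = M2" "R3 21 = of_bool (?c j i)"
          "\<And>r. r \<notin> writes (conflict_prog 6 18) \<Longrightarrow> R3 r = R2 r"
        have "R3 r = R2 r" if "r \<in> {0, 2, 3, 6, 18, 24}" for r
          using s3(3)[of r] that by (auto simp: conflict_prog_def compare_prog_def)
        then have "R3 0 = 0" "R3 2 = 1" "R3 3 = n" "R3 6 = j" "R3 18 = i" "R3 24 = R2 24"
          using r2[of 0] r2[of 2] r2[of 3] R ji by simp_all
        then show "run (Cond 21 (Add 22 6 0 ;; Sub 23 18 6 ;; Cond 23 (Add 24 24 2) (Const 23 0)) (Add 22 3 0)) R3 M3 5
          (\<lambda>R'' M''. M'' = M2 \<and> R'' 22 = (if ?c j i then j else n) \<and> R'' 24 = R2 24 + of_bool (j < i \<and> ?c j i))"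
          using s3(1,2) by (intro run_straight) auto
      qed simp
    qed (use p R len in \<open>simp_all add: P_def\<close>)
    then show ?thesis by simp
  qed
  let ?t5 = "n * (n * 29 + 6) + 3"
  let ?t4 = "n * (n * 8 + 6) + 4 + ?t5"
  let ?t3 = "n * 8 + 4 + ?t4"
  let ?t2 = "n * 8 + 4 + ?t3"
  let ?t1 = "n * 8 + 4 + ?t2"
  have "run vertex_prog R M (2 + ?t1) ?Q"
    unfolding vertex_prog_def
  proof (rule run_Seq[OF 0])
    fix R1 M1 assume "P [] [] R1 M1"
    then have 1: "run (?row 0) R1 M1 (n * 8 + 4) (P ([] @ replicate n 0) ([] @ ?u))"
      by (rule row) (simp add: m_def)
    show "run (?row 0 ;; ?row 1 ;; ?row 3 ;; ?p4 ;; ?p5) R1 M1 ?t1 ?Q"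
    proof (rule run_Seq[OF 1])
      fix R2 M2 assume "P ([] @ replicate n 0) ([] @ ?u) R2 M2"
      then have 2: "run (?row 1) R2 M2 (n * 8 + 4)
          (P (([] @ replicate n 0) @ replicate n 1) (([] @ ?u) @ ?u))"
        by (rule row) (simp add: m_def)
      show "run (?row 1 ;; ?row 3 ;; ?p4 ;; ?p5) R2 M2 ?t2 ?Q"
      proof (rule run_Seq[OF 2])
        fix R3 M3 assume "P (([] @ replicate n 0) @ replicate n 1) (([] @ ?u) @ ?u) R3 M3"
        then have 3: "run (?row 3) R3 M3 (n * 8 + 4)
            (P ((([] @ replicate n 0) @ replicate n 1) @ replicate n 3) ((([] @ ?u) @ ?u) @ ?u))"
          by (rule row) (simp add: m_def)
        show "run (?row 3 ;; ?p4 ;; ?p5) R3 M3 ?t3 ?Q"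
        proof (rule run_Seq[OF 3])
          fix R4 M4
          assume "P ((([] @ replicate n 0) @ replicate n 1) @ replicate n 3) ((([] @ ?u) @ ?u) @ ?u) R4 M4"
          then have 4: "run ?p4 R4 M4 (n * (n * 8 + 6) + 4) (\<lambda>R' M'.
              P (((([] @ replicate n 0) @ replicate n 1) @ replicate n 3) @ replicate (n * n) 9)
                (((([] @ ?u) @ ?u) @ ?u) @ concat (map (\<lambda>u. replicate n u) ?u)) R' M' \<and> R' 20 = 9)"
            by (rule 4) (simp add: m_def)
          show "run (?p4 ;; ?p5) R4 M4 ?t4 ?Q"
          proof (rule run_Seq[OF 4], elim conjE)
            fix R5 M5 assume "P (((([] @ replicate n 0) @ replicate n 1) @ replicate n 3) @ replicate (n * n) 9)
                (((([] @ ?u) @ ?u) @ ?u) @ concat (map (\<lambda>u. replicate n u) ?u)) R5 M5" "R5 20 = 9"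
            then have "run ?p5 R5 M5 ?t5 (\<lambda>R' M'. emitted x m M
                ((((([] @ replicate n 0) @ replicate n 1) @ replicate n 3) @ replicate (n * n) 9) @ replicate (n * n) 9)
                ((((([] @ ?u) @ ?u) @ ?u) @ concat (map (\<lambda>u. replicate n u) ?u)) @
                  concat (map (\<lambda>u. map (\<lambda>t. if ?c u t then u else n) ?u) ?u)) R' M' \<and>
                R' 24 = (\<Sum>j<n. \<Sum>i<n. of_bool (j < i \<and> ?c j i)))"
              by (intro 5) (auto simp: m_def)
            then show "run ?p5 R5 M5 ?t5 ?Q"
              by (rule run_mono) (auto simp: cls_list_def val_list_def replicate_add)
          qed simp
        qed simp
      qed simp
    qed simp
  qed simp
  then show "run vertex_prog R M (n * (n * 37) + n * 36 + 30) ?Q"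
    by (rule run_mono) (auto simp: algebra_simps)
qed

section \<open>The adjacency matrix\<close>

text \<open>Allows nested comparisons to be verified one branch at a time, with only the scratch
  registers 32 and 33 changed.\<close>

lemma run_compare_prog:
  assumes "a \<notin> {32, 33}" "b \<notin> {32, 33}"
    and "\<And>R'. R a = R b \<Longrightarrow> (\<And>r. r \<notin> {32, 33} \<Longrightarrow> R' r = R r) \<Longrightarrow> run p R' M c Q"
    and "\<And>R'. R a \<noteq> R b \<Longrightarrow> (\<And>r. r \<notin> {32, 33} \<Longrightarrow> R' r = R r) \<Longrightarrow> run q R' M c Q"
  shows "run (compare_prog a b p q) R M (c + 4) Q"
proof -
  let ?R = "R(32 := R a - R b + (R b - R a), 33 := R b - R a)"
  have 1: "exec (Sub 32 a b) (R, M) 1 (R(32 := R a - R b), M)"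
    by (rule exec.Sub)
  have 2: "exec (Sub 33 b a) (R(32 := R a - R b), M) 1 (R(32 := R a - R b, 33 := R b - R a), M)"
    using exec.Sub[of 33 b a "R(32 := R a - R b)" M] assms(1,2) by simp
  have 3: "exec (Add 32 32 33) (R(32 := R a - R b, 33 := R b - R a), M) 1 (?R, M)"
    using exec.Add[of 32 32 33 "R(32 := R a - R b, 33 := R b - R a)" M] by (simp add: fun_upd_twist)
  have "run (if R a = R b then p else q) ?R M c Q"
    using assms(3)[of ?R] assms(4)[of ?R] by auto
  then obtain t R' M' where e: "exec (if R a = R b then p else q) (?R, M) t (R', M')" "t \<le> c" "Q R' M'"
    unfolding run_def by blast
  have "exec (Cond 32 q p) (?R, M) (Suc t) (R', M')"
  proof (cases "R a = R b")
    case True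
    then show ?thesis using e(1) by (intro exec.CondFalse) auto
  next
    case False
    then have "R a - R b + (R b - R a) \<noteq> 0" by linarith
    then show ?thesis using e(1) False by (intro exec.CondTrue) auto
  qed
  from exec.Seq[OF 1 exec.Seq[OF 2 exec.Seq[OF 3 this]]]
  show ?thesis
    unfolding compare_prog_def using e(2,3) by (intro runI) auto
qed

definition bit_prog :: prog where
  "bit_prog = compare_prog 6 18 (Const 21 0) (
     (Add 34 15 6 ;; Load 34 34 ;; Add 35 15 18 ;; Load 35 35 ;; Add 34 34 35 ;;
      Add 35 16 6 ;; Load 35 35 ;; Add 36 16 18 ;; Load 36 36 ;;
      Const 37 3 ;; Const 38 2 ;; Const 39 4 ;; Const 40 10) ;;
     compare_prog 34 37 (Const 21 0) (
     compare_prog 34 38 (conflict_prog 35 36) (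
     compare_prog 34 39 (compare_prog 35 36 (Const 21 1) (Const 21 0)) (
     compare_prog 34 40 (compare_prog 35 36 (Const 21 0) (Const 21 1)) (Const 21 1)))))"

lemma nth_cls_list:
  "a < 3 * n + (n * n + n * n) \<Longrightarrow> cls_list n ! a = gadget.cls n a"
  by (auto simp: cls_list_def nth_append gadget.cls_def[OF gadget_val_list[of "\<lambda>_ _. True"]])

schematic_goal run_bit_prog:
  fixes cs :: "literal list list" and z :: nat
  defines "n \<equiv> length (concat cs)"
  defines "m \<equiv> 3 * n + (n * n + n * n)"
  defines "x \<equiv> z + 3 * n"
  assumes R: "R 12 = z" "R 13 = z + n" "R 14 = z + 2 * n" "R 15 = x" "R 16 = x + m" "R 6 = a" "R 18 = b"
    and t: "tables cs z n M" "seg M x (cls_list n)" "seg M (x + m) (val_list n (conflict cs))"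
    and ab: "a < m" "b < m"
  shows "run bit_prog R M ?t (\<lambda>R' M'. M' = M \<and>
    R' 21 = of_bool (gadget.adj n (conflict cs) ((!) (val_list n (conflict cs))) a b))" (is "run _ _ _ _ ?post")
proof -
  let ?val = "(!) (val_list n (conflict cs))"
  interpret gadget n m "conflict cs" ?val
    unfolding m_def by (intro gadget_val_list conflict_sym) (simp add: conflict_def)
  let ?s = "cls a + cls b"
  let ?Q = "\<lambda>R' M'. M' = M \<and> R' 21 = of_bool (adj a b)"
  have no: "run (Const 21 0) R' M c ?Q" if "\<not> adj a b" "1 \<le> c" for c R'
    using that by (intro run_straight) auto
  have yes: "run (Const 21 1) R' M c ?Q" if "adj a b" "1 \<le> c" for c R'
    using that by (intro run_straight) auto
  let ?load = "Add 34 15 6 ;; Load 34 34 ;; Add 35 15 18 ;; Load 35 35 ;; Add 34 34 35 ;;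
      Add 35 16 6 ;; Load 35 35 ;; Add 36 16 18 ;; Load 36 36 ;;
      Const 37 3 ;; Const 38 2 ;; Const 39 4 ;; Const 40 10"
  have M: "M (x + a) = cls a" "M (x + b) = cls b" "M (x + m + a) = ?val a" "M (x + m + b) = ?val b"
    using t(2,3) ab seg_nth[of M x "cls_list n"] seg_nth[of M "x + m" "val_list n (conflict cs)"]
    by (simp_all add: nth_cls_list m_def length_val_list length_cls_list)
  have adj: "adj a b \<longleftrightarrow> a \<noteq> b \<and> (if ?s = 3 then False else if ?s = 2 then conflict cs (?val a) (?val b)
     else if ?s = 4 then ?val a = ?val b else if ?s = 10 then ?val a \<noteq> ?val b else True)"
    by (simp add: adj_def Let_def)
  define P where "P R' \<longleftrightarrow> R' 12 = z \<and> R' 13 = z + n \<and> R' 14 = z + 2 * n \<and> R' 34 = ?s \<and> R' 35 = ?val a \<and>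
    R' 36 = ?val b \<and> R' 37 = 3 \<and> R' 38 = 2 \<and> R' 39 = 4 \<and> R' 40 = 10" for R' :: "nat \<Rightarrow> nat"
  have P: "P R''" if "P R'" "\<And>r. r \<notin> {32, 33} \<Longrightarrow> R'' r = R' r" for R' R''
    using that by (simp add: P_def)
  let ?p5 = "compare_prog 35 36 (Const 21 0) (Const 21 1)"
  let ?p4 = "compare_prog 34 40 ?p5 (Const 21 1)"
  let ?p3 = "compare_prog 34 39 (compare_prog 35 36 (Const 21 1) (Const 21 0)) ?p4"
  let ?p2 = "compare_prog 34 38 (conflict_prog 35 36) ?p3"
  show "run bit_prog R M 50 ?post"
    unfolding bit_prog_def
  proof (rule run_mono[OF run_compare_prog[where c = 46 and Q = ?Q]])
    show "run (Const 21 0) R' M 46 ?Q" if "R 6 = R 18" for R'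
      using that R adj by (intro no) auto
  next
    fix R1 assume ne: "R 6 \<noteq> R 18" and same: "\<And>r. r \<notin> {32, 33} \<Longrightarrow> R1 r = R r"
    have 1: "run ?load R1 M 13 (\<lambda>R' M'. M' = M \<and> P R')"
      using R M same by (intro run_straight) (simp_all add: P_def)
    show "run (?load ;; compare_prog 34 37 (Const 21 0) ?p2) R1 M 46 ?Q"
    proof (rule run_Seq[OF 1], elim conjE)
      fix R2 M2 assume "M2 = M" and P2: "P R2"
      \<comment> \<open>Class sum 2 means two \<open>A\<close> vertices. Their values are occurrence
        numbers, hence legal indices into the literal tables.\<close>
      have val: "?val a < n" "?val b < n" if "?s = 2"
      proof -
        have "n \<le> c \<and> c < 2 * n \<Longrightarrow> ?val c < n" for c
          using val_A[of "c - n"] by auto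
        moreover have "n \<le> a \<and> a < 2 * n" "n \<le> b \<and> b < 2 * n"
          using that by (auto simp: cls_def split: if_splits)
        ultimately show "?val a < n" "?val b < n" by blast+
      qed
      have eq: "run (compare_prog 35 36 (Const 21 1) (Const 21 0)) R' M 5 ?Q" if "P R'" "?s = 4" for R'
      proof (rule run_mono[OF run_compare_prog[where c = 1 and Q = ?Q]])
        show "run (Const 21 1) R'' M 1 ?Q" if "R' 35 = R' 36" for R''
          using that \<open>P R'\<close> \<open>?s = 4\<close> ne R adj by (intro yes) (auto simp: P_def)
        show "run (Const 21 0) R'' M 1 ?Q" if "R' 35 \<noteq> R' 36" for R''
          using that \<open>P R'\<close> \<open>?s = 4\<close> ne R adj by (intro no) (auto simp: P_def)
      qed auto
      have neq: "run ?p5 R' M 5 ?Q" if "P R'" "?s = 10" for R'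
      proof (rule run_mono[OF run_compare_prog[where c = 1 and Q = ?Q]])
        show "run (Const 21 0) R'' M 1 ?Q" if "R' 35 = R' 36" for R''
          using that \<open>P R'\<close> \<open>?s = 10\<close> ne R adj by (intro no) (auto simp: P_def)
        show "run (Const 21 1) R'' M 1 ?Q" if "R' 35 \<noteq> R' 36" for R''
          using that \<open>P R'\<close> \<open>?s = 10\<close> ne R adj by (intro yes) (auto simp: P_def)
      qed auto
      have 4: "run ?p4 R' M 9 ?Q" if "P R'" "?s \<notin> {2, 3, 4}" for R'
      proof (rule run_mono[OF run_compare_prog[where c = 5 and Q = ?Q]])
        fix R'' assume e: "R' 34 = R' 40" and same: "\<And>r. r \<notin> {32, 33} \<Longrightarrow> R'' r = R' r"
        show "run ?p5 R'' M 5 ?Q"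
          by (rule neq[OF P[OF that(1) same]]) (use e that(1) in \<open>auto simp: P_def\<close>)
      next
        fix R'' assume "R' 34 \<noteq> R' 40"
        then have s: "?s \<noteq> 10" using that(1) by (simp add: P_def)
        have "a \<noteq> b" using ne R by simp
        then have "adj a b" using that(2) s by (simp add: adj)
        then show "run (Const 21 1) R'' M 5 ?Q"
          by (rule yes) simp
      qed auto
      have 3: "run ?p3 R' M 13 ?Q" if "P R'" "?s \<notin> {2, 3}" for R'
      proof (rule run_mono[OF run_compare_prog[where c = 9 and Q = ?Q]])
        fix R'' assume e: "R' 34 = R' 39" and same: "\<And>r. r \<notin> {32, 33} \<Longrightarrow> R'' r = R' r"
        show "run (compare_prog 35 36 (Const 21 1) (Const 21 0)) R'' M 9 ?Q"
          by (rule run_mono[OF eq[OF P[OF that(1) same]]]) (use e that(1) in \<open>auto simp: P_def\<close>)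
      next
        fix R'' assume e: "R' 34 \<noteq> R' 39" and same: "\<And>r. r \<notin> {32, 33} \<Longrightarrow> R'' r = R' r"
        show "run ?p4 R'' M 9 ?Q"
          by (rule 4[OF P[OF that(1) same]]) (use e that in \<open>auto simp: P_def\<close>)
      qed auto
      have 2: "run ?p2 R' M 21 ?Q" if "P R'" "?s \<noteq> 3" for R'
      proof (rule run_mono[OF run_compare_prog[where c = 17 and Q = ?Q]])
        fix R'' assume e: "R' 34 = R' 38" and same: "\<And>r. r \<notin> {32, 33} \<Longrightarrow> R'' r = R' r"
        have s: "?s = 2" using e that(1) by (simp add: P_def)
        have P'': "P R''" by (rule P[OF that(1) same])
        have "run (conflict_prog 35 36) R'' M 17 (\<lambda>R' M'. M' = M \<and> R' 21 = of_bool (conflict cs (?val a) (?val b)))"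
          using P'' val[OF s] t(1) by (intro run_conflict_prog) (auto simp: P_def n_def)
        then show "run (conflict_prog 35 36) R'' M 17 ?Q"
          by (rule run_mono) (use adj ne R s in auto)
      next
        fix R'' assume e: "R' 34 \<noteq> R' 38" and same: "\<And>r. r \<notin> {32, 33} \<Longrightarrow> R'' r = R' r"
        show "run ?p3 R'' M 17 ?Q"
          by (rule run_mono[OF 3[OF P[OF that(1) same]]]) (use e that in \<open>auto simp: P_def\<close>)
      qed auto
      show "run (compare_prog 34 37 (Const 21 0) ?p2) R2 M2 33 ?Q"
        unfolding \<open>M2 = M\<close>
      proof (rule run_mono[OF run_compare_prog[where c = 21 and Q = ?Q]])
        fix R'' assume "R2 34 = R2 37"
        then show "run (Const 21 0) R'' M 21 ?Q"
          using P2 adj by (intro no) (auto simp: P_def)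
      next
        fix R'' assume e: "R2 34 \<noteq> R2 37" and same: "\<And>r. r \<notin> {32, 33} \<Longrightarrow> R'' r = R2 r"
        show "run ?p2 R'' M 21 ?Q"
          by (rule 2[OF P[OF P2 same]]) (use e P2 in \<open>auto simp: P_def\<close>)
      qed auto
    qed simp
  qed auto
qed

text \<open>The matrix overwrites the formula, whose literals are kept in the tables, and leaves the
  first two cells to the header.\<close>

definition matrix_prog :: prog where
  "matrix_prog = Const 25 2 ;; For 6 10 7 (For 18 10 19 (bit_prog ;; Store 25 21 ;; Add 25 25 2))"

schematic_goal run_matrix_prog:
  fixes cs :: "literal list list" and z :: nat
  defines "n \<equiv> length (concat cs)"
  defines "m \<equiv> 3 * n + (n * n + n * n)"
  defines "x \<equiv> z + 3 * n"
  assumes R: "R 2 = 1" "R 10 = m" "R 12 = z" "R 13 = z + n" "R 14 = z + 2 * n" "R 15 = x" "R 16 = x + m"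
    and t: "tables cs z n M" "seg M x (cls_list n)" "seg M (x + m) (val_list n (conflict cs))"
    and z: "2 + m * m \<le> z"
  shows "run matrix_prog R M ?t (\<lambda>R' M'.
    seg M' 2 (concat (map (\<lambda>a. map (\<lambda>b. of_bool
      (gadget.adj n (conflict cs) ((!) (val_list n (conflict cs))) a b)) [0..<m]) [0..<m])) \<and>
    (\<forall>a\<ge>z. M' a = M a))" (is "run ?prog _ _ _ ?post")
proof -
  define h :: "nat \<Rightarrow> nat \<Rightarrow> nat" where
    "h a b = of_bool (gadget.adj n (conflict cs) ((!) (val_list n (conflict cs))) a b)" for a b
  have wr: "writes bit_prog = {21, 30, 31, 32, 33, 34, 35, 36, 37, 38, 39, 40}"
    by (auto simp: bit_prog_def compare_prog_def conflict_prog_def)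
  let ?row = "\<lambda>a. map (h a) [0..<m]"
  have lenc: "length (concat (map ?row [0..<j])) = j * m" for j
    by (induction j) auto
  let ?I = "\<lambda>j i R' M'. R' 25 = 2 + (j * m + i) \<and> (\<forall>a\<ge>z. M' a = M a) \<and>
    seg M' 2 (concat (map ?row [0..<j]) @ map (h j) [0..<i])"
  let ?body = "bit_prog ;; Store 25 21 ;; Add 25 25 2"
  have 1: "run (Const 25 2) R M 1 (?I 0 0)"
    by (intro run_straight) auto
  have "run matrix_prog R M (1 + (m * ((m * (52 + 3) + 3) + 3) + 3)) (?I m 0)"
    unfolding matrix_prog_def
  proof (rule run_Seq[OF 1])
    fix R1 M1 assume I1: "?I 0 0 R1 M1" and same1: "\<And>r. r \<notin> writes (Const 25 2) \<Longrightarrow> R1 r = R r"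
    have r1: "R1 r = R r" if "r \<in> {2, 10, 12, 13, 14, 15, 16}" for r
      using same1[of r] that by auto
    show "run (For 6 10 7 (For 18 10 19 ?body)) R1 M1 (m * ((m * (52 + 3) + 3) + 3) + 3) (?I m 0)"
    proof (rule run_For[where Inv = "\<lambda>j. ?I j 0"])
      fix j R2 M2 assume j: "j < m" and I2: "?I j 0 R2 M2" and r6: "R2 6 = j"
        and same2: "\<And>r. r \<notin> insert 6 (insert 7 (writes (For 18 10 19 ?body))) \<Longrightarrow> R2 r = R1 r"
      have r2: "R2 r = R r" if "r \<in> {2, 10, 12, 13, 14, 15, 16}" for r
        using same2[of r] r1[of r] that by (auto simp: wr)
      have "run (For 18 10 19 ?body) R2 M2 (m * (52 + 3) + 3) (?I j m)"
      proof (rule run_For[where Inv = "?I j"])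
        fix i R3 M3 assume i: "i < m" and I3: "?I j i R3 M3" and r18: "R3 18 = i"
          and same3: "\<And>r. r \<notin> insert 18 (insert 19 (writes ?body)) \<Longrightarrow> R3 r = R2 r"
        have r3: "R3 r = R r" if "r \<in> {2, 10, 12, 13, 14, 15, 16}" for r
          using same3[of r] r2[of r] that by (auto simp: wr)
        have r36: "R3 6 = j" using same3[of 6] r6 by (simp add: wr)
        have high: "M3 a = M a" if "z \<le> a" for a using I3 that by blast
        have b: "run bit_prog R3 M3 50 (\<lambda>R' M'. M' = M3 \<and> R' 21 = h j i)"
          unfolding h_def n_def
        proof (rule run_bit_prog[where z = z], fold n_def, fold m_def, fold x_def)
          show "tables cs z n M3"
            using t(1) by (rule tables_cong) (use high in auto)
          show "seg M3 x (cls_list n)"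
            using t(2) by (rule seg_cong) (use high in \<open>auto simp: x_def\<close>)
          show "seg M3 (x + m) (val_list n (conflict cs))"
            using t(3) by (rule seg_cong) (use high in \<open>auto simp: x_def\<close>)
        qed (use r3 R r36 r18 i j in auto)
        have "j * m + i < m * m"
        proof -
          have "j * m + i < Suc j * m" using i by simp
          also have "\<dots> \<le> m * m" using j by (intro mult_right_mono) auto
          finally show ?thesis .
        qed
        \<comment> \<open>All writes stay below \<open>z\<close>, so the tables survive for later
          iterations.\<close>
        then have lt: "R3 25 < z" using I3 z by simp
        show "run ?body R3 M3 52 (?I j (Suc i))"
        proof (rule run_Seq[OF b], elim conjE)
          fix R4 M4 assume s4: "M4 = M3" "R4 21 = h j i" "\<And>r. r \<notin> writes bit_prog \<Longrightarrow> R4 r = R3 r"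
          have "R4 25 = R3 25" "R4 2 = 1"
            using s4(3)[of 25] s4(3)[of 2] r3[of 2] R by (simp_all add: wr)
          moreover have "seg (M3(R3 25 := h j i)) 2 ((concat (map ?row [0..<j]) @ map (h j) [0..<i]) @ [h j i])"
            using I3 by (intro seg_snoc) (auto simp: lenc)
          ultimately show "run (Store 25 21 ;; Add 25 25 2) R4 M4 2 (?I j (Suc i))"
            using s4(1,2) I3 lt by (intro run_straight) auto
        qed simp
      qed (use I2 r2 R wr in auto)
      then show "run (For 18 10 19 ?body) R2 M2 (m * (52 + 3) + 3) (?I (Suc j) 0)"
        by (rule run_mono) auto
    qed (use I1 r1 R wr in auto)
  qed simp
  then show "run ?prog R M (m * (m * 55 + 6) + 4) ?post"
    by (rule run_mono) (auto simp: h_def[abs_def] algebra_simps)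
qed

section \<open>Header of the instance and restoring an initial state\<close>

text \<open>Registers 0 and 2 hold the constants 0 and 1, so they serve as the addresses of the two
  header cells.\<close>

definition header_prog :: prog where
  "header_prog = (Store 0 10 ;; Sub 28 3 29 ;; Add 41 9 24) ;; For 6 28 7 (Add 41 41 3) ;; Store 2 41"

lemma run_header_prog:
  assumes R: "R 0 = 0" "R 2 = 1" "R 3 = n" "R 9 = n * n" "R 10 = m" "R 24 = e" "R 29 = l"
    and M: "seg M 2 xs"
  shows "run header_prog R M (n * 4 + 7) (\<lambda>R' M'. seg M' 0 (m # (n * n + e + (n - l) * n) # xs) \<and>
    (\<forall>a\<ge>2. M' a = M a))" (is "run _ _ _ _ ?Q")
proof -
  let ?p1 = "Store 0 10 ;; Sub 28 3 29 ;; Add 41 9 24"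
  have 1: "run ?p1 R M 3 (\<lambda>R' M'. M' = M(0 := m) \<and> R' = R(28 := n - l, 41 := n * n + e))"
    using R by (intro run_straight) auto
  show ?thesis
    unfolding header_prog_def
  proof (rule run_Seq[OF 1], elim conjE)
    fix R1 M1 assume s1: "M1 = M(0 := m)" "R1 = R(28 := n - l, 41 := n * n + e)"
    have 2: "run (For 6 28 7 (Add 41 41 3)) R1 M1 ((n - l) * (1 + 3) + 3)
      (\<lambda>R' M'. M' = M1 \<and> R' 41 = n * n + e + (n - l) * n)"
    proof (rule run_For[where Inv = "\<lambda>j R' M'. M' = M1 \<and> R' 41 = n * n + e + j * n"])
      fix j R' M' assume "M' = M1 \<and> R' 41 = n * n + e + j * n"
        and same: "\<And>r. r \<notin> insert 6 (insert 7 (writes (Add 41 41 3))) \<Longrightarrow> R' r = R1 r"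
      then show "run (Add 41 41 3) R' M' 1 (\<lambda>R' M'. M' = M1 \<and> R' 41 = n * n + e + Suc j * n)"
        using same[of 3] s1 R by (intro run_straight) auto
    qed (use s1 R in auto)
    show "run (For 6 28 7 (Add 41 41 3) ;; Store 2 41) R1 M1 (n * 4 + 4) ?Q"
    proof (rule run_Seq[OF 2], elim conjE)
      fix R2 M2 assume s2: "M2 = M1" "R2 41 = n * n + e + (n - l) * n"
        "\<And>r. r \<notin> writes (For 6 28 7 (Add 41 41 3)) \<Longrightarrow> R2 r = R1 r"
      have "R2 2 = 1" using s2(3)[of 2] s1 R by simp
      then show "run (Store 2 41) R2 M2 1 ?Q"
        using s2(1,2) s1(1) M
        by (intro run_straight) (auto simp: seg_def nth_Cons numeral_2_eq_2 split: nat.split)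
    qed (use mult_right_mono[of "n - l" n 4] in simp)
  qed simp
qed

text \<open>Erases everything between the end of the output and the end of the tables: a decision
  program is only specified on the exact initial memory.\<close>

definition clear_prog :: prog where
  "clear_prog = (Add 25 11 2 ;; Add 25 25 2 ;; Sub 28 17 25) ;; For 6 28 7 (Store 25 0 ;; Add 25 25 2)"

lemma run_clear_prog:
  assumes R: "R 0 = 0" "R 2 = 1" "R 11 + 2 = a" "R 17 = b"
  shows "run clear_prog R M (b * 5 + 6)
    (\<lambda>R' M'. (\<forall>i<a. M' i = M i) \<and> (\<forall>i\<ge>a. i < b \<longrightarrow> M' i = 0) \<and> (\<forall>i\<ge>b. M' i = M i))"
    (is "run _ _ _ _ ?Q")
proof -
  let ?I = "\<lambda>j R' M'. R' (25 :: nat) = a + j \<and> (\<forall>i<a. M' i = M i) \<and> (\<forall>i\<ge>a. i < a + j \<longrightarrow> M' i = (0 :: nat)) \<and>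
    (\<forall>i\<ge>b. M' i = M i)"
  have 1: "run (Add 25 11 2 ;; Add 25 25 2 ;; Sub 28 17 25) R M 3 (\<lambda>R' M'. ?I 0 R' M' \<and> R' 28 = b - a)"
    using R by (intro run_straight) auto
  show ?thesis
    unfolding clear_prog_def
  proof (rule run_Seq[OF 1])
    fix R1 M1 assume s1: "?I 0 R1 M1 \<and> R1 28 = b - a"
      "\<And>r. r \<notin> writes (Add 25 11 2 ;; Add 25 25 2 ;; Sub 28 17 25) \<Longrightarrow> R1 r = R r"
    have r1: "R1 0 = 0" "R1 2 = 1" using s1(2)[of 0] s1(2)[of 2] R by auto
    have "run (For 6 28 7 (Store 25 0 ;; Add 25 25 2)) R1 M1 ((b - a) * (2 + 3) + 3) (?I (b - a))"
    proof (rule run_For[where Inv = ?I])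
      fix j R' M' assume j: "j < b - a" and I: "?I j R' M'"
        and same: "\<And>r. r \<notin> insert 6 (insert 7 (writes (Store 25 0 ;; Add 25 25 2))) \<Longrightarrow> R' r = R1 r"
      have "R' 0 = 0" "R' 2 = 1" using same[of 0] same[of 2] r1 by auto
      then show "run (Store 25 0 ;; Add 25 25 2) R' M' 2 (?I (Suc j))"
        using I j by (intro run_straight) auto
    qed (use s1 r1 in auto)
    then show "run (For 6 28 7 (Store 25 0 ;; Add 25 25 2)) R1 M1 (b * 5 + 3) ?Q"
      by (rule run_mono) auto
  qed simp
qed

text \<open>The registers must be reset for the same reason; by \<open>writes_instance_prog\<close>
  it is enough to go up to 42.\<close>

primrec zero_prog :: "nat \<Rightarrow> prog" where
  "zero_prog 0 = Const 0 0"
| "zero_prog (Suc k) = zero_prog k ;; Const (Suc k) 0"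

lemma run_zero_prog:
  "run (zero_prog k) R M (k + 1) (\<lambda>R' M'. M' = M \<and> R' = (\<lambda>r. if r \<le> k then 0 else R r))"
proof (induction k)
  case 0
  show ?case by (intro run_straight) auto
next
  case (Suc k)
  show ?case
    unfolding zero_prog.simps
    by (rule run_Seq[OF Suc.IH], rule run_straight[where b = 1]) auto
qed

section \<open>Correctness and size of the constructed instance\<close>

text \<open>The parameter is the fill-in cost of a vertex cover of size
  \<open>n - length cs\<close>, the complement of an independent set with one occurrence per
  clause.\<close>

definition instance_of :: "literal list list \<Rightarrow> fill_in_instance" where
  "instance_of cs = (let n = length (concat cs); m = 3 * n + (n * n + n * n) in
     (m, gadget.edges n m (conflict cs) ((!) (val_list n (conflict cs))),
      n * n + gadget.edge_count n (conflict cs) + (n - length cs) * n))"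

lemma gadget_conflict:
  "gadget n (3 * n + (n * n + n * n)) (conflict cs) ((!) (val_list n (conflict cs)))"
  by (intro gadget_val_list conflict_sym) (simp add: conflict_def)

lemma instance_of_in_instances: "instance_of cs \<in> fill_in_instances"
  using gadget.simple_graph_edges[OF gadget_conflict]
  by (simp add: instance_of_def fill_in_instances_def Let_def)

lemma length_le_concat: "[] \<notin> set cs \<Longrightarrow> length cs \<le> length (concat cs)"
proof (induction cs)
  case (Cons C cs)
  then show ?case by (cases C) auto
qed simp

text \<open>Without empty clauses there are at most as many clauses as occurrences, as
  \<open>small_fill_in_iff\<close> requires.\<close>

lemma small_fill_in_instance_of:
  assumes "[] \<notin> set cs"
  shows "has_small_fill_in (instance_of cs) \<longleftrightarrow> satisfiable (nv, cs)"
proof -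
  let ?n = "length (concat cs)"
  interpret gadget ?n "3 * ?n + (?n * ?n + ?n * ?n)" "conflict cs" "(!) (val_list ?n (conflict cs))"
    by (rule gadget_conflict)
  have "has_small_fill_in (instance_of cs) \<longleftrightarrow> (\<exists>F. fill_in {..<3 * ?n + (?n * ?n + ?n * ?n)} edges F \<and>
      card F \<le> ?n * ?n + edge_count + (?n - length cs) * ?n)"
    unfolding has_small_fill_in_def instance_of_def Let_def by (simp only: prod.case)
  also have "\<dots> \<longleftrightarrow> (\<exists>I. independent I \<and> length cs \<le> card I)"
    by (rule small_fill_in_iff[OF length_le_concat[OF assms]])
  also have "\<dots> \<longleftrightarrow> satisfiable (nv, cs)"
    unfolding satisfiable_iff_independent independent_def length_occs by (simp only: conj_assoc)
  finally show ?thesis .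
qed

lemma edge_count_sum:
  fixes n :: nat
  shows "(\<Sum>j<n. \<Sum>i<n. of_bool (j < i \<and> conf j i)) = card {(u, w). u < w \<and> w < n \<and> conf u w}"
proof -
  have "{(u, w). u < w \<and> w < n \<and> conf u w} = (SIGMA u:{..<n}. {w \<in> {..<n}. u < w \<and> conf u w})"
    by auto
  then show ?thesis
    by (simp add: card_SigmaI Int_def)
qed

text \<open>A clause on three variables may contain both signs of each, hence the factor 6.\<close>

lemma length_concat_three_cnf_le:
  assumes "(v, cs) \<in> three_cnf"
  shows "length (concat cs) \<le> 6 * length cs"
proof -
  have "\<forall>C\<in>set cs. length C \<le> 6"
  proof
    fix C assume "C \<in> set cs"
    then have C: "distinct C" "card (var ` set C) \<le> 3"
      using assms by (auto simp: three_cnf_def)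
    have "set C \<subseteq> Pos ` var ` set C \<union> Neg ` var ` set C"
    proof
      fix l assume "l \<in> set C"
      then show "l \<in> Pos ` var ` set C \<union> Neg ` var ` set C"
        by (cases l rule: literal.exhaust) force+
    qed
    then have "card (set C) \<le> card (Pos ` var ` set C \<union> Neg ` var ` set C)"
      by (intro card_mono) auto
    also have "\<dots> \<le> card (Pos ` var ` set C) + card (Neg ` var ` set C)"
      by (rule card_Un_le)
    also have "\<dots> \<le> card (var ` set C) + card (var ` set C)"
      by (intro add_mono card_image_le) auto
    finally show "length C \<le> 6" using C by (simp add: distinct_card)
  qed
  then show ?thesis
    by (induction cs) auto
qed

text \<open>With \<open>N = length cs + v + 1\<close>, the bound \<open>n \<le> 6 * N\<close> gives
  \<open>m + 2 \<le> 18 * N + 72 * N * N + 2\<close> and \<open>k \<le> 3 * n * n\<close>. The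
  quadratic growth of \<open>k\<close> is decisive: a power of \<open>k\<close> with exponent below
  1/2 stays sublinear in \<open>N\<close>.\<close>

lemma instance_of_size:
  assumes "(v, cs) \<in> three_cnf" "instance_of cs = (m, E, k)"
  shows "m + 2 \<le> 92 * (length cs + v + 1)\<^sup>2" "k \<le> 108 * (length cs + v + 1)\<^sup>2"
proof -
  define n where "n = length (concat cs)"
  define N where "N = length cs + v + 1"
  interpret gadget n "3 * n + (n * n + n * n)" "conflict cs" "(!) (val_list n (conflict cs))"
    unfolding n_def by (rule gadget_conflict)
  have n: "n \<le> 6 * N" and N: "1 \<le> N" using length_concat_three_cnf_le[OF assms(1)] by (auto simp: n_def N_def)
  have nn: "n * n \<le> 36 * (N * N)" using mult_mono[OF n n] by simp
  have "N \<le> N * N" using N by simp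
  have mk: "m = 3 * n + (n * n + n * n)" "k = n * n + edge_count + (n - length cs) * n"
    using assms(2) unfolding instance_of_def Let_def n_def[symmetric] by simp_all
  show "m + 2 \<le> 92 * (length cs + v + 1)\<^sup>2"
    unfolding N_def[symmetric] mk power2_eq_square using nn n N \<open>N \<le> N * N\<close> by linarith
  have "edge_count \<le> card ({..<n} \<times> {..<n})"
    unfolding edge_count_def by (intro card_mono) auto
  then have "edge_count \<le> n * n"
    by (simp only: card_cartesian_product card_lessThan)
  moreover have "(n - length cs) * n \<le> n * n"
    by (intro mult_right_mono) auto
  ultimately have "k \<le> 3 * (n * n)"
    unfolding mk by linarith
  then show "k \<le> 108 * (length cs + v + 1)\<^sup>2"
    unfolding N_def[symmetric] power2_eq_square using nn by linarith
qed

text \<open>The sum of the bounds of all phases, with the number of occurrences replaced by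
  \<open>6 * l\<close>. The summand 2 covers the test for an empty clause and the rejecting
  assignment.\<close>

definition reduction_time :: "nat \<Rightarrow> nat \<Rightarrow> nat" where
  "reduction_time l v = (let n = 6 * l; m = 3 * n + (n * n + n * n) in
     3 + (l * 9 + 3) + 2 +
     ((n * 4 + m * 4 + 18) + ((l * (n * (8 * v + 16) + 8) + 7) + ((n * (n * 37) + n * 36 + 30) +
      ((m * (m * 55 + 6) + 4) + ((n * 4 + 7) + (((m * m + (l + n) + 4 + 3 * n + 2 * m) * 5 + 6) + 43)))))))"

text \<open>The terms in \<open>m * m\<close> dominate. They are quartic in \<open>l\<close>, as
  \<open>m\<close> is quadratic.\<close>

lemma reduction_time_le: "reduction_time l v \<le> 1000000 * (l + v + 1) ^ 4"
  unfolding reduction_time_def Let_def power4_eq_xxxx by (simp add: algebra_simps)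

section \<open>The complete decision procedure for 3SAT\<close>

text \<open>Register 2 already holds 1 when it is used as an address, so the load fetches the number
  of clauses.\<close>

definition start_prog :: prog where
  "start_prog = Const 2 1 ;; Load 29 2 ;; Const 4 2"

definition instance_prog :: prog where
  "instance_prog = sizes_prog ;; table_prog ;; vertex_prog ;; matrix_prog ;; header_prog ;; clear_prog ;; zero_prog 42"

lemma writes_zero_prog: "writes (zero_prog k) \<subseteq> {..k}"
  by (induction k) auto

lemma writes_instance_prog: "r \<in> writes instance_prog \<Longrightarrow> r \<le> 42"
  using writes_zero_prog[of 42]
  by (auto simp: instance_prog_def sizes_prog_def table_prog_def vertex_prog_def matrix_prog_def bit_prog_def
      conflict_prog_def compare_prog_def header_prog_def clear_prog_def simp del: zero_prog.simps)

schematic_goal run_instance_prog: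
  fixes cs :: "literal list list" and v :: nat
  defines "n \<equiv> length (concat cs)"
  defines "m \<equiv> 3 * n + (n * n + n * n)"
  assumes R: "R 2 = 1" "R 3 = n" "R 4 = 2 + length (code cs)" "R 29 = length cs"
      "R 0 = 0" "R 9 = 0" "R 11 = 0" "R 24 = 0"
    and code: "seg M 2 (code cs)" and zero: "\<And>a. a \<ge> 2 + length (code cs) \<Longrightarrow> M a = 0"
    and vars: "\<And>C l. C \<in> set cs \<Longrightarrow> l \<in> set C \<Longrightarrow> var l < v"
  shows "run instance_prog R M ?t
     (\<lambda>R' M'. (\<forall>r\<le>42. R' r = 0) \<and> M' = snd (init_state (encode_fill_in (instance_of cs))))"
    (is "run _ _ _ _ ?Q")
proof -
  define z where "z = m * m + length (code cs) + 4"
  have z_ge: "2 + length (code cs) \<le> z" "2 + m * m \<le> z" by (simp_all add: z_def)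
  define x where "x = z + 3 * n"
  let ?val = "(!) (val_list n (conflict cs))"
  interpret gadget n m "conflict cs" ?val
    unfolding m_def by (rule gadget_conflict)
  define mat where "mat = concat (map (\<lambda>a. map (\<lambda>b. of_bool (adj a b) :: nat) [0..<m]) [0..<m])"
  define ws where "ws = m # (n * n + edge_count + (n - length cs) * n) # mat"
  have "map (\<lambda>u. map (\<lambda>v. of_bool ({u, v} \<in> edges) :: nat) [0..<m]) [0..<m] =
      map (\<lambda>a. map (\<lambda>b. of_bool (adj a b)) [0..<m]) [0..<m]"
    by (auto simp: edges_iff)
  moreover have "instance_of cs = (m, edges, n * n + edge_count + (n - length cs) * n)"
    unfolding instance_of_def Let_def n_def[symmetric] m_def[symmetric] ..
  ultimately have ws: "encode_fill_in (instance_of cs) = ws"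
    unfolding ws_def mat_def encode_fill_in_def by (simp only: prod.case)
  have len_mat: "length mat = m * m"
    by (simp add: mat_def length_concat_map_const[where k = m])
  let ?tF = "43"
  let ?tE = "(m * m + length (code cs) + 4 + 3 * n + 2 * m) * 5 + 6 + ?tF"
  let ?tD = "n * 4 + 7 + ?tE"
  let ?tC = "m * (m * 55 + 6) + 4 + ?tD"
  let ?tB = "n * (n * 37) + n * 36 + 30 + ?tC"
  let ?tA = "length cs * (n * (8 * v + 16) + 8) + 7 + ?tB"
  let ?regs = "\<lambda>R' :: nat \<Rightarrow> nat. R' 0 = 0 \<and> R' 2 = 1 \<and> R' 3 = n \<and> R' 9 = n * n \<and> R' 10 = m \<and> R' 11 = m * m \<and>
    R' 12 = z \<and> R' 13 = z + n \<and> R' 14 = z + 2 * n \<and> R' 15 = x \<and> R' 16 = x + m \<and> R' 17 = x + 2 * m \<and>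
    R' 29 = length cs"
  have A: "run sizes_prog R M (n * 4 + m * 4 + 18) (\<lambda>R' M'. M' = M \<and> ?regs R' \<and> R' 24 = 0)"
  proof -
    have "run sizes_prog R M (R 3 * 4 + (3 * R 3 + (R 3 * R 3 + R 3 * R 3)) * 4 + 18) (\<lambda>R' M'. M' = M \<and>
      R' 9 = n * n \<and> R' 10 = m \<and> R' 11 = m * m \<and> R' 12 = z \<and> R' 13 = z + n \<and> R' 14 = z + 2 * n \<and> R' 15 = x \<and>
      R' 16 = x + m \<and> R' 17 = x + 2 * m)"
      by (rule run_mono[OF run_sizes_prog]) (use R in \<open>auto simp: m_def z_def x_def\<close>)
    then show ?thesis
      by (rule run_mono) (use R in \<open>auto simp: sizes_prog_def m_def\<close>)
  qed
  show "run instance_prog R M (n * 4 + m * 4 + 18 + ?tA) ?Q"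
    unfolding instance_prog_def
  proof (rule run_Seq[OF A], elim conjE)
    fix R1 M1 :: "nat \<Rightarrow> nat" assume s1: "M1 = M" "R1 0 = 0" "R1 2 = 1" "R1 3 = n" "R1 9 = n * n" "R1 10 = m" "R1 11 = m * m"
      "R1 12 = z" "R1 13 = z + n" "R1 14 = z + 2 * n" "R1 15 = x" "R1 16 = x + m" "R1 17 = x + 2 * m"
      "R1 29 = length cs" "R1 24 = 0"
    have B: "run table_prog R1 M1 (length cs * (n * (8 * v + 16) + 8) + 7)
       (\<lambda>R' M'. tables cs z n M' \<and> (\<forall>a\<ge>x. M' a = 0) \<and> ?regs R' \<and> R' 24 = 0)"
    proof (rule run_mono[OF run_table_prog[where cs = cs and z = z and v = v, folded n_def]])
      show "seg M1 2 (code cs)" "\<And>a. z \<le> a \<Longrightarrow> M1 a = 0"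
        using code zero s1 by (auto simp: z_def)
      fix R' M' assume e: "tables cs z n M' \<and> (\<forall>a\<ge>z + 3 * n. M' a = 0)"
        and same: "\<And>r. r \<notin> writes table_prog \<Longrightarrow> R' r = R1 r"
      have "R' r = R1 r" if "r \<in> {0, 2, 3, 9, 10, 11, 12, 13, 14, 15, 16, 17, 24, 29}" for r
        using same[of r] that by (auto simp: table_prog_def)
      then show "tables cs z n M' \<and> (\<forall>a\<ge>x. M' a = 0) \<and> ?regs R' \<and> R' 24 = 0"
        using e s1 by (simp add: x_def)
    qed (use s1 vars z_ge in simp_all)
    show "run (table_prog ;; vertex_prog ;; matrix_prog ;; header_prog ;; clear_prog ;; zero_prog 42) R1 M1 ?tA ?Q"
    proof (rule run_Seq[OF B], elim conjE)
      fix R2 M2 :: "nat \<Rightarrow> nat" assume t2: "tables cs z n M2" and z2: "\<forall>a\<ge>x. M2 a = 0" and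
        s2: "R2 0 = 0" "R2 2 = 1" "R2 3 = n" "R2 9 = n * n" "R2 10 = m" "R2 11 = m * m"
        "R2 12 = z" "R2 13 = z + n" "R2 14 = z + 2 * n" "R2 15 = x" "R2 16 = x + m" "R2 17 = x + 2 * m"
        "R2 29 = length cs" "R2 24 = 0"
      have C: "run vertex_prog R2 M2 (n * (n * 37) + n * 36 + 30) (\<lambda>R' M'.
          tables cs z n M' \<and> seg M' x (cls_list n) \<and> seg M' (x + m) (val_list n (conflict cs)) \<and>
          (\<forall>a\<ge>x + 2 * m. M' a = 0) \<and> R' 24 = edge_count \<and> ?regs R')"
      proof (rule run_mono[OF run_vertex_prog[of R2 cs z x M2, folded n_def, folded m_def]])
        fix R' M'
        assume e: "emitted x m M2 (cls_list n) (val_list n (conflict cs)) R' M' \<and>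
            R' 24 = (\<Sum>j<n. \<Sum>i<n. of_bool (j < i \<and> conflict cs j i))"
          and same: "\<And>r. r \<notin> writes vertex_prog \<Longrightarrow> R' r = R2 r"
        have "tables cs z n M'"
          using t2 by (rule tables_cong) (use e in \<open>auto simp: emitted_def x_def n_def\<close>)
        moreover have "R' r = R2 r" if "r \<in> {0, 2, 3, 9, 10, 11, 12, 13, 14, 15, 16, 17, 29}" for r
          using same[of r] that by (auto simp: vertex_prog_def conflict_prog_def compare_prog_def)
        ultimately show "tables cs z n M' \<and> seg M' x (cls_list n) \<and> seg M' (x + m) (val_list n (conflict cs)) \<and>
          (\<forall>a\<ge>x + 2 * m. M' a = 0) \<and> R' 24 = edge_count \<and> ?regs R'"
          using e[unfolded edge_count_sum, folded edge_count_def] s2 by (simp add: emitted_def)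
      qed (use s2 t2 z2 x_def in simp_all)
      show "run (vertex_prog ;; matrix_prog ;; header_prog ;; clear_prog ;; zero_prog 42) R2 M2 ?tB ?Q"
      proof (rule run_Seq[OF C], elim conjE)
        fix R3 M3 :: "nat \<Rightarrow> nat" assume t3: "tables cs z n M3" "seg M3 x (cls_list n)" "seg M3 (x + m) (val_list n (conflict cs))"
          and z3: "\<forall>a\<ge>x + 2 * m. M3 a = 0" and
          s3: "R3 24 = edge_count" "R3 0 = 0" "R3 2 = 1" "R3 3 = n" "R3 9 = n * n" "R3 10 = m" "R3 11 = m * m"
          "R3 12 = z" "R3 13 = z + n" "R3 14 = z + 2 * n" "R3 15 = x" "R3 16 = x + m" "R3 17 = x + 2 * m"
          "R3 29 = length cs"
        have D: "run matrix_prog R3 M3 (m * (m * 55 + 6) + 4) (\<lambda>R' M'. seg M' 2 mat \<and>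
          (\<forall>a\<ge>x + 2 * m. M' a = 0) \<and> R' 24 = edge_count \<and> ?regs R')"
        proof (rule run_mono[OF run_matrix_prog[of R3 cs z M3, folded n_def, folded m_def x_def]])
          fix R' M'
          assume e: "seg M' 2 (concat (map (\<lambda>a. map (\<lambda>b. of_bool (adj a b)) [0..<m]) [0..<m])) \<and> (\<forall>a\<ge>z. M' a = M3 a)"
            and same: "\<And>r. r \<notin> writes matrix_prog \<Longrightarrow> R' r = R3 r"
          have "R' r = R3 r" if "r \<in> {0, 2, 3, 9, 10, 11, 12, 13, 14, 15, 16, 17, 24, 29}" for r
            using same[of r] that
            by (auto simp: matrix_prog_def bit_prog_def conflict_prog_def compare_prog_def)
          then show "seg M' 2 mat \<and> (\<forall>a\<ge>x + 2 * m. M' a = 0) \<and> R' 24 = edge_count \<and> ?regs R'"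
            using e s3 z3 by (simp add: mat_def x_def)
        qed (use s3 t3 z_ge in simp_all)
        show "run (matrix_prog ;; header_prog ;; clear_prog ;; zero_prog 42) R3 M3 ?tC ?Q"
        proof (rule run_Seq[OF D], elim conjE)
          fix R4 M4 :: "nat \<Rightarrow> nat" assume t4: "seg M4 2 mat" and z4: "\<forall>a\<ge>x + 2 * m. M4 a = 0" and
            s4: "R4 24 = edge_count" "R4 0 = 0" "R4 2 = 1" "R4 3 = n" "R4 9 = n * n" "R4 10 = m" "R4 11 = m * m"
            "R4 17 = x + 2 * m" "R4 29 = length cs"
          have E: "run header_prog R4 M4 (n * 4 + 7) (\<lambda>R' M'. seg M' 0 ws \<and> (\<forall>a\<ge>x + 2 * m. M' a = 0) \<and>
            R' 0 = 0 \<and> R' 2 = 1 \<and> R' 11 + 2 = length ws \<and> R' 17 = x + 2 * m)"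
          proof (rule run_mono[OF run_header_prog[of R4 n m edge_count "length cs" M4 mat]])
            fix R' M'
            assume e: "seg M' 0 (m # (n * n + edge_count + (n - length cs) * n) # mat) \<and> (\<forall>a\<ge>2. M' a = M4 a)"
              and same: "\<And>r. r \<notin> writes header_prog \<Longrightarrow> R' r = R4 r"
            have "R' r = R4 r" if "r \<in> {0, 2, 11, 17}" for r
              using same[of r] that by (auto simp: header_prog_def)
            moreover have "2 \<le> x" by (simp add: x_def z_def)
            ultimately show "seg M' 0 ws \<and> (\<forall>a\<ge>x + 2 * m. M' a = 0) \<and>
              R' 0 = 0 \<and> R' 2 = 1 \<and> R' 11 + 2 = length ws \<and> R' 17 = x + 2 * m"
              using e s4 z4 by (simp add: ws_def len_mat)
          qed (use s4 t4 in auto)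
          show "run (header_prog ;; clear_prog ;; zero_prog 42) R4 M4 ?tD ?Q"
          proof (rule run_Seq[OF E], elim conjE)
            fix R5 M5 :: "nat \<Rightarrow> nat" assume s5: "seg M5 0 ws" "\<forall>a\<ge>x + 2 * m. M5 a = 0" "R5 0 = 0" "R5 2 = 1"
              "R5 11 + 2 = length ws" "R5 17 = x + 2 * m"
            have F: "run clear_prog R5 M5 ((m * m + length (code cs) + 4 + 3 * n + 2 * m) * 5 + 6)
               (\<lambda>R' M'. M' = snd (init_state ws))"
            proof (rule run_mono[OF run_clear_prog[OF s5(3-6)]])
              fix R' M'
              assume "(\<forall>i<length ws. M' i = M5 i) \<and> (\<forall>i\<ge>length ws. i < x + 2 * m \<longrightarrow> M' i = 0) \<and>
                (\<forall>i\<ge>x + 2 * m. M' i = M5 i)"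
              then show "M' = snd (init_state ws)"
                using s5(1,2) by (intro ext) (auto simp: init_state_def seg_def not_less)
            qed (simp add: x_def z_def)
            show "run (clear_prog ;; zero_prog 42) R5 M5 ?tE ?Q"
            proof (rule run_Seq[OF F])
              fix R6 M6 :: "nat \<Rightarrow> nat" assume "M6 = snd (init_state ws)"
              then show "run (zero_prog 42) R6 M6 ?tF ?Q"
                by (intro run_mono[OF run_zero_prog]) (auto simp: ws)
            qed simp
          qed simp
        qed simp
      qed simp
    qed simp
  qed simp
qed

text \<open>A formula with an empty clause is rejected at once, since the reduction is correct only
  without empty clauses.\<close>

definition decide_prog :: "prog \<Rightarrow> prog" where
  "decide_prog p = start_prog ;; count_prog ;; Cond 5 (Const 0 0) (instance_prog ;; p)"

lemma decide_prog_correct: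
  assumes cnf: "(v, cs) \<in> three_cnf"
    and p: "exec p (init_state (encode_fill_in (instance_of cs))) t s"
      "fst s 0 \<noteq> 0 \<longleftrightarrow> has_small_fill_in (instance_of cs)"
  shows "\<exists>t' s'. exec (decide_prog p) (init_state (encode_cnf (v, cs))) t' s' \<and>
    t' \<le> reduction_time (length cs) v + t \<and> (fst s' 0 \<noteq> 0 \<longleftrightarrow> satisfiable (v, cs))"
proof -
  define n where "n = length (concat cs)"
  define m where "m = 3 * n + (n * n + n * n)"
  define M where "M = snd (init_state (encode_cnf (v, cs)))"
  have enc: "encode_cnf (v, cs) = v # length cs # code cs"
    by (simp add: encode_cnf_def code_def)
  have M1: "M 1 = length cs" and M2: "seg M 2 (code cs)" and M3: "\<And>a. a \<ge> 2 + length (code cs) \<Longrightarrow> M a = 0"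
    by (auto simp: M_def enc init_state_def seg_def)
  have init: "init_state (encode_cnf (v, cs)) = ((\<lambda>_. 0), M)"
    by (simp add: M_def init_state_def)
  have vars: "var l < v" if "C \<in> set cs" "l \<in> set C" for C l
    using cnf that by (force simp: three_cnf_def)
  have n6: "n \<le> 6 * length cs" using length_concat_three_cnf_le[OF cnf] by (simp add: n_def)
  have start: "run start_prog (\<lambda>_. 0) M 3 (\<lambda>R' M'. M' = M \<and> R' = (\<lambda>_. 0)(2 := 1, 29 := length cs, 4 := 2))"
    using M1 by (intro run_straight) (auto simp: start_prog_def fun_eq_iff)
  have "run (start_prog ;; count_prog) (\<lambda>_. 0) M (3 + (length cs * 9 + 3)) (\<lambda>R' M'. M' = M \<and>
     R' 3 = n \<and> R' 4 = 2 + length (code cs) \<and> (R' 5 \<noteq> 0 \<longleftrightarrow> [] \<in> set cs) \<and>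
     R' 2 = 1 \<and> R' 29 = length cs \<and> (\<forall>r. r \<notin> {2, 3, 4, 5, 6, 7, 8, 20, 29} \<longrightarrow> R' r = 0))"
  proof (rule run_Seq[OF start], elim conjE)
    fix R1 M1 :: "nat \<Rightarrow> nat" assume s1: "M1 = M" "R1 = (\<lambda>_. 0)(2 := 1, 29 := length cs, 4 := 2)"
    show "run count_prog R1 M1 (length cs * 9 + 3) (\<lambda>R' M'. M' = M \<and>
     R' 3 = n \<and> R' 4 = 2 + length (code cs) \<and> (R' 5 \<noteq> 0 \<longleftrightarrow> [] \<in> set cs) \<and>
     R' 2 = 1 \<and> R' 29 = length cs \<and> (\<forall>r. r \<notin> {2, 3, 4, 5, 6, 7, 8, 20, 29} \<longrightarrow> R' r = 0))"
      by (rule run_mono[OF run_count_prog[where cs = cs]])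
        (use s1 M2 in \<open>auto simp: n_def count_prog_def\<close>)
  qed simp
  then obtain t1 R1 where e1: "exec (start_prog ;; count_prog) ((\<lambda>_. 0), M) t1 (R1, M)" "t1 \<le> 3 + (length cs * 9 + 3)"
    and R1: "R1 3 = n" "R1 4 = 2 + length (code cs)" "R1 5 \<noteq> 0 \<longleftrightarrow> [] \<in> set cs" "R1 2 = 1" "R1 29 = length cs"
      "\<And>r. r \<notin> {2, 3, 4, 5, 6, 7, 8, 20, 29} \<Longrightarrow> R1 r = 0"
    unfolding run_def by blast
  \<comment> \<open>The first two phases were analysed as one block, while the whole program is
    associated to the right.\<close>
  have assoc: "exec (decide_prog p) ((\<lambda>_. 0), M) (t1 + t') s'"
    if tail: "exec (Cond 5 (Const 0 0) (instance_prog ;; p)) (R1, M) t' s'" for t' s'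
  proof -
    from e1(1) obtain u1 s1 u2 where "exec start_prog ((\<lambda>_. 0), M) u1 s1" "exec count_prog s1 u2 (R1, M)"
      "t1 = u1 + u2" by (rule exec_cases)
    then show ?thesis
      unfolding decide_prog_def using exec.Seq[OF _ exec.Seq[OF _ tail]] by (simp add: add.assoc)
  qed
  show ?thesis
  proof (cases "[] \<in> set cs")
    case True
    then have "exec (Cond 5 (Const 0 0) (instance_prog ;; p)) (R1, M) (Suc 1) (R1(0 := 0), M)"
      using R1(3) by (intro exec.CondTrue exec.Const) auto
    from assoc[OF this] have "exec (decide_prog p) ((\<lambda>_. 0), M) (t1 + Suc 1) (R1(0 := 0), M)" .
    moreover have "\<not> satisfiable (v, cs)"
      using True by (auto simp: satisfiable_def intro: bexI[of _ "[]"])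
    moreover have "t1 + Suc 1 \<le> reduction_time (length cs) v + t"
      using e1(2) by (simp add: reduction_time_def Let_def)
    ultimately show ?thesis unfolding init by (intro exI conjI) auto
  next
    case False
    have R1z: "R1 r = 0" if "r \<notin> {2, 3, 4, 6, 7, 8, 20, 29}" for r
      using R1(3,6) False that by (cases "r = 5") auto
    have "run instance_prog R1 M
     ((n * 4 + m * 4 + 18) + ((length cs * (n * (8 * v + 16) + 8) + 7) + ((n * (n * 37) + n * 36 + 30) +
      ((m * (m * 55 + 6) + 4) + ((n * 4 + 7) + (((m * m + length (code cs) + 4 + 3 * n + 2 * m) * 5 + 6) + 43))))))
     (\<lambda>R' M'. (\<forall>r\<le>42. R' r = 0) \<and> M' = snd (init_state (encode_fill_in (instance_of cs))))" (is "run _ _ _ ?b _")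
      unfolding n_def m_def
      using R1 R1z M2 M3 vars by (intro run_instance_prog) (auto simp: n_def)
    then obtain t2 R2 M2 where e2: "exec instance_prog (R1, M) t2 (R2, M2)" "t2 \<le> ?b"
      and R2: "\<forall>r\<le>42. R2 r = 0" "M2 = snd (init_state (encode_fill_in (instance_of cs)))"
        "\<forall>r. r \<notin> writes instance_prog \<longrightarrow> R2 r = R1 r"
      unfolding run_def by blast
    have "R2 r = 0" for r
    \<comment> \<open>Registers beyond 42 are never written and still hold 0.\<close>
    proof (cases "r \<le> 42")
      case False
      then have "r \<notin> writes instance_prog" using writes_instance_prog by blast
      then show ?thesis using R2(3) R1z[of r] False by simp
    qed (use R2(1) in simp)
    then have "(R2, M2) = init_state (encode_fill_in (instance_of cs))"
      using R2(2) by (auto simp: init_state_def)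
    then have "exec (instance_prog ;; p) (R1, M) (t2 + t) s"
      using exec.Seq[OF e2(1)] p(1) by simp
    then have "exec (Cond 5 (Const 0 0) (instance_prog ;; p)) (R1, M) (Suc (t2 + t)) s"
      using R1(3) False by (intro exec.CondFalse) auto
    from assoc[OF this] have "exec (decide_prog p) ((\<lambda>_. 0), M) (t1 + Suc (t2 + t)) s" .
    moreover have "t1 + Suc (t2 + t) \<le> reduction_time (length cs) v + t"
    proof -
      have "m \<le> 3 * (6 * length cs) + (6 * length cs * (6 * length cs) + 6 * length cs * (6 * length cs))"
        unfolding m_def using n6 by (intro add_mono mult_mono) auto
      moreover have "length (code cs) \<le> length cs + 6 * length cs"
        using n6 by (simp add: length_code n_def)
      ultimately have "3 + (length cs * 9 + 3) + 2 + ?b \<le> reduction_time (length cs) v"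
        unfolding reduction_time_def Let_def using n6 by (intro add_mono mult_mono order.refl) auto
      then show ?thesis using e1(2) e2(2) by linarith
    qed
    ultimately show ?thesis
      unfolding init using p(2) small_fill_in_instance_of[OF False] by blast
  qed
qed

section \<open>Contradiction with the Exponential Time Hypothesis\<close>

theorem theorem1p3:
  assumes ETH
  shows "\<forall>\<delta>::real. \<delta> > 0 \<longrightarrow>
    \<not> (\<exists>p. solves_fill_in_subexp p (\<lambda>k. real k powr (1 / 2 - \<delta>)))"
proof (intro allI impI notI)
  fix \<delta> :: real
  assume "\<delta> > 0" and "\<exists>p. solves_fill_in_subexp p (\<lambda>k. real k powr (1 / 2 - \<delta>))"
  then obtain p f c where f: "f \<in> O(\<lambda>k. real k powr (1 / 2 - \<delta>))"
    and p: "decides_in_time p fill_in_instances encode_fill_in has_small_fill_in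
       (\<lambda>(n, E, k). 2 powr f k * real (n + 2) ^ c)"
    unfolding solves_fill_in_subexp_def by blast
  \<comment> \<open>Capping \<delta> at 1/4 keeps the exponent nonnegative, so that
    \<open>k powr e\<close> is monotone in \<open>k\<close>, while \<open>2 * e < 1\<close> still
    holds.\<close>
  define e where "e = 1 / 2 - min \<delta> (1 / 4)"
  have e: "0 \<le> e" "2 * e < 1" "1 / 2 - \<delta> \<le> e"
    using \<open>\<delta> > 0\<close> by (auto simp: e_def min_def)
  obtain B C where BC: "B \<ge> 0" "C \<ge> 0" "\<And>k. f k \<le> B + C * real k powr e"
    using bigo_powr_bound[OF f e(3,1)] by blast
  \<comment> \<open>\<open>X\<close> bounds the time of the reduction and \<open>Y\<close> the time
    of \<open>p\<close> on its output. \<open>F\<close> is the logarithm of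
    \<open>2 * X * Y\<close>, which dominates the sum \<open>X + Y\<close> because both factors are
    at least 1.\<close>
  define X where "X N = 1000000 * (real N + 1) ^ 4" for N
  define Y where "Y N = 2 powr (B + C * (108 * (real N + 1)\<^sup>2) powr e) * (92 * (real N + 1)\<^sup>2) ^ c" for N
  define F where "F N = log 2 (2 * X N * Y N)" for N
  have X1: "1 \<le> X N" for N
    unfolding X_def using one_le_power[of "real N + 1" 4] by linarith
  have Y1: "1 \<le> Y N" for N
  proof -
    have "1 \<le> 2 powr (B + C * (108 * (real N + 1)\<^sup>2) powr e)"
      using BC by (intro ge_one_powr_ge_zero) auto
    moreover have "1 \<le> 92 * (real N + 1)\<^sup>2"
      using one_le_power[of "real N + 1" 2] by linarith
    then have "1 \<le> (92 * (real N + 1)\<^sup>2) ^ c" by (rule one_le_power)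
    ultimately show ?thesis
      unfolding Y_def using mult_mono[of 1 _ 1] by fastforce
  qed
  have F: "2 powr F N = 2 * X N * Y N" for N
    unfolding F_def using X1[of N] Y1[of N] by (intro powr_log_cancel) (auto simp: zero_less_mult_iff)
  \<comment> \<open>The quadratic bound on \<open>k\<close> doubles the exponent \<open>e\<close>;
    the polynomial factors contribute only a logarithm and a constant.\<close>
  have "F = (\<lambda>N. (log 2 2000000 + c * log 2 92 + B) + ((4 + 2 * c) / ln 2) * ln (real N + 1) +
      (C * 108 powr e) * (real N + 1) powr (2 * e))"
  proof
    fix N
    have sq: "(108 * (real N + 1)\<^sup>2) powr e = 108 powr e * (real N + 1) powr (2 * e)"
      by (simp add: powr_mult powr_powr flip: powr_numeral)
    have "F N = log 2 (2000000 * (real N + 1) ^ 4) + log 2 (Y N)"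
      using log_mult[of 2 "2000000 * (real N + 1) ^ 4" "Y N"] Y1[of N] by (simp add: F_def X_def)
    also have "log 2 (2000000 * (real N + 1) ^ 4) = log 2 2000000 + 4 * log 2 (real N + 1)"
      by (simp add: log_mult log_nat_power)
    also have "log 2 (Y N) = B + C * (108 * (real N + 1)\<^sup>2) powr e + c * (log 2 92 + 2 * log 2 (real N + 1))"
      unfolding Y_def by (simp add: log_mult log_nat_power distrib_left)
    finally show "F N = (log 2 2000000 + c * log 2 92 + B) + ((4 + 2 * c) / ln 2) * ln (real N + 1) +
      (C * 108 powr e) * (real N + 1) powr (2 * e)"
      unfolding sq by (simp add: log_def field_simps)
  qed
  then have small: "F \<in> o(\<lambda>N. real N)"
    by (rule ssubst) (rule smallo_log_powr[OF e(2)])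
  have "decides_in_time (decide_prog p) three_cnf encode_cnf satisfiable (\<lambda>(n, cs). 2 powr F (length cs + n))"
    unfolding decides_in_time_def
  proof (intro ballI)
    fix x assume "x \<in> three_cnf"
    then obtain v cs where x: "x = (v, cs)" and cnf: "(v, cs) \<in> three_cnf" by (cases x) auto
    obtain m E k where inst: "instance_of cs = (m, E, k)" using prod_cases3 by blast
    obtain t s where t: "exec p (init_state (encode_fill_in (instance_of cs))) t s"
      "real t \<le> 2 powr f k * real (m + 2) ^ c" "fst s 0 \<noteq> 0 \<longleftrightarrow> has_small_fill_in (instance_of cs)"
      using p instance_of_in_instances[of cs] unfolding decides_in_time_def inst by fastforce
    obtain t' s' where t': "exec (decide_prog p) (init_state (encode_cnf (v, cs))) t' s'"
      "t' \<le> reduction_time (length cs) v + t" "fst s' 0 \<noteq> 0 \<longleftrightarrow> satisfiable (v, cs)"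
      using decide_prog_correct[OF cnf t(1,3)] by blast
    let ?N = "length cs + v"
    have size: "real (m + 2) \<le> 92 * (real ?N + 1)\<^sup>2" "real k \<le> 108 * (real ?N + 1)\<^sup>2"
      using instance_of_size[OF cnf inst, THEN of_nat_mono[where 'a = real]] by (simp_all add: algebra_simps)
    have "f k \<le> B + C * (108 * (real ?N + 1)\<^sup>2) powr e"
      using BC(3)[of k] mult_left_mono[OF powr_mono2[OF e(1) _ size(2)] BC(2)] by simp
    then have "2 powr f k * real (m + 2) ^ c \<le> Y ?N"
      unfolding Y_def using size(1) by (intro mult_mono power_mono) auto
    then have "real t \<le> Y ?N" using t(2) by linarith
    moreover have "real (reduction_time (length cs) v) \<le> X ?N"
      using reduction_time_le[of "length cs" v, THEN of_nat_mono[where 'a = real]]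
      unfolding X_def by (simp add: algebra_simps)
    ultimately have "real t' \<le> X ?N + Y ?N" using t'(2) by linarith
    also have "\<dots> \<le> 2 * X ?N * Y ?N"
    proof -
      have "X ?N * 1 \<le> X ?N * Y ?N" "1 * Y ?N \<le> X ?N * Y ?N"
        using X1[of ?N] Y1[of ?N] by (intro mult_left_mono mult_right_mono; linarith)+
      then show ?thesis by linarith
    qed
    finally have "real t' \<le> 2 powr F ?N" unfolding F .
    then show "\<exists>t s. exec (decide_prog p) (init_state (encode_cnf x)) t s \<and>
        real t \<le> (case x of (n, cs) \<Rightarrow> 2 powr F (length cs + n)) \<and> (fst s 0 \<noteq> 0 \<longleftrightarrow> satisfiable x)"
      unfolding x prod.case using t'(1,3) by blast
  qed
  with small have "\<not> ETH" unfolding ETH_def by blast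
  then show False using assms by contradiction
qed

end
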